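(* Let $K$ be a number field and let $DG_K=\widehat{Q}_K\ltimes_{\widehat{I}_K}G_K$ be the free deformation of the absolute Galois group $G_K$. Then the unit group $DG_K^\times$ of the profinite monoid $DG_K$ is isomorphic to $G_K$.
   Context: $K$ is a number field, $\bar K$ an algebraic closure, $G_K=\mathrm{Gal}(\bar K/K)$, and $P_K$ the set of non-zero maximal ideals of $O_K$. $\mathbb{N}$ contains $0$. $\mathscr{V}_K$ (denoted $\mathcal{V}_K$) is the set of finite primes $v$ of $\bar K$; $\mathfrak{p}_v\in P_K$ is the restriction of $v$ to $K$. $G_v\le G_K$ is the closed subgroup (decomposition group) attached to $v$, identified with the absolute Galois group of the local field $K_{\mathfrak{p}_v}$; $I_v\le G_v$ is its inertia subgroup, $q_v:G_v\to G_v/I_v$ the quotient, and $\mathrm{Frob}_v\in G_v/I_v$ the Frobenius. Weil monoid: $W_v^+:=q_v^{-1}(\{\mathrm{Frob}_v^n: n\in\mathbb{N}\})\subseteq G_v$, with the Weil group topology ($I_v$, with its profinite topology, is open). $Q_v:=W_v^+\cup\{0_v\}$ is the one-point compactification of $W_v^+$, a profinite monoid in which $0_v$ is a zero element. Free product of profinite monoids $\{D_i\}_i$: a profinite monoid $D$ with continuous homomorphisms $\iota_i:D_i\to D$ such that every family of continuous homomorphisms $\phi_i:D_i\to D'$ to a profinite monoid $D'$ factors as $\phi_i=\phi\circ\iota_i$ for a unique continuous homomorphism $\phi:D\to D'$ (no finiteness condition on the families). For finite $S\subseteq P_K$ let $\mathcal{V}_S=\{v\in\mathcal{V}_K:\mathfrak{p}_v\in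 S\}$ and let $Q_S$ be the free product of the $Q_v$, $v\in\mathcal{V}_S$. For $S\subseteq S'$ there is the surjection $Q_{S'}\to Q_S$ which is the identity on $Q_v$ for $v\in\mathcal{V}_S$ and sends $Q_v$ to $1$ for $\mathfrak{p}_v\in S'\setminus S$. Put $\widehat{Q}_K:=\varprojlim_S Q_S$. $G_K$ acts on $\mathcal{V}_K$ (via conjugation $G_{\sigma v}=\sigma G_v\sigma^{-1}$), and on $\widehat{Q}_K$ by the maps $Q_v\to Q_{\sigma v}$, $\rho\mapsto {}^\sigma\rho:=\sigma\rho\sigma^{-1}$ for $\rho\in W_v^+$, $0_v\mapsto 0_{\sigma v}$. Let $\widehat{Q}_K\ltimes G_K$ be the semidirect product, $(\rho,\sigma)(\rho',\sigma')=(\rho\cdot{}^\sigma\rho',\sigma\sigma')$. $DG_K=\widehat{Q}_K\ltimes_{\widehat{I}_K}G_K$ (with $\widehat I_K$ the free product of the $I_v$) is the profinite monoid obtained as the quotient of $\widehat{Q}_K\ltimes G_K$ by the minimal profinite congruence containing $(\rho,\sigma)\sim(\rho u_v,u_v^{-1}\sigma)$ for all $\rho\in\widehat{Q}_K$, $\sigma\in G_K$, $v\in\mathcal{V}_K$ and $u_v\in I_v$ (here $u_v$ acts on $\widehat{Q}_K$ by right multiplication via $I_v\to Q_v\to\widehat{Q}_K$, and on $G_K$ via $I_v\hookrightarrow G_K$). *)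

theory Defs
  imports "HOL-Analysis.Analysis" "HOL-Algebra.Algebraic_Closure_Type"
begin

section \<open>Profinite monoids\<close>

record 'a top_monoid = "'a monoid" +
  topol :: "'a topology"

definition topological_monoid :: "('a, 'b) top_monoid_scheme \<Rightarrow> bool" where
  "topological_monoid M \<longleftrightarrow> Group.monoid M \<and> topspace (topol M) = carrier M \<and>
     continuous_map (prod_topology (topol M) (topol M)) (topol M) (\<lambda>(x, y). x \<otimes>\<^bsub>M\<^esub> y)"

text \<open>Continuous homomorphisms of monoids; the constant \<^const>\<open>hom\<close> does not require that
  the unit be preserved.\<close>

definition chom :: "('a, 'c) top_monoid_scheme \<Rightarrow> ('b, 'd) top_monoid_scheme \<Rightarrow> ('a \<Rightarrow> 'b) set" where
  "chom M N = {f \<in> hom M N. f \<one>\<^bsub>M\<^esub> = \<one>\<^bsub>N\<^esub> \<and> continuous_map (topol M) (topol N) f}"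

definition top_iso :: "('a, 'c) top_monoid_scheme \<Rightarrow> ('b, 'd) top_monoid_scheme \<Rightarrow> ('a \<Rightarrow> 'b) set" where
  "top_iso M N = {f \<in> iso M N. homeomorphic_map (topol M) (topol N) f}"

definition discrete_monoid :: "'a monoid \<Rightarrow> 'a top_monoid" where
  "discrete_monoid N = monoid.extend N \<lparr>topol = discrete_topology (carrier N)\<rparr>"

text \<open>A profinite monoid is an inverse limit of finite discrete monoids; equivalently, and this is
  the form used here, a compact Hausdorff topological monoid whose points are separated by
  continuous homomorphisms to finite discrete monoids. Every finite monoid is isomorphic to one
  with elements in \<^typ>\<open>nat\<close>.\<close>

definition profinite_monoid :: "('a, 'b) top_monoid_scheme \<Rightarrow> bool" where
  "profinite_monoid M \<longleftrightarrow> topological_monoid M \<and> compact_space (topol M) \<and> Hausdorff_space (topol M) \<and>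
     (\<forall>x \<in> carrier M. \<forall>y \<in> carrier M. x \<noteq> y \<longrightarrow>
        (\<exists>(N :: nat monoid) f. Group.monoid N \<and> finite (carrier N) \<and>
           f \<in> chom M (discrete_monoid N) \<and> f x \<noteq> f y))"

definition sub_monoid :: "'a top_monoid \<Rightarrow> 'a set \<Rightarrow> 'a top_monoid" where
  "sub_monoid M H = M\<lparr>carrier := H, topol := subtopology (topol M) H\<rparr>"

definition product_monoid :: "'j set \<Rightarrow> ('j \<Rightarrow> 'a top_monoid) \<Rightarrow> ('j \<Rightarrow> 'a) top_monoid" where
  "product_monoid J M =
     \<lparr>carrier = (\<Pi>\<^sub>E j\<in>J. carrier (M j)),
      mult = (\<lambda>x y. \<lambda>j\<in>J. x j \<otimes>\<^bsub>M j\<^esub> y j),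
      one = (\<lambda>j\<in>J. \<one>\<^bsub>M j\<^esub>),
      topol = product_topology (\<lambda>j. topol (M j)) J\<rparr>"

definition inverse_limit ::
  "'j set \<Rightarrow> ('j \<Rightarrow> 'j \<Rightarrow> bool) \<Rightarrow> ('j \<Rightarrow> 'a top_monoid) \<Rightarrow> ('j \<Rightarrow> 'j \<Rightarrow> 'a \<Rightarrow> 'a) \<Rightarrow> ('j \<Rightarrow> 'a) top_monoid" where
  "inverse_limit J ord M t = sub_monoid (product_monoid J M)
     {x \<in> (\<Pi>\<^sub>E j\<in>J. carrier (M j)). \<forall>i\<in>J. \<forall>j\<in>J. ord i j \<longrightarrow> t i j (x j) = x i}"

lemma discrete_monoid_simps [simp]:
  "carrier (discrete_monoid N) = carrier N"
  "x \<otimes>\<^bsub>discrete_monoid N\<^esub> y = x \<otimes>\<^bsub>N\<^esub> y"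
  "\<one>\<^bsub>discrete_monoid N\<^esub> = \<one>\<^bsub>N\<^esub>"
  "topol (discrete_monoid N) = discrete_topology (carrier N)"
  by (simp_all add: discrete_monoid_def monoid.defs)

lemma sub_monoid_simps [simp]:
  "carrier (sub_monoid M H) = H"
  "x \<otimes>\<^bsub>sub_monoid M H\<^esub> y = x \<otimes>\<^bsub>M\<^esub> y"
  "\<one>\<^bsub>sub_monoid M H\<^esub> = \<one>\<^bsub>M\<^esub>"
  "topol (sub_monoid M H) = subtopology (topol M) H"
  by (simp_all add: sub_monoid_def)

text \<open>The group of units of a (compact) topological monoid, with the subspace topology.\<close>

definition unit_group :: "'a top_monoid \<Rightarrow> 'a top_monoid" where
  "unit_group M = monoid.extend (units_of M) \<lparr>topol = subtopology (topol M) (Units M)\<rparr>"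

definition semidirect ::
  "'a top_monoid \<Rightarrow> 'g top_monoid \<Rightarrow> ('g \<Rightarrow> 'a \<Rightarrow> 'a) \<Rightarrow> ('a \<times> 'g) top_monoid" where
  "semidirect A G act =
     \<lparr>carrier = carrier A \<times> carrier G,
      mult = (\<lambda>(a, g) (b, h). (a \<otimes>\<^bsub>A\<^esub> act g b, g \<otimes>\<^bsub>G\<^esub> h)),
      one = (\<one>\<^bsub>A\<^esub>, \<one>\<^bsub>G\<^esub>),
      topol = prod_topology (topol A) (topol G)\<rparr>"


section \<open>Profinite congruences\<close>

definition congruence_on :: "('a, 'b) top_monoid_scheme \<Rightarrow> ('a \<times> 'a) set \<Rightarrow> bool" where
  "congruence_on M r \<longleftrightarrow> equiv (carrier M) r \<and>
     (\<forall>x y x' y'. (x, y) \<in> r \<longrightarrow> (x', y') \<in> r \<longrightarrow> (x \<otimes>\<^bsub>M\<^esub> x', y \<otimes>\<^bsub>M\<^esub> y') \<in> r)"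

definition quotient_topology :: "'a topology \<Rightarrow> ('a \<times> 'a) set \<Rightarrow> 'a set topology" where
  "quotient_topology T r = topology (\<lambda>U. U \<subseteq> topspace T // r \<and> openin T (\<Union>U))"

definition quotient_monoid :: "'a top_monoid \<Rightarrow> ('a \<times> 'a) set \<Rightarrow> 'a set top_monoid" where
  "quotient_monoid M r =
     \<lparr>carrier = carrier M // r,
      mult = (\<lambda>A B. \<Union>x\<in>A. \<Union>y\<in>B. r `` {x \<otimes>\<^bsub>M\<^esub> y}),
      one = r `` {\<one>\<^bsub>M\<^esub>},
      topol = quotient_topology (topol M) r\<rparr>"

definition profinite_congruence :: "'a top_monoid \<Rightarrow> ('a \<times> 'a) set \<Rightarrow> bool" where
  "profinite_congruence M r \<longleftrightarrow> congruence_on M r \<and> profinite_monoid (quotient_monoid M r)"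

definition min_profinite_congruence :: "'a top_monoid \<Rightarrow> ('a \<times> 'a) set \<Rightarrow> ('a \<times> 'a) set" where
  "min_profinite_congruence M R = \<Inter> {r. profinite_congruence M r \<and> R \<subseteq> r}"

lemma openin_quotient_topology:
  assumes "equiv (topspace T) r"
  shows "openin (quotient_topology T r) U \<longleftrightarrow> U \<subseteq> topspace T // r \<and> openin T (\<Union>U)"
proof -
  have inter: "\<Union>(A \<inter> B) = \<Union>A \<inter> \<Union>B" if "A \<subseteq> topspace T // r" "B \<subseteq> topspace T // r" for A B
    using that quotient_disj[OF assms] by blast
  have "istopology (\<lambda>U. U \<subseteq> topspace T // r \<and> openin T (\<Union>U))"
    unfolding istopology_def
  proof (intro conjI allI impI)
    fix A B assume "A \<subseteq> topspace T // r \<and> openin T (\<Union>A)" "B \<subseteq> topspace T // r \<and> openin T (\<Union>B)"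
    then show "A \<inter> B \<subseteq> topspace T // r" "openin T (\<Union>(A \<inter> B))"
      using inter[of A B] by (auto intro: openin_Int)
  next
    fix \<U> assume H: "\<forall>U\<in>\<U>. U \<subseteq> topspace T // r \<and> openin T (\<Union>U)"
    have "\<Union>(\<Union>\<U>) = \<Union>(Union ` \<U>)" by blast
    then show "openin T (\<Union>(\<Union>\<U>))" using H by (metis (no_types, lifting) image_iff openin_Union)
    show "\<Union>\<U> \<subseteq> topspace T // r" using H by blast
  qed
  then show ?thesis
    by (simp add: quotient_topology_def)
qed

lemma quotient_map_quotient_topology:
  assumes r: "equiv (topspace T) r"
  shows "quotient_map T (quotient_topology T r) (\<lambda>x. r `` {x})"
proof -
  have ts: "topspace (quotient_topology T r) = topspace T // r"
  proof -
    have "openin (quotient_topology T r) (topspace T // r)"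
      using openin_quotient_topology[OF r] Union_quotient[OF r] by simp
    then show ?thesis
      using openin_quotient_topology[OF r] openin_subset openin_topspace by (metis subset_antisym)
  qed
  show ?thesis
    unfolding quotient_map_def
  proof (intro conjI allI impI)
    show "(\<lambda>x. r `` {x}) ` topspace T = topspace (quotient_topology T r)"
      unfolding ts by (auto simp: quotient_def)
    fix U assume "U \<subseteq> topspace (quotient_topology T r)"
    then have U: "U \<subseteq> topspace T // r" by (simp add: ts)
    have "{x \<in> topspace T. r `` {x} \<in> U} = \<Union>U"
    proof (intro Set.set_eqI iffI)
      fix x assume "x \<in> {x \<in> topspace T. r `` {x} \<in> U}"
      then show "x \<in> \<Union>U" using equiv_class_self[OF r] by blast
    next
      fix x assume "x \<in> \<Union>U"
      then obtain A where A: "x \<in> A" "A \<in> U" by blast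
      then have "A \<in> topspace T // r" using U by blast
      then obtain y where y: "y \<in> topspace T" "A = r `` {y}" by (rule quotientE)
      then have "(y, x) \<in> r" using A by simp
      then have "x \<in> topspace T" "r `` {x} = A"
        using y r equiv_class_eq[OF r] by (auto simp: equiv_def)
      then show "x \<in> {x \<in> topspace T. r `` {x} \<in> U}" using A by simp
    qed
    then show "openin T {x \<in> topspace T. r `` {x} \<in> U} = openin (quotient_topology T r) U"
      using openin_quotient_topology[OF r] U by simp
  qed
qed

context
  fixes M :: "'a top_monoid" and r :: "('a \<times> 'a) set"
  assumes M: "topological_monoid M" and r: "congruence_on M r"
begin

lemma congruence_equiv: "equiv (carrier M) r"
  using r by (simp add: congruence_on_def)

lemma quotient_monoid_mult:
  assumes "x \<in> carrier M" "y \<in> carrier M"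
  shows "r `` {x} \<otimes>\<^bsub>quotient_monoid M r\<^esub> r `` {y} = r `` {x \<otimes>\<^bsub>M\<^esub> y}"
proof -
  have eq: "r `` {x' \<otimes>\<^bsub>M\<^esub> y'} = r `` {x \<otimes>\<^bsub>M\<^esub> y}" if "x' \<in> r `` {x}" "y' \<in> r `` {y}" for x' y'
    using that r equiv_class_eq[OF congruence_equiv, of "x \<otimes>\<^bsub>M\<^esub> y" "x' \<otimes>\<^bsub>M\<^esub> y'"]
    by (simp add: congruence_on_def)
  have ne: "r `` {x} \<noteq> {}" "r `` {y} \<noteq> {}"
    using assms equiv_class_self[OF congruence_equiv] by blast+
  have "(\<Union>x'\<in>r `` {x}. \<Union>y'\<in>r `` {y}. r `` {x' \<otimes>\<^bsub>M\<^esub> y'}) =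
      (\<Union>x'\<in>r `` {x}. \<Union>y'\<in>r `` {y}. r `` {x \<otimes>\<^bsub>M\<^esub> y})"
    by (intro SUP_cong refl eq)
  also have "\<dots> = r `` {x \<otimes>\<^bsub>M\<^esub> y}"
    using ne by simp
  finally show ?thesis
    by (simp add: quotient_monoid_def)
qed

lemma quotient_map_quotient_monoid:
  "quotient_map (topol M) (topol (quotient_monoid M r)) (\<lambda>x. r `` {x})"
  using M congruence_equiv quotient_map_quotient_topology[of "topol M" r]
  by (simp add: topological_monoid_def quotient_monoid_def)

lemma quotient_monoid_monoid: "Group.monoid (quotient_monoid M r)"
proof -
  interpret Group.monoid M using M by (simp add: topological_monoid_def)
  have c: "carrier (quotient_monoid M r) = (\<lambda>x. r `` {x}) ` carrier M"
    by (auto simp: quotient_monoid_def quotient_def)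
  have o: "\<one>\<^bsub>quotient_monoid M r\<^esub> = r `` {\<one>\<^bsub>M\<^esub>}"
    by (simp add: quotient_monoid_def)
  show ?thesis
    by (rule monoidI) (auto simp: c o quotient_monoid_mult m_assoc)
qed

lemma quotient_chom: "(\<lambda>x. r `` {x}) \<in> chom M (quotient_monoid M r)"
proof -
  have "r `` {x} \<in> carrier (quotient_monoid M r)" if "x \<in> carrier M" for x
    using that by (simp add: quotient_monoid_def quotientI)
  moreover have "\<one>\<^bsub>quotient_monoid M r\<^esub> = r `` {\<one>\<^bsub>M\<^esub>}"
    by (simp add: quotient_monoid_def)
  ultimately show ?thesis
    using quotient_imp_continuous_map[OF quotient_map_quotient_monoid]
    by (simp add: chom_def hom_def quotient_monoid_mult)
qed

lemma profinite_congruenceI: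
  assumes cpt: "compact_space (topol M)"
    and sep: "\<And>x y. x \<in> carrier M \<Longrightarrow> y \<in> carrier M \<Longrightarrow> (x, y) \<notin> r \<Longrightarrow>
      \<exists>(N :: nat monoid) f. Group.monoid N \<and> finite (carrier N) \<and> f \<in> chom M (discrete_monoid N) \<and>
         (\<forall>(a, b) \<in> r. f a = f b) \<and> f x \<noteq> f y"
  shows "profinite_congruence M r"
proof -
  define Q where "Q = quotient_monoid M r"
  define q where "q = (\<lambda>x. r `` {x})"
  have ts: "topspace (topol M) = carrier M" using M by (simp add: topological_monoid_def)
  have qm: "quotient_map (topol M) (topol Q) q"
    using quotient_map_quotient_monoid by (simp add: Q_def q_def)
  have cQ: "carrier Q = q ` carrier M"
    by (auto simp: Q_def q_def quotient_monoid_def quotient_def)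
  have tQ: "topspace (topol Q) = carrier Q"
    using qm ts cQ by (simp add: quotient_map_def)
  have qmult: "q x \<otimes>\<^bsub>Q\<^esub> q y = q (x \<otimes>\<^bsub>M\<^esub> y)" if "x \<in> carrier M" "y \<in> carrier M" for x y
    using quotient_monoid_mult that by (simp add: Q_def q_def)
  have cptQ: "compact_space (topol Q)"
    using image_compactin[of "topol M" "topspace (topol M)" "topol Q" q] cpt qm quotient_imp_continuous_map[OF qm]
    by (simp add: compact_space_def quotient_map_def)
  have sepQ: "\<exists>(N :: nat monoid) f. Group.monoid N \<and> finite (carrier N) \<and>
      f \<in> chom Q (discrete_monoid N) \<and> f A \<noteq> f B" if AB: "A \<in> carrier Q" "B \<in> carrier Q" "A \<noteq> B" for A B
  proof -
    obtain x y where xy: "A = q x" "B = q y" "x \<in> carrier M" "y \<in> carrier M"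
      using AB cQ by auto
    then have "(x, y) \<notin> r" using AB equiv_class_eq[OF congruence_equiv] by (auto simp: q_def)
    then obtain N :: "nat monoid" and f where N: "Group.monoid N" "finite (carrier N)"
      and f: "f \<in> chom M (discrete_monoid N)" and resp: "\<forall>(a, b) \<in> r. f a = f b" and ne: "f x \<noteq> f y"
      using sep xy by blast
    define g where "g C = f (SOME a. a \<in> C)" for C
    have gq: "g (q a) = f a" if "a \<in> carrier M" for a
    proof -
      have "a \<in> q a" using that equiv_class_self[OF congruence_equiv] unfolding q_def by blast
      then have "(SOME b. b \<in> q a) \<in> q a" by (rule someI)
      then show ?thesis using resp by (auto simp: g_def q_def)
    qed
    have "continuous_map (topol Q) (discrete_topology (carrier N)) g"
    proof (rule continuous_compose_quotient_map[OF qm])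
      show "continuous_map (topol M) (discrete_topology (carrier N)) (g \<circ> q)"
        by (rule continuous_map_eq[of _ _ f]) (use f gq ts in \<open>auto simp: chom_def\<close>)
    qed
    moreover have "g \<in> hom Q (discrete_monoid N)"
      using f M by (auto simp: hom_def chom_def cQ gq qmult Pi_iff topological_monoid_def monoid.m_closed)
    moreover have "g \<one>\<^bsub>Q\<^esub> = \<one>\<^bsub>N\<^esub>"
    proof -
      have "\<one>\<^bsub>Q\<^esub> = q \<one>\<^bsub>M\<^esub>" by (simp add: Q_def q_def quotient_monoid_def)
      then show ?thesis using gq f M by (simp add: chom_def topological_monoid_def monoid.one_closed)
    qed
    ultimately have "g \<in> chom Q (discrete_monoid N)" by (simp add: chom_def)
    moreover have "g A \<noteq> g B" using ne xy gq by simp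
    ultimately show ?thesis using N by blast
  qed
  have hausQ: "Hausdorff_space (topol Q)"
    unfolding Hausdorff_space_def
  proof (intro allI impI)
    fix A B assume "A \<in> topspace (topol Q) \<and> B \<in> topspace (topol Q) \<and> A \<noteq> B"
    then obtain N :: "nat monoid" and f where f: "f \<in> chom Q (discrete_monoid N)" "f A \<noteq> f B"
      and AB: "A \<in> topspace (topol Q)" "B \<in> topspace (topol Q)"
      using sepQ tQ by metis
    have c: "continuous_map (topol Q) (discrete_topology (carrier N)) f"
      using f by (simp add: chom_def)
    have fAB: "f A \<in> carrier N" "f B \<in> carrier N"
      using c AB by (auto simp: continuous_map_def)
    let ?U = "{x \<in> topspace (topol Q). f x \<in> {f A}}" and ?V = "{x \<in> topspace (topol Q). f x \<in> {f B}}"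
    have "openin (topol Q) ?U" "openin (topol Q) ?V"
      using fAB openin_continuous_map_preimage[OF c, of "{f A}"]
        openin_continuous_map_preimage[OF c, of "{f B}"] by simp_all
    moreover have "A \<in> ?U" "B \<in> ?V" "disjnt ?U ?V"
      using AB f by (auto simp: disjnt_def)
    ultimately show "\<exists>U V. openin (topol Q) U \<and> openin (topol Q) V \<and> A \<in> U \<and> B \<in> V \<and> disjnt U V"
      by blast
  qed
  have "continuous_map (prod_topology (topol Q) (topol Q)) (topol Q) (\<lambda>(x, y). x \<otimes>\<^bsub>Q\<^esub> y)"
  proof (rule continuous_compose_quotient_map)
    show "quotient_map (prod_topology (topol M) (topol M)) (prod_topology (topol Q) (topol Q)) (\<lambda>(x, y). (q x, q y))"
    proof (rule continuous_imp_quotient_map)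
      show "continuous_map (prod_topology (topol M) (topol M)) (prod_topology (topol Q) (topol Q)) (\<lambda>(x, y). (q x, q y))"
        using quotient_imp_continuous_map[OF qm] by (simp add: continuous_map_prod_top)
      show "compact_space (prod_topology (topol M) (topol M))"
        using cpt by (simp add: compact_space_prod_topology)
      show "Hausdorff_space (prod_topology (topol Q) (topol Q))"
        using hausQ by (simp add: Hausdorff_space_prod_topology)
      show "(\<lambda>(x, y). (q x, q y)) ` topspace (prod_topology (topol M) (topol M)) =
          topspace (prod_topology (topol Q) (topol Q))"
        by (auto simp: ts tQ cQ)
    qed
    have "continuous_map (prod_topology (topol M) (topol M)) (topol Q) (q \<circ> (\<lambda>(x, y). x \<otimes>\<^bsub>M\<^esub> y))"
      using M quotient_imp_continuous_map[OF qm]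
      by (auto simp: topological_monoid_def intro: continuous_map_compose)
    then show "continuous_map (prod_topology (topol M) (topol M)) (topol Q)
        ((\<lambda>(x, y). x \<otimes>\<^bsub>Q\<^esub> y) \<circ> (\<lambda>(x, y). (q x, q y)))"
      by (rule continuous_map_eq) (auto simp: ts qmult)
  qed
  then have "profinite_monoid Q"
    using cptQ hausQ sepQ tQ quotient_monoid_monoid
    by (auto simp: profinite_monoid_def topological_monoid_def Q_def)
  then show ?thesis using r by (simp add: profinite_congruence_def Q_def)
qed

end

text \<open>The intersection in \<^const>\<open>min_profinite_congruence\<close> is the smallest profinite congruence
  containing the given relation.\<close>

theorem min_profinite_congruence:
  assumes M: "topological_monoid M" "compact_space (topol M)" and R: "R \<subseteq> carrier M \<times> carrier M"
  shows "profinite_congruence M (min_profinite_congruence M R)"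
    and "R \<subseteq> min_profinite_congruence M R"
    and "profinite_congruence M r \<Longrightarrow> R \<subseteq> r \<Longrightarrow> min_profinite_congruence M R \<subseteq> r"
proof -
  interpret Group.monoid M using M by (simp add: topological_monoid_def)
  let ?F = "{r. profinite_congruence M r \<and> R \<subseteq> r}"
  have cong: "congruence_on M r" if "r \<in> ?F" for r
    using that by (simp add: profinite_congruence_def)
  have all: "congruence_on M (carrier M \<times> carrier M)"
    by (auto simp: congruence_on_def equiv_def refl_on_def sym_def trans_def)
  have "carrier M \<times> carrier M \<in> ?F"
    using R by (auto intro: profinite_congruenceI[OF M(1) all M(2)])
  then have "\<Inter>?F \<subseteq> carrier M \<times> carrier M" by (rule Inter_lower)
  moreover have "refl_on (carrier M) (\<Inter>?F)"
    using cong by (simp add: congruence_on_def equiv_def refl_on_def)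
  moreover have "sym (\<Inter>?F)"
    using cong by (intro symI InterI) (meson InterD congruence_on_def equiv_def symD)
  moreover have "trans (\<Inter>?F)"
    using cong by (intro transI InterI) (meson InterD congruence_on_def equiv_def transD)
  moreover have "(x \<otimes>\<^bsub>M\<^esub> x', y \<otimes>\<^bsub>M\<^esub> y') \<in> \<Inter>?F"
    if "(x, y) \<in> \<Inter>?F" "(x', y') \<in> \<Inter>?F" for x y x' y'
  proof (rule InterI)
    fix r assume r: "r \<in> ?F"
    then have "(x, y) \<in> r" "(x', y') \<in> r" using that by blast+
    then show "(x \<otimes>\<^bsub>M\<^esub> x', y \<otimes>\<^bsub>M\<^esub> y') \<in> r"
      using cong[OF r] by (simp add: congruence_on_def)
  qed
  ultimately have "congruence_on M (\<Inter>?F)"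
    unfolding congruence_on_def equiv_def by blast
  then show "profinite_congruence M (min_profinite_congruence M R)"
    unfolding min_profinite_congruence_def
  proof (rule profinite_congruenceI[OF M(1) _ M(2)])
    fix x y assume xy: "x \<in> carrier M" "y \<in> carrier M" "(x, y) \<notin> \<Inter>?F"
    then obtain r where r: "profinite_congruence M r" "R \<subseteq> r" "(x, y) \<notin> r" by blast
    then have rc: "congruence_on M r" by (simp add: profinite_congruence_def)
    have ch: "(\<lambda>x. r `` {x}) \<in> chom M (quotient_monoid M r)"
      by (rule quotient_chom[OF M(1) rc])
    have eq: "equiv (carrier M) r" using rc by (simp add: congruence_on_def)
    have "r `` {x} \<noteq> r `` {y}" using xy r eq by (simp add: eq_equiv_class_iff)
    moreover have "r `` {x} \<in> carrier (quotient_monoid M r)" "r `` {y} \<in> carrier (quotient_monoid M r)"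
      using xy by (auto simp: quotient_monoid_def intro: quotientI)
    ultimately obtain N :: "nat monoid" and f where N: "Group.monoid N" "finite (carrier N)"
      and f: "f \<in> chom (quotient_monoid M r) (discrete_monoid N)" "f (r `` {x}) \<noteq> f (r `` {y})"
      using r unfolding profinite_congruence_def profinite_monoid_def by meson
    have "(\<lambda>x. f (r `` {x})) \<in> chom M (discrete_monoid N)"
      using ch f unfolding chom_def hom_def
      by (auto simp: Pi_iff dest: continuous_map_compose simp: o_def)
    moreover have "\<forall>(a, b)\<in>\<Inter>?F. f (r `` {a}) = f (r `` {b})"
      using r equiv_class_eq[OF eq] by fastforce
    ultimately show "\<exists>(N :: nat monoid) f. Group.monoid N \<and> finite (carrier N) \<and>
       f \<in> chom M (discrete_monoid N) \<and> (\<forall>(a, b)\<in>\<Inter>?F. f a = f b) \<and> f x \<noteq> f y"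
      using N f(2) by (intro exI[of _ N] exI[of _ "\<lambda>x. f (r `` {x})"]) blast
  qed
qed (auto simp: min_profinite_congruence_def)


section \<open>Free products of profinite monoids\<close>

text \<open>The free product of the \<open>D i\<close> is realised inside the product of all finite discrete monoids
  \<open>N\<close>, indexed by all families of continuous homomorphisms \<open>\<phi> i : D i \<rightarrow> N\<close>, as the
  closed submonoid generated by the images of the \<open>D i\<close>. The results
  \<open>profinite_monoid_free_product\<close>, \<open>free_inj_chom\<close> and \<open>free_product_universal\<close> below show that
  it has the defining universal property with respect to profinite monoids of arbitrary type.\<close>

type_synonym ('i, 'b) free_index = "nat monoid \<times> ('i \<Rightarrow> 'b \<Rightarrow> nat)"

definition free_targets :: "'i set \<Rightarrow> ('i \<Rightarrow> 'b top_monoid) \<Rightarrow> ('i, 'b) free_index set" where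
  "free_targets I D = {(N, \<phi>). Group.monoid N \<and> finite (carrier N) \<and>
     (\<forall>i\<in>I. \<phi> i \<in> chom (D i) (discrete_monoid N))}"

definition free_ambient ::
  "'i set \<Rightarrow> ('i \<Rightarrow> 'b top_monoid) \<Rightarrow> (('i, 'b) free_index \<Rightarrow> nat) top_monoid" where
  "free_ambient I D = product_monoid (free_targets I D) (\<lambda>(N, \<phi>). discrete_monoid N)"

definition free_inj ::
  "'i set \<Rightarrow> ('i \<Rightarrow> 'b top_monoid) \<Rightarrow> 'i \<Rightarrow> 'b \<Rightarrow> ('i, 'b) free_index \<Rightarrow> nat" where
  "free_inj I D i x = (\<lambda>(N, \<phi>)\<in>free_targets I D. \<phi> i x)"

definition free_product ::
  "'i set \<Rightarrow> ('i \<Rightarrow> 'b top_monoid) \<Rightarrow> (('i, 'b) free_index \<Rightarrow> nat) top_monoid" where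
  "free_product I D = sub_monoid (free_ambient I D)
     (\<Inter> {H. submonoid H (free_ambient I D) \<and> closedin (topol (free_ambient I D)) H \<and>
            (\<forall>i\<in>I. free_inj I D i ` carrier (D i) \<subseteq> H)})"

text \<open>The continuous homomorphism out of the free product that is determined by \<open>\<phi>\<close>.\<close>

definition free_lift ::
  "'i set \<Rightarrow> ('i \<Rightarrow> 'b top_monoid) \<Rightarrow> 'c top_monoid \<Rightarrow> ('i \<Rightarrow> 'b \<Rightarrow> 'c) \<Rightarrow>
     (('i, 'b) free_index \<Rightarrow> nat) \<Rightarrow> 'c" where
  "free_lift I D D' \<phi> = (THE f. f \<in> extensional (carrier (free_product I D)) \<and>
     f \<in> chom (free_product I D) D' \<and>
     (\<forall>i\<in>I. \<forall>x\<in>carrier (D i). f (free_inj I D i x) = \<phi> i x))"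

context
  fixes I :: "'i set" and D :: "'i \<Rightarrow> 'b top_monoid"
begin

lemma free_ambient_simps:
  "carrier (free_ambient I D) = (\<Pi>\<^sub>E (N, \<phi>)\<in>free_targets I D. carrier N)"
  "x \<otimes>\<^bsub>free_ambient I D\<^esub> y = (\<lambda>(N, \<phi>)\<in>free_targets I D. x (N, \<phi>) \<otimes>\<^bsub>N\<^esub> y (N, \<phi>))"
  "\<one>\<^bsub>free_ambient I D\<^esub> = (\<lambda>(N, \<phi>)\<in>free_targets I D. \<one>\<^bsub>N\<^esub>)"
  "topol (free_ambient I D) = product_topology (\<lambda>(N, \<phi>). discrete_topology (carrier N)) (free_targets I D)"
  "topspace (topol (free_ambient I D)) = carrier (free_ambient I D)"
proof -
  have *: "carrier (case p of (N, \<phi>) \<Rightarrow> discrete_monoid N) = (case p of (N, \<phi>) \<Rightarrow> carrier N)"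
    "topol (case p of (N, \<phi>) \<Rightarrow> discrete_monoid N) = (case p of (N, \<phi>) \<Rightarrow> discrete_topology (carrier N))"
    "topspace (case p of (N, \<phi>) \<Rightarrow> discrete_topology (carrier N)) = (case p of (N, \<phi>) \<Rightarrow> carrier N)"
    for p :: "('i, 'b) free_index"
    by (simp_all split: prod.split)
  show "carrier (free_ambient I D) = (\<Pi>\<^sub>E (N, \<phi>)\<in>free_targets I D. carrier N)"
    "x \<otimes>\<^bsub>free_ambient I D\<^esub> y = (\<lambda>(N, \<phi>)\<in>free_targets I D. x (N, \<phi>) \<otimes>\<^bsub>N\<^esub> y (N, \<phi>))"
    "\<one>\<^bsub>free_ambient I D\<^esub> = (\<lambda>(N, \<phi>)\<in>free_targets I D. \<one>\<^bsub>N\<^esub>)"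
    "topol (free_ambient I D) = product_topology (\<lambda>(N, \<phi>). discrete_topology (carrier N)) (free_targets I D)"
    "topspace (topol (free_ambient I D)) = carrier (free_ambient I D)"
    unfolding free_ambient_def product_monoid_def
    by (auto simp: * restrict_def fun_eq_iff split: prod.split)
qed

lemma monoid_free_ambient: "Group.monoid (free_ambient I D)"
proof (rule monoidI)
  fix x y z
  assume "x \<in> carrier (free_ambient I D)" "y \<in> carrier (free_ambient I D)" "z \<in> carrier (free_ambient I D)"
  then show "x \<otimes>\<^bsub>free_ambient I D\<^esub> y \<otimes>\<^bsub>free_ambient I D\<^esub> z =
      x \<otimes>\<^bsub>free_ambient I D\<^esub> (y \<otimes>\<^bsub>free_ambient I D\<^esub> z)"
    by (auto simp: free_ambient_simps fun_eq_iff restrict_def PiE_iff free_targets_def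
        intro!: monoid.m_assoc split: prod.splits)
next
  fix x y
  assume "x \<in> carrier (free_ambient I D)" "y \<in> carrier (free_ambient I D)"
  then show "x \<otimes>\<^bsub>free_ambient I D\<^esub> y \<in> carrier (free_ambient I D)"
    by (auto simp: free_ambient_simps PiE_iff free_targets_def
        intro!: monoid.m_closed split: prod.splits)
next
  show "\<one>\<^bsub>free_ambient I D\<^esub> \<in> carrier (free_ambient I D)"
    by (auto simp: free_ambient_simps PiE_iff free_targets_def intro!: monoid.one_closed)
next
  fix x assume x: "x \<in> carrier (free_ambient I D)"
  show "\<one>\<^bsub>free_ambient I D\<^esub> \<otimes>\<^bsub>free_ambient I D\<^esub> x = x"
    using x by (auto simp: free_ambient_simps fun_eq_iff restrict_def PiE_iff extensional_def
        free_targets_def intro!: monoid.l_one split: prod.splits)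
  show "x \<otimes>\<^bsub>free_ambient I D\<^esub> \<one>\<^bsub>free_ambient I D\<^esub> = x"
    using x by (auto simp: free_ambient_simps fun_eq_iff restrict_def PiE_iff extensional_def
        free_targets_def intro!: monoid.r_one split: prod.splits)
qed


lemma submonoid_free_product: "submonoid (carrier (free_product I D)) (free_ambient I D)"
  and closedin_free_product: "closedin (topol (free_ambient I D)) (carrier (free_product I D))"
  and free_inj_carrier: "i \<in> I \<Longrightarrow> x \<in> carrier (D i) \<Longrightarrow> free_inj I D i x \<in> carrier (free_product I D)"
proof -
  interpret A: Group.monoid "free_ambient I D" by (rule monoid_free_ambient)
  let ?F = "{H. submonoid H (free_ambient I D) \<and> closedin (topol (free_ambient I D)) H \<and>
            (\<forall>i\<in>I. free_inj I D i ` carrier (D i) \<subseteq> H)}"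
  have c: "carrier (free_product I D) = \<Inter>?F"
    by (simp add: free_product_def)
  have inj: "free_inj I D i x \<in> carrier (free_ambient I D)" if "i \<in> I" "x \<in> carrier (D i)" for i x
    using that by (auto simp: free_inj_def free_ambient_simps free_targets_def chom_def hom_def)
  have all: "carrier (free_ambient I D) \<in> ?F"
    using inj closedin_topspace[of "topol (free_ambient I D)"]
    by (auto simp: free_ambient_simps(5) intro!: submonoid.intro)
  show "submonoid (carrier (free_product I D)) (free_ambient I D)"
    unfolding c
  proof
    show "\<Inter>?F \<subseteq> carrier (free_ambient I D)" using all by (rule Inter_lower)
  qed (auto simp: submonoid_def)
  show "closedin (topol (free_ambient I D)) (carrier (free_product I D))"
    unfolding c using all by (intro closedin_Inter) auto
  show "i \<in> I \<Longrightarrow> x \<in> carrier (D i) \<Longrightarrow> free_inj I D i x \<in> carrier (free_product I D)"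
    unfolding c by auto
qed

lemma free_product_least:
  assumes "submonoid H (free_ambient I D)" "closedin (topol (free_ambient I D)) H"
    and "\<And>i x. i \<in> I \<Longrightarrow> x \<in> carrier (D i) \<Longrightarrow> free_inj I D i x \<in> H"
  shows "carrier (free_product I D) \<subseteq> H"
proof -
  have "H \<in> {H. submonoid H (free_ambient I D) \<and> closedin (topol (free_ambient I D)) H \<and>
            (\<forall>i\<in>I. free_inj I D i ` carrier (D i) \<subseteq> H)}"
    using assms by auto
  then show ?thesis unfolding free_product_def sub_monoid_simps by (rule Inter_lower)
qed

lemma free_product_simps:
  "x \<otimes>\<^bsub>free_product I D\<^esub> y = x \<otimes>\<^bsub>free_ambient I D\<^esub> y"
  "\<one>\<^bsub>free_product I D\<^esub> = \<one>\<^bsub>free_ambient I D\<^esub>"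
  "topol (free_product I D) = subtopology (topol (free_ambient I D)) (carrier (free_product I D))"
  "topspace (topol (free_product I D)) = carrier (free_product I D)"
proof -
  show t: "topol (free_product I D) = subtopology (topol (free_ambient I D)) (carrier (free_product I D))"
    by (simp add: free_product_def)
  show "topspace (topol (free_product I D)) = carrier (free_product I D)"
    unfolding t using submonoid.subset[OF submonoid_free_product]
    by (simp add: free_ambient_simps(5) Int_absorb1)
qed (simp_all add: free_product_def)

lemma topological_monoid_free_ambient: "topological_monoid (free_ambient I D)"
proof -
  have "continuous_map (prod_topology (topol (free_ambient I D)) (topol (free_ambient I D)))
      (discrete_topology (carrier N)) (\<lambda>z. fst z (N, \<phi>) \<otimes>\<^bsub>N\<^esub> snd z (N, \<phi>))"
    if p: "(N, \<phi>) \<in> free_targets I D" for N \<phi>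
  proof -
    let ?T = "topol (free_ambient I D)" and ?N = "discrete_topology (carrier N)"
    have pr: "continuous_map ?T ?N (\<lambda>x. x (N, \<phi>))"
      unfolding free_ambient_simps using continuous_map_product_projection[OF p,
          of "\<lambda>(N, \<phi>). discrete_topology (carrier N)"] by simp
    have N: "Group.monoid N" using p by (simp add: free_targets_def)
    have "continuous_map (prod_topology ?T ?T) (prod_topology ?N ?N) (\<lambda>z. (fst z (N, \<phi>), snd z (N, \<phi>)))"
      using continuous_map_compose[OF continuous_map_fst pr] continuous_map_compose[OF continuous_map_snd pr]
      by (intro continuous_map_pairedI) (simp_all add: o_def)
    moreover have "continuous_map (prod_topology ?N ?N) ?N (\<lambda>z. fst z \<otimes>\<^bsub>N\<^esub> snd z)"
      using N by (auto simp: prod_topology_discrete_topology[symmetric] monoid.m_closed)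
    ultimately have "continuous_map (prod_topology ?T ?T) ?N
        ((\<lambda>z. fst z \<otimes>\<^bsub>N\<^esub> snd z) \<circ> (\<lambda>z. (fst z (N, \<phi>), snd z (N, \<phi>))))"
      by (rule continuous_map_compose)
    then show ?thesis
      by (simp add: o_def)
  qed
  then have "continuous_map (prod_topology (topol (free_ambient I D)) (topol (free_ambient I D)))
      (product_topology (\<lambda>(N, \<phi>). discrete_topology (carrier N)) (free_targets I D))
      (\<lambda>z. \<lambda>(N, \<phi>)\<in>free_targets I D. fst z (N, \<phi>) \<otimes>\<^bsub>N\<^esub> snd z (N, \<phi>))"
    unfolding continuous_map_componentwise
    by (intro conjI ballI) (auto simp only: restrict_apply split: prod.splits, auto)
  then have "continuous_map (prod_topology (topol (free_ambient I D)) (topol (free_ambient I D)))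
      (topol (free_ambient I D)) (\<lambda>(x, y). x \<otimes>\<^bsub>free_ambient I D\<^esub> y)"
    by (simp add: free_ambient_simps(2,4) case_prod_unfold)
  then show ?thesis
    by (simp add: topological_monoid_def monoid_free_ambient free_ambient_simps(5))
qed

theorem profinite_monoid_free_product: "profinite_monoid (free_product I D)"
proof -
  let ?A = "free_ambient I D" and ?P = "free_product I D"
  interpret A: Group.monoid ?A by (rule monoid_free_ambient)
  interpret P: submonoid "carrier ?P" ?A by (rule submonoid_free_product)
  have "Group.monoid ?P"
    by (rule monoidI) (use P.subset in \<open>auto simp: free_product_simps(1,2) A.m_assoc subset_iff\<close>)
  moreover have "continuous_map (prod_topology (topol ?P) (topol ?P)) (topol ?P) (\<lambda>(x, y). x \<otimes>\<^bsub>?P\<^esub> y)"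
  proof -
    have "continuous_map (prod_topology (topol ?A) (topol ?A)) (topol ?A) (\<lambda>(x, y). x \<otimes>\<^bsub>?A\<^esub> y)"
      using topological_monoid_free_ambient by (simp add: topological_monoid_def)
    then show ?thesis
      using submonoid.m_closed[OF submonoid_free_product]
      unfolding free_product_simps subtopology_Times[symmetric]
      by (auto simp: continuous_map_in_subtopology intro: continuous_map_from_subtopology)
  qed
  moreover have "compact_space (topol ?P)"
  proof -
    have "compact_space (topol ?A)"
      unfolding free_ambient_simps by (auto simp: compact_space_product_topology compact_space_discrete_topology free_targets_def)
    then show ?thesis
      unfolding free_product_simps
      using closedin_compact_space closedin_free_product compact_space_subtopology by blast
  qed
  moreover have "Hausdorff_space (topol ?P)"
    unfolding free_product_simps free_ambient_simps
    by (intro Hausdorff_space_subtopology) (auto simp: Hausdorff_space_product_topology)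
  moreover have "\<exists>(N :: nat monoid) f. Group.monoid N \<and> finite (carrier N) \<and>
           f \<in> chom ?P (discrete_monoid N) \<and> f x \<noteq> f y"
    if xy: "x \<in> carrier ?P" "y \<in> carrier ?P" "x \<noteq> y" for x y
  proof -
    have sub: "carrier ?P \<subseteq> carrier ?A" using submonoid_free_product by (rule submonoid.subset)
    then have "x \<in> extensional (free_targets I D)" "y \<in> extensional (free_targets I D)"
      using xy by (auto simp: free_ambient_simps PiE_iff)
    then obtain p where p: "p \<in> free_targets I D" "x p \<noteq> y p"
      using xy extensionalityI by blast
    obtain N \<phi> where N: "p = (N, \<phi>)" by force
    have "continuous_map (topol ?P) (discrete_topology (carrier N)) (\<lambda>x. x p)"
      unfolding free_product_simps free_ambient_simps
      using continuous_map_product_projection[OF p(1), of "\<lambda>(N, \<phi>). discrete_topology (carrier N)"]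
      by (intro continuous_map_from_subtopology) (simp add: N)
    then have "(\<lambda>x. x p) \<in> chom ?P (discrete_monoid N)"
      using p N sub by (auto simp: chom_def hom_def free_product_simps free_ambient_simps(1-3) PiE_iff)
    then show ?thesis
      using p N by (auto simp: free_targets_def intro!: exI[of _ N])
  qed
  ultimately show ?thesis
    by (simp add: profinite_monoid_def topological_monoid_def free_product_simps(4))
qed

theorem free_inj_chom:
  assumes i: "i \<in> I" and D: "topological_monoid (D i)"
  shows "free_inj I D i \<in> chom (D i) (free_product I D)"
proof -
  have phi: "\<phi> i \<in> chom (D i) (discrete_monoid N)" if "(N, \<phi>) \<in> free_targets I D" for N \<phi>
    using that i by (simp add: free_targets_def)
  have ts: "topspace (topol (D i)) = carrier (D i)"
    using D by (simp add: topological_monoid_def)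
  have "continuous_map (topol (D i)) (topol (free_ambient I D)) (free_inj I D i)"
    unfolding free_ambient_simps continuous_map_componentwise free_inj_def
    using phi by (auto simp: chom_def)
  then have "continuous_map (topol (D i)) (topol (free_product I D)) (free_inj I D i)"
    unfolding free_product_simps using free_inj_carrier[OF i]
    by (auto simp: continuous_map_in_subtopology ts)
  moreover have "free_inj I D i (x \<otimes>\<^bsub>D i\<^esub> y) = free_inj I D i x \<otimes>\<^bsub>free_product I D\<^esub> free_inj I D i y"
    if "x \<in> carrier (D i)" "y \<in> carrier (D i)" for x y
    unfolding free_product_simps free_ambient_simps free_inj_def
    using that phi by (intro restrict_ext) (auto simp: chom_def hom_def)
  moreover have "free_inj I D i \<one>\<^bsub>D i\<^esub> = \<one>\<^bsub>free_product I D\<^esub>"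
    unfolding free_product_simps free_ambient_simps free_inj_def
    using phi by (intro restrict_ext) (auto simp: chom_def)
  ultimately show ?thesis
    using free_inj_carrier[OF i] by (simp add: chom_def hom_def)
qed

theorem free_product_universal:
  fixes D' :: "'c top_monoid"
  assumes D': "profinite_monoid D'" and phi: "\<And>i. i \<in> I \<Longrightarrow> \<phi> i \<in> chom (D i) D'"
  shows "\<exists>!f. f \<in> extensional (carrier (free_product I D)) \<and> f \<in> chom (free_product I D) D' \<and>
     (\<forall>i\<in>I. \<forall>x\<in>carrier (D i). f (free_inj I D i x) = \<phi> i x)"
proof -
  let ?A = "free_ambient I D" and ?P = "free_product I D"
  interpret D': Group.monoid D' using D' by (simp add: profinite_monoid_def topological_monoid_def)
  interpret P: submonoid "carrier ?P" ?A by (rule submonoid_free_product)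
  have tsD': "topspace (topol D') = carrier D'"
    using D' by (simp add: profinite_monoid_def topological_monoid_def)
  have haus: "Hausdorff_space (topol D')" and cpt: "compact_space (topol D')"
    using D' by (simp_all add: profinite_monoid_def)
  define h where "h = {(N :: nat monoid, g). Group.monoid N \<and> finite (carrier N) \<and> g \<in> chom D' (discrete_monoid N)}"
  define c where "c = (\<lambda>(N :: nat monoid, g :: 'c \<Rightarrow> nat). (N, \<lambda>i x. g (\<phi> i x)))"
  have cT: "c p \<in> free_targets I D" if "p \<in> h" for p
  proof -
    obtain N g where p: "p = (N, g)" by force
    have "(\<lambda>x. g (\<phi> i x)) \<in> chom (D i) (discrete_monoid N)" if i: "i \<in> I" for i
    proof -
      have "continuous_map (topol (D i)) (discrete_topology (carrier N)) (g \<circ> \<phi> i)"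
        using phi[OF i] \<open>p \<in> h\<close> by (intro continuous_map_compose[of _ "topol D'"]) (simp_all add: p h_def chom_def)
      then show ?thesis
        using phi[OF i] \<open>p \<in> h\<close> by (auto simp: p h_def chom_def hom_def o_def Pi_iff)
    qed
    then show ?thesis using that by (simp add: p c_def free_targets_def h_def)
  qed
  have sep: "x = y" if "x \<in> carrier D'" "y \<in> carrier D'" "\<And>p. p \<in> h \<Longrightarrow> snd p x = snd p y" for x y
    using that D' unfolding profinite_monoid_def h_def by fastforce
  define Gr where "Gr = {z \<in> carrier ?A \<times> carrier D'. \<forall>p\<in>h. snd p (snd z) = fst z (c p)}"
  have closed: "closedin (prod_topology (topol ?A) (topol D')) Gr"
  proof -
    have tsp: "topspace (prod_topology (topol ?A) (topol D')) = carrier ?A \<times> carrier D'"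
      by (simp add: tsD' free_ambient_simps(5))
    have 1: "closedin (prod_topology (topol ?A) (topol D')) {z \<in> carrier ?A \<times> carrier D'. snd p (snd z) = fst z (c p)}"
      if p: "p \<in> h" for p
    proof -
      obtain N g where pN: "p = (N, g)" by force
      have g: "continuous_map (topol D') (discrete_topology (carrier N)) g"
        using p by (simp add: pN h_def chom_def)
      have pr: "continuous_map (topol ?A) (discrete_topology (carrier N)) (\<lambda>x. x (c p))"
        unfolding free_ambient_simps using continuous_map_product_projection[OF cT[OF p],
            of "\<lambda>(N, \<phi>). discrete_topology (carrier N)"] by (simp add: pN c_def)
      have "closedin (prod_topology (topol ?A) (topol D'))
          {z \<in> topspace (prod_topology (topol ?A) (topol D')). (g \<circ> snd) z = ((\<lambda>x. x (c p)) \<circ> fst) z}"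
        by (rule closedin_continuous_maps_eq[of "discrete_topology (carrier N)"])
          (simp, rule continuous_map_compose[OF continuous_map_snd g], rule continuous_map_compose[OF continuous_map_fst pr])
      then show ?thesis by (simp add: tsD' free_ambient_simps(5) pN)
    qed
    have G: "Gr = (\<Inter>p\<in>h. {z \<in> carrier ?A \<times> carrier D'. snd p (snd z) = fst z (c p)}) \<inter> (carrier ?A \<times> carrier D')"
      by (auto simp: Gr_def)
    have top: "closedin (prod_topology (topol ?A) (topol D')) (carrier ?A \<times> carrier D')"
      using closedin_topspace[of "prod_topology (topol ?A) (topol D')"] unfolding tsp .
    show ?thesis
    proof (cases "h = {}")
      case True
      then show ?thesis using top by (simp add: G)
    next
      case False
      have "closedin (prod_topology (topol ?A) (topol D'))
          (\<Inter>p\<in>h. {z \<in> carrier ?A \<times> carrier D'. snd p (snd z) = fst z (c p)})"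
        by (rule closedin_INT[OF False 1])
      then show ?thesis
        unfolding G using top by (rule closedin_Int)
    qed
  qed
  have Gr_one: "(\<one>\<^bsub>?A\<^esub>, \<one>\<^bsub>D'\<^esub>) \<in> Gr"
    using cT Group.monoid.one_closed[OF monoid_free_ambient]
    by (auto simp: Gr_def c_def h_def chom_def free_ambient_simps(3))
  have Gr_mult: "(x \<otimes>\<^bsub>?A\<^esub> x', y \<otimes>\<^bsub>D'\<^esub> y') \<in> Gr" if z: "(x, y) \<in> Gr" "(x', y') \<in> Gr" for x y x' y'
  proof -
    have "snd p (y \<otimes>\<^bsub>D'\<^esub> y') = (x \<otimes>\<^bsub>?A\<^esub> x') (c p)" if p: "p \<in> h" for p
    proof -
      obtain N g where pN: "p = (N, g)" by force
      have "g (y \<otimes>\<^bsub>D'\<^esub> y') = g y \<otimes>\<^bsub>N\<^esub> g y'"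
        using p z by (auto simp: pN h_def chom_def hom_def Gr_def)
      also have "\<dots> = x (c p) \<otimes>\<^bsub>N\<^esub> x' (c p)"
      proof -
        have "snd p y = x (c p)" "snd p y' = x' (c p)" using p z by (simp_all add: Gr_def)
        then show ?thesis by (simp add: pN)
      qed
      also have "\<dots> = (x \<otimes>\<^bsub>?A\<^esub> x') (c p)"
        using cT[OF p] by (simp add: pN c_def free_ambient_simps(2))
      finally show ?thesis by (simp add: pN)
    qed
    then show ?thesis
      using z Group.monoid.m_closed[OF monoid_free_ambient] by (auto simp: Gr_def)
  qed
  have Gr_phi: "(free_inj I D i x, \<phi> i x) \<in> Gr" if "i \<in> I" "x \<in> carrier (D i)" for i x
  proof -
    have "snd p (\<phi> i x) = free_inj I D i x (c p)" if p: "p \<in> h" for p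
      using cT[OF p] by (cases p) (simp add: free_inj_def c_def)
    then show ?thesis
      using that free_inj_carrier[OF that] P.subset phi[OF that(1)] by (auto simp: Gr_def chom_def hom_def)
  qed
  have "carrier ?P \<subseteq> fst ` Gr"
  proof (rule free_product_least)
    show "submonoid (fst ` Gr) ?A"
    proof
      show "fst ` Gr \<subseteq> carrier ?A" by (auto simp: Gr_def)
      show "\<one>\<^bsub>?A\<^esub> \<in> fst ` Gr" using Gr_one by force
      show "x \<otimes>\<^bsub>?A\<^esub> y \<in> fst ` Gr" if "x \<in> fst ` Gr" "y \<in> fst ` Gr" for x y
        using that Gr_mult by force
    qed
    show "closedin (topol ?A) (fst ` Gr)"
      using closed closed_map_fst[OF cpt] by (auto simp: closed_map_def)
    show "\<And>i x. i \<in> I \<Longrightarrow> x \<in> carrier (D i) \<Longrightarrow> free_inj I D i x \<in> fst ` Gr"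
      using Gr_phi by force
  qed
  then have ex: "\<exists>y. (x, y) \<in> Gr" if "x \<in> carrier ?P" for x
    using that by force
  have uniq: "y = y'" if "(x, y) \<in> Gr" "(x, y') \<in> Gr" for x y y'
    using that by (intro sep) (auto simp: Gr_def)
  define f where "f = (\<lambda>x\<in>carrier ?P. THE y. (x, y) \<in> Gr)"
  have fG: "(x, f x) \<in> Gr" if "x \<in> carrier ?P" for x
    using ex[OF that] uniq that unfolding f_def by (auto intro: theI)
  have fI: "f x = y" if "x \<in> carrier ?P" "(x, y) \<in> Gr" for x y
    using fG uniq that by blast
  have fc: "f x \<in> carrier D'" if "x \<in> carrier ?P" for x
    using fG[OF that] by (simp add: Gr_def)
  have tP: "topspace (topol ?P) = carrier ?P" by (rule free_product_simps)
  have "continuous_map (topol ?P) (topol D') f"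
    unfolding continuous_map_closedin tP
  proof (intro conjI allI impI)
    show "f \<in> carrier ?P \<rightarrow> topspace (topol D')" using fc by (simp add: tsD')
    fix C assume C: "closedin (topol D') C"
    have "closedin (prod_topology (topol ?A) (topol D')) (Gr \<inter> carrier ?P \<times> C)"
      using closed closedin_free_product C by (intro closedin_Int) (simp_all add: closedin_prod_Times_iff)
    then have "closedin (topol ?A) (fst ` (Gr \<inter> carrier ?P \<times> C))"
      using closed_map_fst[OF cpt] by (auto simp: closed_map_def)
    moreover have "fst ` (Gr \<inter> carrier ?P \<times> C) = {x \<in> carrier ?P. f x \<in> C}"
    proof
      show "fst ` (Gr \<inter> carrier ?P \<times> C) \<subseteq> {x \<in> carrier ?P. f x \<in> C}"
        using fI by auto
      show "{x \<in> carrier ?P. f x \<in> C} \<subseteq> fst ` (Gr \<inter> carrier ?P \<times> C)"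
        using fG by force
    qed
    ultimately show "closedin (topol ?P) {x \<in> carrier ?P. f x \<in> C}"
      unfolding free_product_simps(3) by (auto simp: closedin_subtopology)
  qed
  moreover have "f (x \<otimes>\<^bsub>?P\<^esub> y) = f x \<otimes>\<^bsub>D'\<^esub> f y" if "x \<in> carrier ?P" "y \<in> carrier ?P" for x y
    using that fG by (intro fI) (simp_all add: free_product_simps(1) Gr_mult)
  moreover have "f \<one>\<^bsub>?P\<^esub> = \<one>\<^bsub>D'\<^esub>"
    using Gr_one by (intro fI) (simp_all add: free_product_simps(2))
  ultimately have fch: "f \<in> chom ?P D'"
    using fc by (simp add: chom_def hom_def)
  show ?thesis
  proof (rule ex1I[of _ f])
    show "f \<in> extensional (carrier ?P) \<and> f \<in> chom ?P D' \<and>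
        (\<forall>i\<in>I. \<forall>x\<in>carrier (D i). f (free_inj I D i x) = \<phi> i x)"
    proof (intro conjI ballI)
      show "f \<in> extensional (carrier ?P)" by (simp add: f_def)
      show "f \<in> chom ?P D'" by (rule fch)
      show "f (free_inj I D i x) = \<phi> i x" if "i \<in> I" "x \<in> carrier (D i)" for i x
        using that Gr_phi free_inj_carrier by (intro fI)
    qed
    fix g assume g: "g \<in> extensional (carrier ?P) \<and> g \<in> chom ?P D' \<and>
        (\<forall>i\<in>I. \<forall>x\<in>carrier (D i). g (free_inj I D i x) = \<phi> i x)"
    let ?H = "{x \<in> carrier ?P. f x = g x}"
    have "closedin (topol ?P) {x \<in> topspace (topol ?P). f x = g x}"
      using g fch by (intro closedin_continuous_maps_eq[OF haus]) (simp_all add: chom_def)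
    then have "closedin (topol ?P) ?H"
      unfolding tP .
    then have cl: "closedin (topol ?A) ?H"
      unfolding free_product_simps(3) by (rule closedin_trans_full[OF _ closedin_free_product])
    have "carrier ?P \<subseteq> ?H"
    proof (rule free_product_least[OF _ cl])
      show "submonoid ?H ?A"
      proof
        show "?H \<subseteq> carrier ?A" using P.subset by blast
        show "\<one>\<^bsub>?A\<^esub> \<in> ?H" using fch g P.one_closed by (simp add: chom_def free_product_simps(2))
        show "x \<otimes>\<^bsub>?A\<^esub> y \<in> ?H" if "x \<in> ?H" "y \<in> ?H" for x y
          using that fch g by (auto simp: chom_def hom_def free_product_simps(1))
      qed
      show "free_inj I D i x \<in> ?H" if "i \<in> I" "x \<in> carrier (D i)" for i x
        using that g free_inj_carrier[OF that] fI[OF free_inj_carrier[OF that] Gr_phi[OF that]] by simp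
    qed
    then show "g = f"
      using g by (intro extensionalityI[of _ "carrier ?P"]) (auto simp: f_def)
  qed
qed

end

corollary free_lift:
  assumes "profinite_monoid D'" and "\<And>i. i \<in> I \<Longrightarrow> \<phi> i \<in> chom (D i) D'"
  shows "free_lift I D D' \<phi> \<in> chom (free_product I D) D'"
    and "i \<in> I \<Longrightarrow> x \<in> carrier (D i) \<Longrightarrow> free_lift I D D' \<phi> (free_inj I D i x) = \<phi> i x"
  using theI'[OF free_product_universal[where \<phi> = \<phi> and D = D and I = I, OF assms]]
  unfolding free_lift_def by blast+


section \<open>Number fields, their absolute Galois groups and primes\<close>

text \<open>The type \<^typ>\<open>'a\<close> below is an algebraic closure of \<open>K\<close>, which is assumed
  in the form \<open>algebraic_closure ring_of_type_algebra K\<close>.\<close>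

definition number_field :: "'a::field_char_0 set \<Rightarrow> bool" where
  "number_field K \<longleftrightarrow> subfield K (ring_of_type_algebra :: 'a ring) \<and>
     ring.finite_dimension (ring_of_type_algebra :: 'a ring) \<rat> K"

definition galois_carrier :: "'a::field_char_0 set \<Rightarrow> ('a \<Rightarrow> 'a) set" where
  "galois_carrier K = {\<sigma> \<in> ring_iso ring_of_type_algebra ring_of_type_algebra. \<forall>x\<in>K. \<sigma> x = x}"

definition krull_topology :: "'a::field_char_0 set \<Rightarrow> ('a \<Rightarrow> 'a) topology" where
  "krull_topology K = topology_generated_by
     {{\<tau> \<in> galois_carrier K. \<forall>x\<in>E. \<tau> x = \<sigma> x} | \<sigma> E.
        \<sigma> \<in> galois_carrier K \<and> K \<subseteq> E \<and> subfield E (ring_of_type_algebra :: 'a ring) \<and>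
        ring.finite_dimension (ring_of_type_algebra :: 'a ring) K E}"

definition abs_galois :: "'a::field_char_0 set \<Rightarrow> ('a \<Rightarrow> 'a) top_monoid" where
  "abs_galois K = \<lparr>carrier = galois_carrier K, mult = (\<circ>), one = id, topol = krull_topology K\<rparr>"

definition int_ring :: "'a::field_char_0 set \<Rightarrow> 'a ring" where
  "int_ring F = ring_of_type_algebra\<lparr>carrier := {x \<in> F. algebraic_int x}\<rparr>"

text \<open>For the algebraic closure itself, the finite primes are taken to be the non-zero maximal ideals
  of its ring of integers, \<open>primes_of UNIV\<close>; the restriction of \<open>v\<close> to \<open>K\<close> is \<open>v \<inter> K\<close>.\<close>

definition primes_of :: "'a::field_char_0 set \<Rightarrow> 'a set set" where
  "primes_of F = {p. maximalideal p (int_ring F) \<and> p \<noteq> {0}}"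

definition decomp :: "'a::field_char_0 set \<Rightarrow> 'a set \<Rightarrow> ('a \<Rightarrow> 'a) set" where
  "decomp K v = {\<sigma> \<in> galois_carrier K. \<sigma> ` v = v}"

definition decomp_group :: "'a::field_char_0 set \<Rightarrow> 'a set \<Rightarrow> ('a \<Rightarrow> 'a) top_monoid" where
  "decomp_group K v = sub_monoid (abs_galois K) (decomp K v)"

definition inertia :: "'a::field_char_0 set \<Rightarrow> 'a set \<Rightarrow> ('a \<Rightarrow> 'a) set" where
  "inertia K v = {\<sigma> \<in> decomp K v. \<forall>x. algebraic_int x \<longrightarrow> \<sigma> x - x \<in> v}"

text \<open>The (arithmetic) Frobenius: an element of \<open>decomp_group K v Mod inertia K v\<close>, that is,
  a coset of the inertia group.\<close>

definition frobenius :: "'a::field_char_0 set \<Rightarrow> 'a set \<Rightarrow> ('a \<Rightarrow> 'a) set" where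
  "frobenius K v = {\<sigma> \<in> decomp K v. \<forall>x. algebraic_int x \<longrightarrow>
     \<sigma> x - x ^ card (carrier (int_ring K Quot (v \<inter> K))) \<in> v}"

definition weil :: "'a::field_char_0 set \<Rightarrow> 'a set \<Rightarrow> ('a \<Rightarrow> 'a) set" where
  "weil K v = {\<sigma> \<in> decomp K v. \<exists>n::nat.
     inertia K v #>\<^bsub>decomp_group K v\<^esub> \<sigma> = frobenius K v [^]\<^bsub>decomp_group K v Mod inertia K v\<^esub> n}"

text \<open>The Weil monoid is the disjoint union of cosets of the inertia group; these are open and
  carry their profinite topology.\<close>

definition weil_topology :: "'a::field_char_0 set \<Rightarrow> 'a set \<Rightarrow> ('a \<Rightarrow> 'a) topology" where
  "weil_topology K v = topology_generated_by
     {U \<inter> (inertia K v #>\<^bsub>decomp_group K v\<^esub> \<sigma>) | U \<sigma>. openin (krull_topology K) U \<and> \<sigma> \<in> weil K v}"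

text \<open>The one-point compactification; the added point \<^const>\<open>None\<close> is the zero element.\<close>

definition weil_compact :: "'a::field_char_0 set \<Rightarrow> 'a set \<Rightarrow> ('a \<Rightarrow> 'a) option top_monoid" where
  "weil_compact K v =
     \<lparr>carrier = insert None (Some ` weil K v),
      mult = (\<lambda>x y. case (x, y) of (Some \<sigma>, Some \<tau>) \<Rightarrow> Some (\<sigma> \<circ> \<tau>) | _ \<Rightarrow> None),
      one = Some id,
      topol = Alexandroff_compactification (weil_topology K v)\<rparr>"


section \<open>The free deformation\<close>

definition primes_over :: "'a::field_char_0 set \<Rightarrow> 'a set set \<Rightarrow> 'a set set" where
  "primes_over K S = {v \<in> primes_of UNIV. v \<inter> K \<in> S}"

definition finite_prime_sets :: "'a::field_char_0 set \<Rightarrow> 'a set set set" where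
  "finite_prime_sets K = {S. finite S \<and> S \<subseteq> primes_of K}"

type_synonym 'a QS_elem = "('a set, ('a \<Rightarrow> 'a) option) free_index \<Rightarrow> nat"
type_synonym 'a Qhat_elem = "'a set set \<Rightarrow> 'a QS_elem"

definition QS :: "'a::field_char_0 set \<Rightarrow> 'a set set \<Rightarrow> 'a QS_elem top_monoid" where
  "QS K S = free_product (primes_over K S) (weil_compact K)"

definition QS_inj :: "'a::field_char_0 set \<Rightarrow> 'a set set \<Rightarrow> 'a set \<Rightarrow> ('a \<Rightarrow> 'a) option \<Rightarrow> 'a QS_elem" where
  "QS_inj K S v x =
     (if v \<in> primes_over K S then free_inj (primes_over K S) (weil_compact K) v x else \<one>\<^bsub>QS K S\<^esub>)"

definition QS_trans :: "'a::field_char_0 set \<Rightarrow> 'a set set \<Rightarrow> 'a set set \<Rightarrow> 'a QS_elem \<Rightarrow> 'a QS_elem" where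
  "QS_trans K S S' = free_lift (primes_over K S') (weil_compact K) (QS K S) (QS_inj K S)"

definition Qhat :: "'a::field_char_0 set \<Rightarrow> 'a Qhat_elem top_monoid" where
  "Qhat K = inverse_limit (finite_prime_sets K) (\<subseteq>) (QS K) (QS_trans K)"

definition Qhat_inj :: "'a::field_char_0 set \<Rightarrow> 'a set \<Rightarrow> ('a \<Rightarrow> 'a) option \<Rightarrow> 'a Qhat_elem" where
  "Qhat_inj K v x = (\<lambda>S\<in>finite_prime_sets K. QS_inj K S v x)"

definition QS_act :: "'a::field_char_0 set \<Rightarrow> 'a set set \<Rightarrow> ('a \<Rightarrow> 'a) \<Rightarrow> 'a QS_elem \<Rightarrow> 'a QS_elem" where
  "QS_act K S \<sigma> = free_lift (primes_over K S) (weil_compact K) (QS K S)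
     (\<lambda>v x. QS_inj K S (\<sigma> ` v) (map_option (\<lambda>\<rho>. \<sigma> \<circ> \<rho> \<circ> inv\<^bsub>abs_galois K\<^esub> \<sigma>) x))"

definition Qhat_act :: "'a::field_char_0 set \<Rightarrow> ('a \<Rightarrow> 'a) \<Rightarrow> 'a Qhat_elem \<Rightarrow> 'a Qhat_elem" where
  "Qhat_act K \<sigma> x = (\<lambda>S\<in>finite_prime_sets K. QS_act K S \<sigma> (x S))"

definition Qhat_semidirect :: "'a::field_char_0 set \<Rightarrow> ('a Qhat_elem \<times> ('a \<Rightarrow> 'a)) top_monoid" where
  "Qhat_semidirect K = semidirect (Qhat K) (abs_galois K) (Qhat_act K)"

definition inertia_relation ::
  "'a::field_char_0 set \<Rightarrow> (('a Qhat_elem \<times> ('a \<Rightarrow> 'a)) \<times> ('a Qhat_elem \<times> ('a \<Rightarrow> 'a))) set" where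
  "inertia_relation K =
     {((\<rho>, \<sigma>), (\<rho> \<otimes>\<^bsub>Qhat K\<^esub> Qhat_inj K v (Some u), inv\<^bsub>abs_galois K\<^esub> u \<otimes>\<^bsub>abs_galois K\<^esub> \<sigma>)) | \<rho> \<sigma> v u.
        \<rho> \<in> carrier (Qhat K) \<and> \<sigma> \<in> galois_carrier K \<and> v \<in> primes_of UNIV \<and> u \<in> inertia K v}"

definition free_deformation ::
  "'a::field_char_0 set \<Rightarrow> ('a Qhat_elem \<times> ('a \<Rightarrow> 'a)) set top_monoid" where
  "free_deformation K = quotient_monoid (Qhat_semidirect K)
     (min_profinite_congruence (Qhat_semidirect K) (inertia_relation K))"

end

theory Submission
  imports Defs
begin

text \<open>
  The map \<open>\<sigma> \<mapsto> [(1, \<sigma>)]\<close> from the Galois group to the free deformation is a continuous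
  homomorphism, and it has to be shown that it is injective and hits every unit.

  A finite Galois-stable set \<open>A\<close> of algebraic integers is ramified at finitely many primes \<open>S\<close> only.
  So there is a finite quotient of the deformation, made of permutations of \<open>A\<close> and a zero, in
  which the Galois group acts on \<open>A\<close>, the local monoids at the primes in \<open>S\<close> act through their
  inertia groups and are sent to zero outside, and the other local monoids are killed. These
  quotients separate the elements of the Galois group.

  Conversely, a finite quotient of the deformation depends only on the local monoids at the primes in some
  finite set \<open>S\<close>. In the deformation inertia elements agree with Galois elements, and all other elements of
  these local monoids become zero in the quotient for \<open>A = {}\<close>. As a unit does not become zero,
  its image in every finite quotient is that of a Galois element, and by compactness of the Galois group
  the unit itself is one.
\<close>

text \<open>What rules out further units is the added zero of each local monoid. The powers of a
  Weil element of positive degree leave every compact set and so tend to that zero; in a finite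
  quotient some power then has the same image as the zero. The degree is read off from the power map
  that an element induces modulo v, so that the argument stays inside the ring of algebraic
  integers.

  A continuous homomorphism from the limit to a finite monoid involves only finitely many primes of
  K. So the non-inertial elements can be sent to zero at finitely many primes at a time, a unit is
  compared with Galois elements in one finite quotient at a time, and the Galois element found may
  vary with the quotient. Compactness removes this dependence: otherwise finitely many quotients
  would separate the unit from all Galois elements at once, and a common refinement of them would be
  a finite quotient in which the unit agrees with no Galois element.\<close>

section \<open>The ambient field, in terms of the operations of the type class\<close>

lemma ring_of_type_algebra_simps [simp]:
  "carrier (ring_of_type_algebra :: 'a::field ring) = UNIV"
  "x \<otimes>\<^bsub>ring_of_type_algebra\<^esub> y = x * y"
  "x \<oplus>\<^bsub>ring_of_type_algebra\<^esub> y = x + y"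
  "\<one>\<^bsub>ring_of_type_algebra\<^esub> = (1 :: 'a)"
  "\<zero>\<^bsub>ring_of_type_algebra\<^esub> = (0 :: 'a)"
  for x y :: "'a::field"
  by (simp_all add: ring_of_type_algebra_def)

lemma ring_of_type_algebra_pow [simp]:
  "x [^]\<^bsub>ring_of_type_algebra\<^esub> n = x ^ n" for x :: "'a::field" and n :: nat
proof -
  interpret field "ring_of_type_algebra :: 'a ring" ..
  show ?thesis by (induction n) simp_all
qed

lemma ring_of_type_algebra_inv [simp]:
  "x \<noteq> 0 \<Longrightarrow> inv\<^bsub>ring_of_type_algebra\<^esub> x = inverse x" for x :: "'a::field"
proof -
  interpret field "ring_of_type_algebra :: 'a ring" ..
  show "x \<noteq> 0 \<Longrightarrow> inv\<^bsub>ring_of_type_algebra\<^esub> x = inverse x"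
    by (intro comm_inv_char) auto
qed

lemma ring_of_type_algebra_minus [simp]:
  "\<ominus>\<^bsub>ring_of_type_algebra\<^esub> x = - x" for x :: "'a::field"
proof -
  interpret field "ring_of_type_algebra :: 'a ring" ..
  show ?thesis by (intro minus_equality) auto
qed

text \<open>Polynomials of \<open>HOL-Algebra\<close> are coefficient lists that start with the
  leading coefficient, while \<open>Poly\<close> expects the constant term first; hence the
  reversal.\<close>

lemma eval_ring_of_type_algebra:
  "ring.eval (ring_of_type_algebra :: 'a::field ring) p x = poly (Poly (rev p)) x"
proof -
  interpret field "ring_of_type_algebra :: 'a ring" ..
  show ?thesis
    by (induction p) (simp_all add: Poly_append poly_monom)
qed

lemma subfield_ring_of_type_algebraD:
  assumes "subfield F (ring_of_type_algebra :: 'a::field ring)"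
  shows "0 \<in> F" "1 \<in> F" "x \<in> F \<Longrightarrow> y \<in> F \<Longrightarrow> x + y \<in> F" "x \<in> F \<Longrightarrow> y \<in> F \<Longrightarrow> x * y \<in> F" "x \<in> F \<Longrightarrow> - x \<in> F"
  using subringE[OF subfieldE(1)[OF assms]] by auto

lemma subfield_UNIV: "subfield UNIV (ring_of_type_algebra :: 'a::field ring)"
proof -
  interpret field "ring_of_type_algebra :: 'a ring" ..
  show ?thesis using carrier_is_subfield by simp
qed

lemma subfield_Rats: "subfield \<rat> (ring_of_type_algebra :: 'a::field_char_0 ring)"
proof -
  interpret field "ring_of_type_algebra :: 'a ring" ..
  show ?thesis
    by (intro subfieldI' subringI) auto
qed

section \<open>Algebraic integers and an elementwise description of primes\<close>

text \<open>Multiplying by the leading coefficient of an annihilating integer polynomial is enough.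
  It lets automorphisms, which are determined by their values everywhere, be compared on algebraic
  integers only.\<close>

lemma ex_integer_multiple_algebraic_int:
  fixes x :: "'a::field_char_0"
  assumes "algebraic x"
  shows "\<exists>n::int. n \<noteq> 0 \<and> algebraic_int (of_int n * x)"
proof -
  from assms obtain p where p: "p \<noteq> 0" "poly (map_poly of_int p) x = 0"
    by (erule algebraicE')
  define m where "m = Polynomial.degree p"
  define c where "c = Polynomial.coeff p m"
  have c: "c \<noteq> 0" using p by (simp add: c_def m_def)
  \<comment> \<open>This is c^(m-1) p(X/c), which has integer coefficients and is monic with root c
    x.\<close>
  define q where "q = Polynomial.monom 1 m + (\<Sum>i<m. Polynomial.monom (Polynomial.coeff p i * c ^ (m - 1 - i)) i)"
  have cf: "Polynomial.coeff q k = (if k = m then 1 else if k < m then Polynomial.coeff p k * c ^ (m - 1 - k) else 0)" for k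
    by (auto simp: q_def coeff_sum sum.delta)
  have deg: "Polynomial.degree q = m"
    by (intro antisym degree_le le_degree) (auto simp: cf)
  show ?thesis
  proof (cases "m = 0")
    case True
    then have "p = [:c:]" by (metis c_def degree_0_id m_def)
    then show ?thesis using p c by (auto simp: map_poly_pCons)
  next
    case False
    have "poly (map_poly of_int q) (of_int c * x) = (\<Sum>i\<le>m. of_int (Polynomial.coeff q i) * (of_int c * x) ^ i)"
      by (simp add: poly_altdef deg degree_map_poly coeff_map_poly)
    also have "\<dots> = (\<Sum>i\<le>m. of_int (c ^ (m - 1)) * (of_int (Polynomial.coeff p i) * x ^ i))"
    proof (intro sum.cong refl)
      fix i assume i: "i \<in> {..m}"
      show "of_int (Polynomial.coeff q i) * (of_int c * x) ^ i = of_int (c ^ (m - 1)) * (of_int (Polynomial.coeff p i) * x ^ i)"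
      proof (cases "i = m")
        case True
        have "of_int c ^ m = of_int c ^ (m - 1) * (of_int c :: 'a)"
          using False by (simp add: power_eq_if)
        then show ?thesis using True by (simp add: cf power_mult_distrib c_def mult_ac)
      next
        case ne: False
        then have "c ^ (m - 1) = c ^ (m - 1 - i) * c ^ i"
          using i by (simp flip: power_add)
        then show ?thesis using i ne by (simp add: cf power_mult_distrib mult_ac)
      qed
    qed
    also have "\<dots> = of_int (c ^ (m - 1)) * poly (map_poly of_int p) x"
      by (simp add: poly_altdef m_def degree_map_poly coeff_map_poly sum_distrib_left)
    finally have "poly (map_poly of_int q) (of_int c * x) = 0"
      using p by simp
    moreover have "Polynomial.lead_coeff q = 1" by (simp add: deg cf)
    ultimately show ?thesis using c algebraic_int_altdef_ipoly by blast
  qed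
qed

lemma carrier_int_ring [simp]: "carrier (int_ring F) = {x \<in> F. algebraic_int x}"
  and int_ring_simps [simp]: "x \<otimes>\<^bsub>int_ring F\<^esub> y = x * y" "x \<oplus>\<^bsub>int_ring F\<^esub> y = x + y"
   "\<one>\<^bsub>int_ring F\<^esub> = 1" "\<zero>\<^bsub>int_ring F\<^esub> = 0"
  by (simp_all add: int_ring_def)

text \<open>That the algebraic integers form a ring is never proved: it is part of the assumption that a
  maximal ideal exists.\<close>

lemma ring_int_ringD:
  assumes "ring (int_ring F)" "x \<in> F" "y \<in> F" "algebraic_int x" "algebraic_int y"
  shows "algebraic_int (x + y)" "algebraic_int (x * y)"
proof -
  interpret ring "int_ring F" by fact
  show "algebraic_int (x + y)" "algebraic_int (x * y)"
    using assms a_closed[of x y] m_closed[of x y] by auto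
qed

lemma cring_int_ringI:
  assumes F: "subfield F (ring_of_type_algebra :: 'a::field_char_0 ring)"
    and "\<And>x y. x \<in> F \<Longrightarrow> y \<in> F \<Longrightarrow> algebraic_int x \<Longrightarrow> algebraic_int y \<Longrightarrow> algebraic_int (x + y) \<and> algebraic_int (x * y)"
  shows "cring (int_ring F)"
proof (intro cringI abelian_groupI comm_monoidI)
  fix x assume "x \<in> carrier (int_ring F)"
  then show "\<exists>y\<in>carrier (int_ring F). y \<oplus>\<^bsub>int_ring F\<^esub> x = \<zero>\<^bsub>int_ring F\<^esub>"
    using subfield_ring_of_type_algebraD[OF F] by (intro bexI[of _ "- x"]) auto
qed (use assms(2) subfield_ring_of_type_algebraD[OF F] in \<open>auto simp: algebra_simps\<close>)

lemma cring_int_ring: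
  assumes F: "subfield F (ring_of_type_algebra :: 'a::field_char_0 ring)" and "ring (int_ring F)"
  shows "cring (int_ring F)"
  using ring_int_ringD[OF assms(2)] by (intro cring_int_ringI F) auto

text \<open>A prime of the algebraic closure supplies the ring property for the whole field; here it
  is passed down to \<open>K\<close>, where it is needed for the restricted prime.\<close>

lemma ring_int_ring_subfield:
  assumes F: "subfield F (ring_of_type_algebra :: 'a::field_char_0 ring)" and "ring (int_ring (UNIV :: 'a set))"
  shows "ring (int_ring F)"
  using ring_int_ringD[OF assms(2)] by (intro cring.axioms(1) cring_int_ringI F) auto

text \<open>Maximality becomes a statement on elements: whatever lies outside \<open>P\<close> is
  invertible modulo \<open>P\<close>. In this form primes can be restricted to subfields and moved
  by automorphisms without handling ideals again.\<close>

lemma primes_of_iff: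
  assumes F: "subfield F (ring_of_type_algebra :: 'a::field_char_0 ring)"
  defines "Z \<equiv> {x \<in> F. algebraic_int x}"
  shows "P \<in> primes_of F \<longleftrightarrow> ring (int_ring F) \<and> P \<subseteq> Z \<and> 0 \<in> P \<and> (\<forall>x\<in>P. \<forall>y\<in>P. x + y \<in> P) \<and>
    (\<forall>x\<in>P. \<forall>y\<in>Z. x * y \<in> P) \<and> 1 \<notin> P \<and> (\<forall>x\<in>Z - P. \<exists>y\<in>Z. x * y - 1 \<in> P) \<and> P \<noteq> {0}"
    (is "_ \<longleftrightarrow> ?R")
proof
  assume "P \<in> primes_of F"
  then have P: "maximalideal P (int_ring F)" "P \<noteq> {0}" by (simp_all add: primes_of_def)
  interpret maximalideal P "int_ring F" by fact
  interpret cring "int_ring F" by (rule cring_int_ring[OF F ring_axioms])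
  have c: "carrier (int_ring F) = Z" by (simp add: Z_def)
  have inv: "\<exists>y\<in>Z. x * y - 1 \<in> P" if x: "x \<in> Z - P" for x
  proof -
    \<comment> \<open>The ideal generated by \<open>P\<close> and \<open>x\<close> is strictly
      larger than \<open>P\<close>, so it contains 1; this yields the inverse of
      \<open>x\<close>.\<close>
    let ?J = "P <+>\<^bsub>int_ring F\<^esub> PIdl\<^bsub>int_ring F\<^esub> x"
    have "ideal (PIdl\<^bsub>int_ring F\<^esub> x) (int_ring F)"
      using x by (intro cgenideal_ideal) (simp add: Z_def)
    then have J: "ideal ?J (int_ring F)" by (rule add_ideals[OF is_ideal])
    have mem: "?J = {p + y * x | p y. p \<in> P \<and> y \<in> Z}"
      unfolding set_add_def' cgenideal_def by (auto simp: Z_def)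
    have one: "1 \<in> Z" using one_closed by (simp add: Z_def)
    have zero: "0 \<in> Z" "0 \<in> P" using additive_subgroup.zero_closed[OF additive_subgroup_axioms] a_subset c by auto
    have PJ: "P \<subseteq> ?J"
    proof
      fix p assume "p \<in> P"
      moreover have "p = p + 0 * x" by simp
      ultimately show "p \<in> ?J" using zero unfolding mem by blast
    qed
    have "x = 0 + 1 * x" by simp
    then have "x \<in> ?J" using zero one unfolding mem by blast
    then have "?J \<noteq> P" using x by blast
    moreover have "?J \<subseteq> carrier (int_ring F)" using ideal.Icarr[OF J] by blast
    ultimately have "?J = Z" using I_maximal[OF J PJ] c by blast
    then obtain p y where p: "1 = p + y * x" "p \<in> P" and y: "y \<in> Z" using one unfolding mem by blast
    have "x * y - 1 = x * y - (p + y * x)" using p(1) by metis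
    then have "x * y - 1 = - p" by (simp add: algebra_simps)
    moreover have "- p \<in> P" if "p \<in> P" for p
    proof -
      have "- 1 \<in> Z" using one subfield_ring_of_type_algebraD[OF F] by (auto simp: Z_def)
      from I_l_closed[OF that, of "- 1"] this show ?thesis by (simp add: Z_def)
    qed
    ultimately show ?thesis using p(2) y \<open>x * y - 1 = - p\<close> by metis
  qed
  have one': "1 \<notin> P" using one_imp_carrier I_notcarr int_ring_simps(3) by metis
  have add: "x + y \<in> P" if "x \<in> P" "y \<in> P" for x y
    using additive_subgroup.a_closed[OF additive_subgroup_axioms that] by simp
  have mult: "x * y \<in> P" if "x \<in> P" "y \<in> Z" for x y
    using I_r_closed[OF that(1), of y] that(2) by (simp add: Z_def)
  have P0: "0 \<in> P" "P \<subseteq> Z"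
    using additive_subgroup.zero_closed[OF additive_subgroup_axioms] a_subset by (auto simp: Z_def)
  show ?R
    by (intro conjI ballI) (rule ring_axioms P0 one' P(2) inv add mult | assumption)+
next
  assume R: ?R
  interpret cring "int_ring F" using R by (intro cring_int_ring[OF F]) simp
  have c: "carrier (int_ring F) = Z" by (simp add: Z_def)
  have one: "1 \<in> Z" using one_closed by (simp add: Z_def)
  have neg: "- p \<in> P" if "p \<in> P" for p
  proof -
    have "- 1 \<in> Z" using one subfield_ring_of_type_algebraD[OF F] by (auto simp: Z_def)
    then have "p * (- 1) \<in> P" using R that by blast
    then show ?thesis by simp
  qed
  have minus: "\<ominus>\<^bsub>int_ring F\<^esub> x = - x" if "x \<in> P" for x
    using R that neg[OF that] by (intro minus_equality) (auto simp: Z_def subset_iff)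
  have "ideal P (int_ring F)"
  proof (rule idealI)
    show "ring (int_ring F)" by (rule ring_axioms)
    show "subgroup P (add_monoid (int_ring F))"
    proof
      show "inv\<^bsub>add_monoid (int_ring F)\<^esub> x \<in> P" if "x \<in> P" for x
        using that minus[OF that] neg by (simp add: a_inv_def)
    qed (use R in \<open>auto simp: Z_def\<close>)
  qed (use R in \<open>auto simp: Z_def mult.commute\<close>)
  then have "maximalideal P (int_ring F)"
  proof (rule maximalidealI)
    show "carrier (int_ring F) \<noteq> P" using R one by (auto simp: Z_def)
    fix J assume J: "ideal J (int_ring F)" "P \<subseteq> J" "J \<subseteq> carrier (int_ring F)"
    interpret J: ideal J "int_ring F" by fact
    show "J = P \<or> J = carrier (int_ring F)"
    proof (rule disjCI)
      assume "J \<noteq> carrier (int_ring F)"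
      then have 1: "1 \<notin> J" using J.one_imp_carrier int_ring_simps(3) by metis
      \<comment> \<open>Otherwise \<open>J\<close> would contain both x * y and x * y - 1, hence
        1.\<close>
      have "x \<in> P" if x: "x \<in> J" for x
      proof (rule ccontr)
        assume "x \<notin> P"
        then obtain y where y: "y \<in> Z" "x * y - 1 \<in> P" using R J.Icarr[OF x] c by blast
        have "x * y \<in> J" using J.I_r_closed[OF x, of y] y by (simp add: Z_def)
        moreover have "- (x * y - 1) \<in> J" using neg[OF y(2)] J(2) by blast
        ultimately have "x * y + - (x * y - 1) \<in> J" using J.a_closed int_ring_simps(2) by metis
        moreover have "x * y + - (x * y - 1) = 1" by simp
        ultimately show False using 1 by metis
      qed
      then show "J = P" using J(2) by (intro equalityI subsetI) auto
    qed
  qed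
  then show "P \<in> primes_of F" using R by (simp add: primes_of_def)
qed

section \<open>The algebraic closure: roots, algebraicity, finite extensions\<close>

locale number_field_closure =
  fixes K :: "'a::field_char_0 set"
  assumes nf: "number_field K"
    and cl: "algebraic_closure (ring_of_type_algebra :: 'a ring) K"
begin

lemma subfield_K: "subfield K (ring_of_type_algebra :: 'a ring)"
  using nf by (simp add: number_field_def)

text \<open>Carries algebraic closedness from the coefficient lists of \<open>HOL-Algebra\<close>
  over to \<open>poly\<close>. It later provides an element on which a nontrivial power map modulo a
  prime is visibly not the identity.\<close>

lemma monic_root:
  fixes p :: "'a poly"
  assumes "Polynomial.lead_coeff p = 1" "Polynomial.degree p > 0"
  shows "\<exists>x. poly p x = 0"
proof -
  interpret algebraic_closure "ring_of_type_algebra :: 'a ring" K by (rule cl)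
  define P where "P = rev (Polynomial.coeffs p)"
  have deg: "Polynomials.degree P = Polynomial.degree p"
    by (auto simp: P_def degree_eq_length_coeffs)
  have carrier_P: "P \<in> carrier (poly_ring (ring_of_type_algebra :: 'a ring))"
    using assms by (auto simp: univ_poly_def polynomial_def P_def hd_rev last_coeffs_eq_coeff_degree)
  then have "splitted P"
    using roots_over_carrier by blast
  then have "roots P \<noteq> {#}"
    unfolding splitted_def using deg assms by auto
  then obtain x where "x \<in># roots P" by blast
  then have "is_root P x"
    using roots_mem_iff_is_root[OF carrier_P] by auto
  then have "poly p x = 0"
    by (simp add: is_root_def eval_ring_of_type_algebra P_def)
  then show ?thesis ..
qed

lemma finite_dimension_Rats_extension:
  assumes "ring.finite_dimension (ring_of_type_algebra :: 'a ring) K E"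
  shows "ring.finite_dimension (ring_of_type_algebra :: 'a ring) \<rat> E"
proof -
  interpret algebraic_closure "ring_of_type_algebra :: 'a ring" K by (rule cl)
  have "finite_dimension \<rat> K"
    using nf unfolding number_field_def by (rule conjunct2)
  then show ?thesis
    using assms by (rule telescopic_base_dim(1)[OF subfield_Rats subfield_K])
qed

text \<open>The Krull topology is generated by conditions on finite extensions; to express a
  condition on a single element, the simple extension it generates is used.\<close>

lemma ex_finite_extension:
  obtains E where "x \<in> E" "K \<subseteq> E" "subfield E (ring_of_type_algebra :: 'a ring)"
    "ring.finite_dimension (ring_of_type_algebra :: 'a ring) K E"
proof -
  interpret algebraic_closure "ring_of_type_algebra :: 'a ring" K by (rule cl)
  have x: "x \<in> carrier ring_of_type_algebra" "(algebraic over K) x"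
    using algebraic_extension by auto
  note sub = subfieldE(1)[OF subfield_K]
  show thesis
  proof (rule that)
    show "x \<in> simple_extension K x"
      by (rule simple_extension_mem[OF sub x(1)])
    show "K \<subseteq> simple_extension K x"
      by (rule simple_extension_incl[OF subring_props(1)[OF subfield_K] x(1)])
    show "subfield (simple_extension K x) ring_of_type_algebra"
      by (rule iffD2[OF simple_extension_is_subfield[OF subfield_K x(1)] x(2)])
    show "finite_dimension K (simple_extension K x)"
      by (rule iffD2[OF finite_dimension_simple_extension[OF subfield_K x(1)] x(2)])
  qed
qed

text \<open>\<open>x\<close> lies in a finite extension of \<open>K\<close>, which by the tower law
  is finite over the rationals. What remains is to pass from coefficient lists to
  polynomials.\<close>

lemma all_algebraic: "Polynomial.algebraic (x :: 'a)"
proof -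
  interpret algebraic_closure "ring_of_type_algebra :: 'a ring" K by (rule cl)
  obtain E where E: "x \<in> E" "subfield E (ring_of_type_algebra :: 'a ring)" "finite_dimension K E"
    using ex_finite_extension by metis
  have "(algebraic over \<rat>) x"
    using finite_dimension_imp_algebraic[OF subfield_Rats subfieldE(1)[OF E(2)] finite_dimension_Rats_extension[OF E(3)] E(1)] .
  then obtain p where p: "p \<in> carrier (\<rat>[X]\<^bsub>ring_of_type_algebra\<^esub>)" "p \<noteq> []" "eval p x = 0"
    using algebraicE[OF subfieldE(1)[OF subfield_Rats]] by (metis UNIV_I ring_of_type_algebra_simps(1,5))
  have c: "set p \<subseteq> \<rat>" "hd p \<noteq> 0" using p by (auto simp: univ_poly_def polynomial_def)
  have "last (rev p) \<noteq> 0" using c p by (simp add: last_rev)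
  \<comment> \<open>\<open>Poly\<close> drops trailing zeros; the reversed list ends in the nonzero
    leading coefficient, so something survives.\<close>
  have "Poly (rev p) \<noteq> 0"
  proof
    assume "Poly (rev p) = 0"
    then obtain n where n: "rev p = replicate n 0" unfolding Poly_eq_0 ..
    then have "n \<noteq> 0" using p(2) by (metis rev_is_Nil_conv replicate_0)
    then show False using \<open>last (rev p) \<noteq> 0\<close> unfolding n by simp
  qed
  moreover have "Polynomial.coeff (Poly (rev p)) i \<in> \<rat>" for i
    using c(1) nth_mem[of i "rev p"] by (auto simp: coeff_Poly_eq nth_default_def)
  ultimately show ?thesis
    using p(3) unfolding algebraic_altdef eval_ring_of_type_algebra by blast
qed

lemma ex_multiple: "\<exists>n::int. n \<noteq> 0 \<and> algebraic_int (of_int n * (x :: 'a))"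
  using ex_integer_multiple_algebraic_int[OF all_algebraic] .

lemma finite_spanning_set:
  assumes "subfield F ring_of_type_algebra" "ring.finite_dimension (ring_of_type_algebra :: 'a ring) F E"
  obtains us where "set us \<subseteq> E" "E = ring.Span (ring_of_type_algebra :: 'a ring) F us"
proof -
  interpret algebraic_closure "ring_of_type_algebra :: 'a ring" K by (rule cl)
  obtain n where "dimension n F E" using assms(2) by auto
  then obtain us where us: "Span F us = E" using exists_base[OF assms(1)] by blast
  then have "set us \<subseteq> E" using Span_base_incl[OF assms(1), of us] by simp
  then show thesis using us that by blast
qed

end

section \<open>Automorphisms of the algebraic closure over \<open>K\<close>\<close>

lemma galois_carrier_UNIV_iff:
  assumes "subfield K (ring_of_type_algebra :: 'a::field_char_0 ring)"
  shows "\<sigma> \<in> galois_carrier K \<longleftrightarrow> bij \<sigma> \<and> (\<forall>x y. \<sigma> (x + y) = \<sigma> x + \<sigma> y) \<and> (\<forall>x y. \<sigma> (x * y) = \<sigma> x * \<sigma> y) \<and>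
    (\<forall>x\<in>K. \<sigma> x = x)"
  using subfield_ring_of_type_algebraD(2)[OF assms]
  by (auto simp: galois_carrier_def ring_iso_def ring_hom_def)

context number_field_closure
begin

lemmas galois_carrier_iff = galois_carrier_UNIV_iff[OF subfield_K]

context
  fixes \<sigma> assumes \<sigma>: "\<sigma> \<in> galois_carrier K"
begin

lemma galois_bij: "bij \<sigma>"
  and galois_add: "\<sigma> (x + y) = \<sigma> x + \<sigma> y"
  and galois_mult: "\<sigma> (x * y) = \<sigma> x * \<sigma> y"
  and galois_fix: "x \<in> K \<Longrightarrow> \<sigma> x = x"
  using \<sigma> by (auto simp: galois_carrier_iff)

lemma galois_0: "\<sigma> 0 = 0" and galois_1: "\<sigma> 1 = 1"
  using galois_fix subfield_ring_of_type_algebraD[OF subfield_K] by auto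

lemma galois_minus: "\<sigma> (- x) = - \<sigma> x"
  using galois_add[of x "- x"] by (simp add: galois_0 eq_neg_iff_add_eq_0 add.commute)

lemma galois_diff: "\<sigma> (x - y) = \<sigma> x - \<sigma> y"
  using galois_add[of x "- y"] by (simp add: galois_minus)

lemma galois_power: "\<sigma> (x ^ n) = \<sigma> x ^ n"
  by (induction n) (simp_all add: galois_1 galois_mult)

lemma galois_of_int: "\<sigma> (of_int n) = of_int n"
proof -
  have "\<sigma> (of_nat m) = of_nat m" for m
    by (induction m) (simp_all add: galois_0 galois_1 galois_add)
  then show ?thesis by (cases n) (simp_all add: galois_minus galois_1 galois_diff galois_add)
qed

lemma galois_eq_iff: "\<sigma> x = \<sigma> y \<longleftrightarrow> x = y"
  by (rule inj_eq[OF bij_is_inj[OF galois_bij]])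

lemma galois_poly: "poly (map_poly of_int p) (\<sigma> x) = \<sigma> (poly (map_poly of_int p) x)"
  by (induction p) (simp_all add: map_poly_pCons galois_0 galois_add galois_mult galois_of_int)

lemma galois_algebraic_int: "algebraic_int (\<sigma> x) \<longleftrightarrow> algebraic_int x"
  unfolding algebraic_int_altdef_ipoly galois_poly using galois_eq_iff[of _ 0] by (simp add: galois_0)

lemma galois_inv: "inv_into UNIV \<sigma> \<in> galois_carrier K"
proof -
  have *: "\<sigma> (inv_into UNIV \<sigma> x) = x" for x using galois_bij by (simp add: bij_is_surj surj_f_inv_f)
  have "inv_into UNIV \<sigma> (x + y) = inv_into UNIV \<sigma> x + inv_into UNIV \<sigma> y" for x y
    by (metis * galois_add galois_eq_iff)
  moreover have "inv_into UNIV \<sigma> (x * y) = inv_into UNIV \<sigma> x * inv_into UNIV \<sigma> y" for x y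
    by (metis * galois_mult galois_eq_iff)
  moreover have "inv_into UNIV \<sigma> x = x" if "x \<in> K" for x
    by (metis * galois_fix that galois_eq_iff)
  ultimately show ?thesis
    using galois_bij by (simp add: galois_carrier_iff bij_imp_bij_inv)
qed

lemma galois_inv_apply: "\<sigma> (inv_into UNIV \<sigma> x) = x" "inv_into UNIV \<sigma> (\<sigma> x) = x"
  and galois_inv_comp: "\<sigma> \<circ> inv_into UNIV \<sigma> = id" "inv_into UNIV \<sigma> \<circ> \<sigma> = id"
  using galois_bij by (auto simp: fun_eq_iff bij_is_surj surj_f_inv_f bij_is_inj)

end

lemma galois_id: "id \<in> galois_carrier K"
  by (simp add: galois_carrier_iff)

lemma galois_comp: "\<sigma> \<in> galois_carrier K \<Longrightarrow> \<tau> \<in> galois_carrier K \<Longrightarrow> \<sigma> \<circ> \<tau> \<in> galois_carrier K"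
  by (simp add: galois_carrier_iff bij_comp)

lemma abs_galois_simps [simp]:
  "carrier (abs_galois K) = galois_carrier K" "x \<otimes>\<^bsub>abs_galois K\<^esub> y = x \<circ> y" "\<one>\<^bsub>abs_galois K\<^esub> = id"
  "topol (abs_galois K) = krull_topology K"
  by (simp_all add: abs_galois_def)

lemma group_abs_galois: "group (abs_galois K)"
proof (rule groupI)
  fix \<sigma> assume "\<sigma> \<in> carrier (abs_galois K)"
  then show "\<exists>\<tau>\<in>carrier (abs_galois K). \<tau> \<otimes>\<^bsub>abs_galois K\<^esub> \<sigma> = \<one>\<^bsub>abs_galois K\<^esub>"
    using galois_inv galois_inv_comp by auto
qed (auto simp: galois_id galois_comp o_assoc)

lemma inv_abs_galois: "\<sigma> \<in> galois_carrier K \<Longrightarrow> inv\<^bsub>abs_galois K\<^esub> \<sigma> = inv_into UNIV \<sigma>"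
  using group.inv_equality[OF group_abs_galois, of "inv_into UNIV \<sigma>" \<sigma>] galois_inv galois_inv_comp by simp

end

section \<open>Primes\<close>

context
  fixes F :: "'a::field_char_0 set" and P
  assumes F: "subfield F (ring_of_type_algebra :: 'a ring)" and P: "P \<in> primes_of F"
begin

lemma prime_ring: "ring (int_ring F)"
  and prime_subset: "P \<subseteq> {x \<in> F. algebraic_int x}"
  and prime_0: "0 \<in> P" and prime_add: "x \<in> P \<Longrightarrow> y \<in> P \<Longrightarrow> x + y \<in> P"
  and prime_mult: "x \<in> P \<Longrightarrow> y \<in> F \<Longrightarrow> algebraic_int y \<Longrightarrow> x * y \<in> P"
  and prime_1: "1 \<notin> P"
  and prime_inverse: "x \<in> F \<Longrightarrow> algebraic_int x \<Longrightarrow> x \<notin> P \<Longrightarrow> \<exists>y\<in>F. algebraic_int y \<and> x * y - 1 \<in> P"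
  and prime_nonzero: "\<exists>x\<in>P. x \<noteq> 0"
  using primes_of_iff[OF F, of P] P by auto

lemmas prime_int_add = ring_int_ringD(1)[OF prime_ring] and prime_int_mult = ring_int_ringD(2)[OF prime_ring]

lemma prime_mult': "x \<in> P \<Longrightarrow> y \<in> F \<Longrightarrow> algebraic_int y \<Longrightarrow> y * x \<in> P"
  using prime_mult by (simp add: mult.commute)

lemma prime_minus: "x \<in> P \<Longrightarrow> - x \<in> P"
  using prime_mult[of x "- 1"] subfield_ring_of_type_algebraD[OF F] by simp

lemma prime_diff: "x \<in> P \<Longrightarrow> y \<in> P \<Longrightarrow> x - y \<in> P"
  using prime_add[of x "- y"] prime_minus[of y] by simp

lemma prime_prime:
  assumes "x \<in> F" "algebraic_int x" "y \<in> F" "algebraic_int y" "x * y \<in> P" "x \<notin> P"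
  shows "y \<in> P"
proof -
  obtain z where z: "z \<in> F" "algebraic_int z" "x * z - 1 \<in> P"
    using prime_inverse assms by blast
  have "(x * y) * z \<in> P" "(x * z - 1) * y \<in> P"
    using z assms prime_mult by blast+
  then have "(x * y) * z - (x * z - 1) * y \<in> P" by (rule prime_diff)
  then show ?thesis by (simp add: algebra_simps)
qed

lemma subfield_of_int: "of_int n \<in> F"
proof -
  have "of_nat m \<in> F" for m
    by (induction m) (simp_all add: subfield_ring_of_type_algebraD[OF F])
  then show ?thesis
    by (cases n) (simp_all only: of_int_of_nat_eq of_int_minus subfield_ring_of_type_algebraD[OF F])
qed

lemma algebraic_int_of_int: "algebraic_int (of_int n :: 'a)"
  by (simp add: int_imp_algebraic_int)

lemma prime_int_poly:
  assumes "x \<in> F" "algebraic_int x"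
  shows "poly (map_poly of_int p) x \<in> F" "algebraic_int (poly (map_poly of_int p) x)"
proof -
  have "poly (map_poly of_int p) x \<in> F \<and> algebraic_int (poly (map_poly of_int p) x)"
    using assms algebraic_int_of_int
    by (induction p) (auto simp: map_poly_pCons subfield_of_int subfield_ring_of_type_algebraD[OF F]
        intro!: prime_int_add prime_int_mult)
  then show "poly (map_poly of_int p) x \<in> F" "algebraic_int (poly (map_poly of_int p) x)" by auto
qed

lemma prime_power_diff:
  assumes "x \<in> F" "algebraic_int x" "y \<in> F" "algebraic_int y" "x - y \<in> P"
  shows "x ^ n - y ^ n \<in> P"
proof (induction n)
  case (Suc n)
  have x: "x ^ n \<in> F \<and> algebraic_int (x ^ n)"
    using assms by (induction n) (auto intro: prime_int_mult subfield_ring_of_type_algebraD[OF F])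
  have "x ^ Suc n - y ^ Suc n = (x - y) * x ^ n + (x ^ n - y ^ n) * y"
    by (simp add: algebra_simps)
  then show ?case using assms x Suc by (simp add: prime_add prime_mult)
qed (simp add: prime_0)

text \<open>The integers in \<open>P\<close> form a prime ideal of the ring of integers. Its least
  positive member divides all the others by division with remainder, and is prime because
  \<open>P\<close> is.\<close>

lemma prime_least_integer:
  assumes "of_int n \<in> P" "n \<noteq> 0"
  obtains p :: nat where "Factorial_Ring.prime p" "int p dvd n" "of_nat p \<in> P"
proof -
  let ?A = "\<lambda>m::nat. m > 0 \<and> of_nat m \<in> P"
  have "?A (nat \<bar>n\<bar>)"
    using assms prime_minus[of "of_int n"] by (cases "n \<ge> 0") auto
  then have ex: "\<exists>m. ?A m" ..
  define p where "p = (LEAST m. ?A m)"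
  have p: "?A p" using ex unfolding p_def by (rule LeastI_ex)
  have least: "p \<le> m" if "?A m" for m unfolding p_def using that by (rule Least_le)
  have mem: "of_int k \<in> F" "algebraic_int (of_int k :: 'a)" for k :: int
    by (simp_all add: subfield_of_int algebraic_int_of_int)
  have dvd: "int p dvd k" if "of_int k \<in> P" for k
  proof -
    have "of_int k - of_nat p * of_int (k div int p) \<in> P"
      using p that mem by (intro prime_diff prime_mult) auto
    moreover have "of_int k - of_nat p * of_int (k div int p) = (of_int (k - int p * (k div int p)) :: 'a)"
      by simp
    ultimately have "of_int (k mod int p) \<in> P" by (simp add: minus_mult_div_eq_mod)
    moreover define r where "r = k mod int p"
    moreover have r: "r \<ge> 0" "r < int p" using p by (simp_all add: r_def)
    ultimately have "of_nat (nat r) \<in> P" by simp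
    then have "\<not> nat r > 0" using least[of "nat r"] r by linarith
    then have "k mod int p = 0" using r by (simp add: r_def)
    then show ?thesis by auto
  qed
  have "Factorial_Ring.prime p"
  proof (rule prime_natI)
    show "2 \<le> p" using p prime_1 by (cases "p = 1") auto
    fix m k :: nat assume "p dvd m * k"
    then have "of_nat (m * k) \<in> P"
      using p mem prime_mult by (metis dvdE of_int_of_nat_eq of_nat_mult)
    then have "of_nat m \<in> P \<or> of_nat k \<in> P"
      using prime_prime[of "of_nat m" "of_nat k"] mem[of "int m"] mem[of "int k"] by auto
    then show "p dvd m \<or> p dvd k"
      using dvd[of "int m"] dvd[of "int k"] by auto
  qed
  then show thesis using dvd assms p that by blast
qed

end

text \<open>An element of the larger ideal outside the smaller one would be invertible modulo the
  smaller, hence modulo the larger, where it vanishes.\<close>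

lemma prime_subset_imp_eq:
  assumes F: "subfield F (ring_of_type_algebra :: 'a::field_char_0 ring)" and "P \<in> primes_of F" "P' \<in> primes_of F" "P' \<subseteq> P"
  shows "P' = P"
proof (rule ccontr)
  assume "P' \<noteq> P"
  then obtain x where x: "x \<in> P" "x \<notin> P'" using assms by blast
  then have "x \<in> F" "algebraic_int x" using prime_subset[OF F assms(2)] by auto
  then obtain y where y: "y \<in> F" "algebraic_int y" "x * y - 1 \<in> P'"
    using prime_inverse[OF F assms(3)] x by blast
  have "x * y \<in> P" "x * y - 1 \<in> P"
    using y x assms(4) prime_mult[OF F assms(2)] by blast+
  then have "x * y - (x * y - 1) \<in> P" by (rule prime_diff[OF F assms(2)])
  then show False using prime_1[OF F assms(2)] by simp
qed

text \<open>After powers of \<open>d\<close> have been cancelled, an annihilating integer polynomial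
  has a nonzero constant term, and this term is a multiple of \<open>d\<close>. Every nonzero prime
  thereby contains a nonzero integer.\<close>

lemma ex_nonzero_integer_multiple:
  fixes d :: "'a::field_char_0"
  assumes "algebraic_int d" "d \<noteq> 0"
  obtains n :: int and g :: "int poly" where "n \<noteq> 0" "of_int n = d * poly (map_poly of_int g) d"
proof -
  obtain p where p: "poly (map_poly of_int p) d = 0" "p \<noteq> 0"
    using assms by (force simp: algebraic_int_altdef_ipoly)
  then have "\<exists>n g. n \<noteq> 0 \<and> of_int n = d * poly (map_poly of_int g) d"
  proof (induction p)
    case (pCons a p)
    show ?case
    proof (cases "a = 0")
      case True
      then show ?thesis using pCons assms by (auto simp: map_poly_pCons)
    next
      case False
      have "poly (map_poly of_int (- p)) d = - poly (map_poly of_int p) d"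
        by (simp add: poly_altdef coeff_map_poly degree_map_poly sum_negf)
      moreover have "of_int a + d * poly (map_poly of_int p) d = 0"
        using pCons.prems(1) by (simp add: map_poly_pCons)
      then have "of_int a = - (d * poly (map_poly of_int p) d)"
        by (simp only: eq_neg_iff_add_eq_0)
      ultimately have "of_int a = d * poly (map_poly of_int (- p)) d"
        by (simp only: mult_minus_right)
      then show ?thesis using False by blast
    qed
  qed simp
  then show thesis using that by blast
qed

lemma clear_denominators:
  assumes "finite A"
  shows "\<exists>(m::int) a. m \<noteq> 0 \<and> (\<forall>i\<in>A. of_int m * (r i :: rat) = of_int (a i))"
  using assms
proof (induction A rule: finite_induct)
  case empty
  show ?case by (intro exI[of _ 1]) simp
next
  case (insert j A)
  then obtain m :: int and a where m: "m \<noteq> 0" "\<forall>i\<in>A. of_int m * r i = of_int (a i)" by blast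
  obtain b c where bc: "r j = of_int b / of_int c" "c \<noteq> 0"
    by (cases "r j") (auto simp: Fract_of_int_quotient)
  show ?case
  proof (intro exI conjI ballI)
    show "m * c \<noteq> 0" using m bc by simp
    show "of_int (m * c) * r i = of_int (if i = j then m * b else c * a i)" if "i \<in> insert j A" for i
      using that m(2) bc by (auto simp: mult_ac)
  qed
qed

lemma prime_sum:
  assumes "subfield F (ring_of_type_algebra :: 'a::field_char_0 ring)" "P \<in> primes_of F"
    and "\<And>i. i \<in> A \<Longrightarrow> f i \<in> P"
  shows "sum f A \<in> P"
  using assms(3) prime_0[OF assms(1,2)] prime_add[OF assms(1,2)]
  by (induction A rule: infinite_finite_induct) auto

text \<open>The half of the Chinese remainder theorem that is needed: multiply elements that lie in
  the other primes but not in \<open>P\<close>, and use that \<open>P\<close> is prime.\<close>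

lemma maximal_ideal_separation:
  assumes F: "subfield F (ring_of_type_algebra :: 'a::field_char_0 ring)"
    and A: "finite A" "A \<subseteq> primes_of F" and P: "P \<in> A"
  shows "\<exists>x\<in>F. algebraic_int x \<and> x \<notin> P \<and> (\<forall>P'\<in>A - {P}. x \<in> P')"
proof -
  have PF: "P \<in> primes_of F" using A P by blast
  have "\<exists>x\<in>F. algebraic_int x \<and> x \<notin> P \<and> (\<forall>P'\<in>B. x \<in> P')" if "finite B" "B \<subseteq> A - {P}" for B
    using that
  proof (induction B rule: finite_induct)
    case empty
    show ?case using prime_1[OF F PF] subfield_ring_of_type_algebraD[OF F] by (intro bexI[of _ 1]) auto
  next
    case (insert P' B)
    then obtain x where x: "x \<in> F" "algebraic_int x" "x \<notin> P" "\<forall>P'\<in>B. x \<in> P'" by blast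
    have P': "P' \<in> primes_of F" "P' \<noteq> P" using insert A by auto
    then obtain y where y: "y \<in> P'" "y \<notin> P" using prime_subset_imp_eq[OF F PF] by blast
    have yF: "y \<in> F" "algebraic_int y" using prime_subset[OF F P'(1)] y by auto
    have "y * x \<notin> P" using prime_prime[OF F PF yF x(1,2)] y x by blast
    moreover have "y * x \<in> P''" if "P'' \<in> insert P' B" for P''
    proof (cases "P'' = P'")
      case True
      then show ?thesis using prime_mult[OF F P'(1) y(1)] x by simp
    next
      case False
      then have "P'' \<in> primes_of F" "x \<in> P''" using that insert A x by auto
      then show ?thesis using prime_mult'[OF F] yF by blast
    qed
    moreover have "y * x \<in> F" "algebraic_int (y * x)"
      using prime_int_mult[OF F PF] yF x subfield_ring_of_type_algebraD[OF F] by auto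
    ultimately show ?case by blast
  qed
  then show ?thesis using A by (metis finite_Diff order_refl)
qed

section \<open>Finiteness of primes and their restriction to \<open>K\<close>\<close>

context number_field_closure
begin

text \<open>Elements that separate finitely many primes over \<open>p\<close> are linearly
  independent over the rationals, which bounds the number of these primes by the length of a list
  spanning \<open>K\<close>. Independence is a descent: all coefficients of an integral relation are
  divisible by \<open>p\<close>, so the relation can be divided by \<open>p\<close> again and
  again.\<close>

lemma finite_primes_over_prime:
  assumes p: "Factorial_Ring.prime p"
  shows "finite {P \<in> primes_of K. of_nat p \<in> P}"
proof -
  interpret R: algebraic_closure "ring_of_type_algebra :: 'a ring" K by (rule cl)
  \<comment> \<open>Rational scalars act through \<open>of_rat\<close>, so that the bound on the
    size of independent sets in a span applies.\<close>
  interpret V: vector_space "\<lambda>r (x :: 'a). of_rat r * x"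
    by unfold_locales (auto simp: algebra_simps of_rat_add of_rat_mult)
  obtain us where us: "K = R.Span \<rat> us"
    using finite_spanning_set[OF subfield_Rats] nf unfolding number_field_def by metis
  have "R.Span \<rat> us \<subseteq> V.span (set us)" for us
  proof (induction us)
    case (Cons u us)
    have mono: "V.span (set us) \<subseteq> V.span (set (u # us))" by (intro V.span_mono) auto
    show ?case
    proof
      fix w assume "w \<in> R.Span \<rat> (u # us)"
      then obtain k v where w: "k \<in> \<rat>" "v \<in> R.Span \<rat> us" "w = k * u + v"
        by (auto simp: R.line_extension_mem_iff)
      obtain r where r: "k = of_rat r" using w(1) by (rule Rats_cases)
      have "of_rat r * u \<in> V.span (set (u # us))" by (intro V.span_scale V.span_base) simp
      moreover have "v \<in> V.span (set (u # us))" using w(2) Cons mono by blast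
      ultimately show "w \<in> V.span (set (u # us))" unfolding w(3) r by (rule V.span_add)
    qed
  qed (simp add: V.span_zero)
  then have K: "K \<subseteq> V.span (set us)" using us by blast
  have bound: "card A \<le> length us" if A: "finite A" "A \<subseteq> {P \<in> primes_of K. of_nat p \<in> P}" for A
  proof -
    have AP: "A \<subseteq> primes_of K" using A by auto
    have "\<forall>P\<in>A. \<exists>x. x \<in> K \<and> algebraic_int x \<and> x \<notin> P \<and> (\<forall>P'\<in>A - {P}. x \<in> P')"
      using maximal_ideal_separation[OF subfield_K A(1) AP] by blast
    then obtain x where x: "\<And>P. P \<in> A \<Longrightarrow> x P \<in> K" "\<And>P. P \<in> A \<Longrightarrow> algebraic_int (x P)"
      "\<And>P. P \<in> A \<Longrightarrow> x P \<notin> P" "\<And>P P'. P \<in> A \<Longrightarrow> P' \<in> A \<Longrightarrow> P \<noteq> P' \<Longrightarrow> x P \<in> P'"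
      by (metis Diff_iff singletonD)
    \<comment> \<open>Modulo \<open>P\<close> all terms of the relation but one vanish, and
      \<open>x P\<close> is not in \<open>P\<close>, so \<open>a P\<close> is. If \<open>p\<close>
      did not divide it, Bezout would put 1 into \<open>P\<close>.\<close>
    have step: "int p dvd a P" if "(\<Sum>P\<in>A. of_int (a P) * x P) = 0" "P \<in> A" for a :: "'a set \<Rightarrow> int" and P
    proof (rule ccontr)
      assume ndvd: "\<not> int p dvd a P"
      have PK: "P \<in> primes_of K" using AP that by blast
      note r = prime_add[OF subfield_K PK] prime_mult[OF subfield_K PK] prime_mult'[OF subfield_K PK]
        prime_minus[OF subfield_K PK] prime_0[OF subfield_K PK]
      have int: "of_int k \<in> K" "algebraic_int (of_int k :: 'a)" for k
        using subfield_of_int[OF subfield_K PK] algebraic_int_of_int by auto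
      have "(\<Sum>P'\<in>A - {P}. of_int (a P') * x P') \<in> P"
        using int x that by (intro prime_sum[OF subfield_K PK] prime_mult'[OF subfield_K PK]) auto
      moreover have "of_int (a P) * x P = - (\<Sum>P'\<in>A - {P}. of_int (a P') * x P')"
        using that A(1) by (simp add: sum.remove[of A P] eq_neg_iff_add_eq_0)
      ultimately have "of_int (a P) * x P \<in> P" using r by metis
      then have aP: "of_int (a P) \<in> P"
        using prime_prime[OF subfield_K PK, of "x P" "of_int (a P)"] x(1-3)[OF that(2)] int
        by (auto simp: mult.commute)
      have "Rings.coprime (int p) (a P)"
        using p ndvd by (simp add: prime_imp_coprime)
      then obtain s t where "s * int p + t * a P = 1"
        by (metis bezout_int coprime_imp_gcd_eq_1)
      then have "(1::'a) = of_int s * of_nat p + of_int t * of_int (a P)"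
        by (metis of_int_1 of_int_add of_int_mult of_int_of_nat_eq)
      moreover have "of_nat p \<in> P" using A that by blast
      ultimately have "1 \<in> P" using r int aP by metis
      then show False using prime_1[OF subfield_K PK] by blast
    qed
    \<comment> \<open>The quotients by \<open>p\<close> satisfy the same relation, since p is
      nonzero in characteristic 0.\<close>
    have power: "int p ^ k dvd a P" if "(\<Sum>P\<in>A. of_int (a P) * x P) = 0" "P \<in> A" for a :: "'a set \<Rightarrow> int" and P k
      using that
    proof (induction k arbitrary: a)
      case (Suc k)
      define b where "b P = a P div int p" for P
      have b: "a P = int p * b P" if "P \<in> A" for P
        using step[OF Suc.prems(1) that] by (simp add: b_def)
      have "of_int (int p) * (\<Sum>P\<in>A. of_int (b P) * x P) = (\<Sum>P\<in>A. of_int (a P) * x P)"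
        unfolding sum_distrib_left by (intro sum.cong refl) (simp add: b mult_ac)
      then have "(\<Sum>P\<in>A. of_int (b P) * x P) = 0"
        using Suc.prems p by auto
      then have "int p ^ k dvd b P" using Suc by blast
      then show ?case using b[OF Suc.prems(2)] by simp
    qed simp
    have zero: "a P = 0" if "(\<Sum>P\<in>A. of_int (a P) * x P) = 0" "P \<in> A" for a :: "'a set \<Rightarrow> int" and P
    proof (rule ccontr)
      assume "a P \<noteq> 0"
      obtain k :: nat where k: "nat \<bar>a P\<bar> < p ^ k"
        using p prime_ge_2_nat[OF p] by (meson less_exp order_less_le_trans power_mono zero_le)
      have "int p ^ k dvd \<bar>a P\<bar>" using power[OF that, of k] by simp
      then have "int p ^ k \<le> \<bar>a P\<bar>" using \<open>a P \<noteq> 0\<close> by (intro zdvd_imp_le) auto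
      then show False using k by (simp add: nat_less_iff)
    qed
    have inj: "inj_on x A"
      using x(3,4) by (metis inj_onI)
    have "V.independent (x ` A)"
    proof (rule V.independent_if_scalars_zero)
      fix r y assume r: "(\<Sum>v\<in>x ` A. of_rat (r v) * v) = 0" and y: "y \<in> x ` A"
      obtain m :: int and a where m: "m \<noteq> 0" "\<forall>P\<in>A. of_int m * r (x P) = of_int (a P)"
        using clear_denominators[OF A(1), of "\<lambda>P. r (x P)"] by blast
      have "(\<Sum>P\<in>A. of_int (a P) * x P) = of_int m * (\<Sum>P\<in>A. of_rat (r (x P)) * x P)"
        unfolding sum_distrib_left
      proof (intro sum.cong refl)
        fix P assume "P \<in> A"
        then have "of_int m * of_rat (r (x P)) = (of_int (a P) :: 'a)"
          using m(2) by (metis of_rat_mult of_rat_of_int_eq)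
        then show "of_int (a P) * x P = of_int m * (of_rat (r (x P)) * x P)"
          by (simp add: mult.assoc[symmetric])
      qed
      also have "\<dots> = 0" using r by (simp add: sum.reindex[OF inj])
      finally have "\<forall>P\<in>A. a P = 0" using zero by blast
      then show "r y = 0" using y m by auto
    qed (use A in simp)
    moreover have "x ` A \<subseteq> V.span (set us)" using x(1) K by blast
    ultimately have "card (x ` A) \<le> card (set us)"
      using V.independent_span_bound[of "set us" "x ` A"] by simp
    then show ?thesis using card_image[OF inj] card_length[of us] by simp
  qed
  show ?thesis
    by (rule conjunct1[OF finite_if_finite_subsets_card_bdd]) (rule bound)
qed

lemma finite_primes_dividing_integer:
  assumes "n \<noteq> 0"
  shows "finite {P \<in> primes_of K. of_int n \<in> P}"
proof (rule finite_subset)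
  show "{P \<in> primes_of K. of_int n \<in> P} \<subseteq> (\<Union>p\<in>{p. Factorial_Ring.prime p \<and> int p dvd n}. {P \<in> primes_of K. of_nat p \<in> P})"
  proof
    fix P assume "P \<in> {P \<in> primes_of K. of_int n \<in> P}"
    then have P: "P \<in> primes_of K" "of_int n \<in> P" by auto
    obtain p where "Factorial_Ring.prime p" "int p dvd n" "of_nat p \<in> P"
      by (rule prime_least_integer[OF subfield_K P assms])
    then show "P \<in> (\<Union>p\<in>{p. Factorial_Ring.prime p \<and> int p dvd n}. {P \<in> primes_of K. of_nat p \<in> P})"
      using P(1) by blast
  qed
  have "int ` {p. int p dvd n} \<subseteq> {d. d dvd n}" by auto
  then have "finite (int ` {p. int p dvd n})" using finite_divisors_int[OF assms] by (rule finite_subset)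
  then have "finite {p. int p dvd n}" by (rule finite_imageD) simp
  then show "finite (\<Union>p\<in>{p. Factorial_Ring.prime p \<and> int p dvd n}. {P \<in> primes_of K. of_nat p \<in> P})"
    using finite_primes_over_prime by auto
qed

text \<open>An inverse modulo \<open>v\<close> of an integer of \<open>K\<close> is a priori only
  known in the closure. It is found in \<open>K\<close> as an integer polynomial in the element,
  extracted from a monic equation for it with the help of the prime number in
  \<open>v\<close>.\<close>

lemma prime_over_in_primes_of:
  assumes v: "v \<in> primes_of UNIV"
  shows "v \<inter> K \<in> primes_of K"
proof -
  note pv = prime_add[OF subfield_UNIV v] prime_mult[OF subfield_UNIV v, simplified] prime_0[OF subfield_UNIV v]
    and fK = subfield_ring_of_type_algebraD[OF subfield_K]
  have ringK: "ring (int_ring K)"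
    by (rule ring_int_ring_subfield[OF subfield_K prime_ring[OF subfield_UNIV v]])
  have int: "of_int k \<in> K" "algebraic_int (of_int k :: 'a)" for k
  proof -
    have "of_nat m \<in> K" for m by (induction m) (simp_all add: fK)
    then show "of_int k \<in> K" by (cases k) (simp_all only: of_int_of_nat_eq of_int_minus fK)
  qed (simp add: int_imp_algebraic_int)
  have polyK: "poly (map_poly of_int h) x \<in> K" if "x \<in> K" for h x
    using that by (induction h) (simp_all add: map_poly_pCons int fK)
  have sub: "v \<subseteq> {x. algebraic_int x}" using prime_subset[OF subfield_UNIV v] by simp
  obtain d where d: "d \<in> v" "d \<noteq> 0" using prime_nonzero[OF subfield_UNIV v] by blast
  then obtain n g where n: "n \<noteq> 0" "of_int n = d * poly (map_poly of_int g) d"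
    using ex_nonzero_integer_multiple sub by blast
  have "of_int n \<in> v"
    unfolding n(2) using prime_int_poly(2)[OF subfield_UNIV v, of d] d sub by (intro pv(2)) auto
  then obtain p where p: "Factorial_Ring.prime p" "of_nat p \<in> v"
    using prime_least_integer[OF subfield_UNIV v] n(1) by metis
  have ex: "\<exists>w\<in>K. algebraic_int w \<and> x * w - 1 \<in> v"
    if x: "x \<in> K" "algebraic_int x" "x \<notin> v"
      and "poly (map_poly of_int h) x \<in> v" "\<exists>i. \<not> int p dvd Polynomial.coeff h i" for x h
    using that(4,5)
  proof (induction h)
    case (pCons a h)
    have hx: "poly (map_poly of_int h) x \<in> K" "algebraic_int (poly (map_poly of_int h) x)"
      using polyK[OF x(1)] prime_int_poly(2)[OF subfield_UNIV v, of x] x by auto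
    have e: "of_int a + x * poly (map_poly of_int h) x \<in> v"
      using pCons.prems by (simp add: map_poly_pCons)
    show ?case
    proof (cases "int p dvd a")
      case True
      then obtain b where "a = int p * b" by blast
      then have "of_int a \<in> v" using pv(2)[OF p(2), of "of_int b"] int by simp
      from prime_diff[OF subfield_UNIV v e this] have "x * poly (map_poly of_int h) x \<in> v"
        by simp
      then have "poly (map_poly of_int h) x \<in> v"
        using prime_prime[OF subfield_UNIV v, of x] x hx by simp
      moreover have "\<exists>i. \<not> int p dvd Polynomial.coeff h i"
      proof -
        obtain i where "\<not> int p dvd Polynomial.coeff (pCons a h) i" using pCons.prems(2) by blast
        then show ?thesis using True by (cases i) auto
      qed
      ultimately show ?thesis by (rule pCons.IH)
    next
      case False
      then have "Rings.coprime (int p) a" using p by (simp add: prime_imp_coprime)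
      then obtain s t where st: "s * int p + t * a = 1"
        by (metis bezout_int coprime_imp_gcd_eq_1)
      \<comment> \<open>Modulo \<open>v\<close>, x h(x) is -a, and t inverts a because
        \<open>p\<close> vanishes; so -t h(x) inverts x.\<close>
      define w where "w = of_int (- t) * poly (map_poly of_int h) x"
      have "x * w - 1 = (of_int a + x * poly (map_poly of_int h) x) * of_int (- t) + of_nat p * of_int (- s)"
      proof -
        have "(1::'a) = of_int s * of_nat p + of_int t * of_int a"
          using st by (metis of_int_1 of_int_add of_int_mult of_int_of_nat_eq)
        then show ?thesis by (simp add: w_def algebra_simps)
      qed
      moreover have "(of_int a + x * poly (map_poly of_int h) x) * of_int (- t) + of_nat p * of_int (- s) \<in> v"
        by (intro pv(1)[OF pv(2)[OF e] pv(2)[OF p(2)]] int)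
      ultimately have "x * w - 1 \<in> v" by metis
      moreover have "w \<in> K"
        unfolding w_def by (intro fK(4) int hx)
      moreover have "algebraic_int w"
        unfolding w_def by (intro prime_int_mult[OF subfield_UNIV v] int hx UNIV_I)
      ultimately show ?thesis by blast
    qed
  qed simp
  have "\<exists>w\<in>K. algebraic_int w \<and> x * w - 1 \<in> v" if x: "x \<in> K" "algebraic_int x" "x \<notin> v" for x
  proof -
    obtain h where h: "poly (map_poly of_int h) x = 0" "Polynomial.lead_coeff h = 1"
      using x by (auto simp: algebraic_int_altdef_ipoly)
    \<comment> \<open>A monic polynomial has a coefficient that is prime to \<open>p\<close>, as the
      induction requires.\<close>
    have "\<not> int p dvd Polynomial.lead_coeff h" using p h(2) by (simp add: prime_nat_iff)
    moreover have "poly (map_poly of_int h) x \<in> v" using h(1) pv(3) by simp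
    ultimately show ?thesis using ex[OF x, of h] by blast
  qed
  note inv = this
  have "\<forall>x\<in>{x \<in> K. algebraic_int x} - v \<inter> K. \<exists>y\<in>{x \<in> K. algebraic_int x}. x * y - 1 \<in> v \<inter> K"
  proof
    fix x assume x: "x \<in> {x \<in> K. algebraic_int x} - v \<inter> K"
    then obtain w where w: "w \<in> K" "algebraic_int w" "x * w - 1 \<in> v" using inv[of x] by blast
    have "x * w - 1 \<in> K" using fK(3)[OF fK(4)[of x w] fK(5)[OF fK(2)]] x w by simp
    then show "\<exists>y\<in>{x \<in> K. algebraic_int x}. x * y - 1 \<in> v \<inter> K" using w by blast
  qed
  moreover have "of_int n \<in> v \<inter> K" "of_int n \<noteq> (0 :: 'a)"
    using \<open>of_int n \<in> v\<close> int(1)[of n] n(1) by simp_all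
  then have "v \<inter> K \<noteq> {0}" by blast
  ultimately show ?thesis
    unfolding primes_of_iff[OF subfield_K]
    using ringK sub pv fK(1,3,4) prime_1[OF subfield_UNIV v] by (intro conjI) auto
qed

text \<open>Such a prime contains a fixed nonzero integer multiple of \<open>d\<close>, which only
  finitely many primes of \<open>K\<close> do. It will be applied to differences of elements of a
  Galois-stable set.\<close>

lemma finite_primes_under:
  assumes "d \<noteq> 0"
  shows "finite {v \<inter> K |v. v \<in> primes_of UNIV \<and> d \<in> v}"
proof (cases "algebraic_int d")
  case True
  then obtain n g where n: "n \<noteq> 0" "of_int n = d * poly (map_poly of_int g) d"
    using ex_nonzero_integer_multiple assms by blast
  show ?thesis
  proof (rule finite_subset[OF _ finite_primes_dividing_integer[OF n(1)]])
    have "of_int n \<in> v \<inter> K" if v: "v \<in> primes_of UNIV" "d \<in> v" for v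
    proof
      show "of_int n \<in> v"
        unfolding n(2) using prime_int_poly(2)[OF subfield_UNIV v(1), of d] True v
        by (intro prime_mult[OF subfield_UNIV v(1)]) auto
      show "of_int n \<in> K"
        by (rule subfield_of_int[OF subfield_K prime_over_in_primes_of[OF v(1)]])
    qed
    then show "{v \<inter> K |v. v \<in> primes_of UNIV \<and> d \<in> v} \<subseteq> {P \<in> primes_of K. of_int n \<in> P}"
      using prime_over_in_primes_of by auto
  qed
next
  case False
  then have "{v \<inter> K |v. v \<in> primes_of UNIV \<and> d \<in> v} = {}"
    using prime_subset[OF subfield_UNIV] by auto
  then show ?thesis by (simp only: finite.emptyI)
qed

lemma galois_image_prime:
  assumes \<sigma>: "\<sigma> \<in> galois_carrier K" and v: "v \<in> primes_of UNIV"
  shows "\<sigma> ` v \<in> primes_of UNIV" and "\<sigma> ` v \<inter> K = v \<inter> K"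
proof -
  note g = galois_add[OF \<sigma>, symmetric] galois_mult[OF \<sigma>, symmetric] galois_algebraic_int[OF \<sigma>]
  have mem: "\<sigma> x \<in> \<sigma> ` v \<longleftrightarrow> x \<in> v" for x
    using galois_eq_iff[OF \<sigma>] by auto
  have surj: "\<exists>x. y = \<sigma> x" for y using galois_inv_apply(1)[OF \<sigma>] by metis
  have all: "(\<forall>y. Q y) \<longleftrightarrow> (\<forall>x. Q (\<sigma> x))" for Q using surj by metis
  have one: "1 \<notin> \<sigma> ` v"
    using mem[of 1] prime_1[OF subfield_UNIV v] by (simp add: galois_1[OF \<sigma>])
  have inv: "\<exists>y. algebraic_int y \<and> x * y - 1 \<in> \<sigma> ` v" if x: "algebraic_int x" "x \<notin> \<sigma> ` v" for x
  proof -
    obtain z where z: "x = \<sigma> z" using surj by blast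
    then obtain y where "algebraic_int y" "z * y - 1 \<in> v"
      using prime_inverse[OF subfield_UNIV v, of z] x mem g(3) by auto
    then have "algebraic_int (\<sigma> y)" "\<sigma> (z * y - 1) \<in> \<sigma> ` v" using g mem by auto
    then show ?thesis by (auto simp: z galois_diff[OF \<sigma>] galois_mult[OF \<sigma>] galois_1[OF \<sigma>])
  qed
  have mult: "x * y \<in> \<sigma> ` v" if xy: "x \<in> \<sigma> ` v" "algebraic_int y" for x y
  proof -
    obtain a where a: "x = \<sigma> a" "a \<in> v" using xy(1) by blast
    obtain b where b: "y = \<sigma> b" using surj by blast
    then have "a * b \<in> v" using xy(2) g(3) a(2) prime_mult[OF subfield_UNIV v, of a b] by simp
    then show ?thesis unfolding a b g(2) by (rule imageI)
  qed
  have "0 \<in> \<sigma> ` v" using mem[of 0] prime_0[OF subfield_UNIV v] by (simp add: galois_0[OF \<sigma>])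
  moreover have "\<sigma> ` v \<noteq> {0}"
    using prime_nonzero[OF subfield_UNIV v] mem galois_eq_iff[OF \<sigma>, of _ 0] by (auto simp: galois_0[OF \<sigma>])
  moreover have "x + y \<in> \<sigma> ` v" if "x \<in> \<sigma> ` v" "y \<in> \<sigma> ` v" for x y
    using that prime_add[OF subfield_UNIV v] by (auto simp: g(1))
  moreover have "\<sigma> ` v \<subseteq> {x. algebraic_int x}"
    using prime_subset[OF subfield_UNIV v] g(3) by auto
  ultimately show "\<sigma> ` v \<in> primes_of UNIV"
    unfolding primes_of_iff[OF subfield_UNIV] using prime_ring[OF subfield_UNIV v] one inv mult by auto
  show "\<sigma> ` v \<inter> K = v \<inter> K"
    using galois_fix[OF \<sigma>] mem by (metis (no_types, lifting) Int_iff subsetI subset_antisym)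
qed

end

lemma continuous_map_into_discrete:
  assumes "\<And>x. x \<in> topspace Y \<Longrightarrow> f x \<in> N" and "\<And>y. y \<in> N \<Longrightarrow> openin Y {x \<in> topspace Y. f x = y}"
  shows "continuous_map Y (discrete_topology N) f"
proof -
  have "openin Y {x \<in> topspace Y. f x \<in> U}" if "U \<subseteq> N" for U
  proof -
    have eq: "{x \<in> topspace Y. f x \<in> U} = (\<Union>y\<in>U. {x \<in> topspace Y. f x = y})" by blast
    show ?thesis unfolding eq by (rule openin_Union) (use that assms(2) in auto)
  qed
  then show ?thesis using assms(1) by (auto simp: continuous_map_def)
qed

lemma continuous_map_discrete_openin:
  assumes "continuous_map Y (discrete_topology N) f"
  shows "openin Y {x \<in> topspace Y. P (f x)}"
proof -
  have "openin Y {x \<in> topspace Y. f x \<in> {y \<in> N. P y}}"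
    by (rule openin_continuous_map_preimage[OF assms]) auto
  moreover have "{x \<in> topspace Y. f x \<in> {y \<in> N. P y}} = {x \<in> topspace Y. P (f x)}"
    using continuous_map_funspace[OF assms] by auto
  ultimately show ?thesis by simp
qed

lemma continuous_map_discrete_closedin:
  assumes "continuous_map Y (discrete_topology N) f"
  shows "closedin Y {x \<in> topspace Y. P (f x)}"
proof -
  have "topspace Y - {x \<in> topspace Y. P (f x)} = {x \<in> topspace Y. \<not> P (f x)}" by blast
  then show ?thesis
    using continuous_map_discrete_openin[OF assms, of "\<lambda>y. \<not> P y"] by (simp add: closedin_def)
qed

section \<open>The Krull topology\<close>

context number_field_closure
begin

lemma topspace_krull [simp]: "topspace (krull_topology K) = galois_carrier K"
proof -
  obtain E where "K \<subseteq> E" "subfield E (ring_of_type_algebra :: 'a ring)"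
    "ring.finite_dimension (ring_of_type_algebra :: 'a ring) K E"
    using ex_finite_extension[of 0] by metis
  then show ?thesis
    by (auto simp: krull_topology_def)
qed

lemma openin_krull_eval: "openin (krull_topology K) {\<tau> \<in> galois_carrier K. \<tau> x = y}"
proof (rule openin_subopen[THEN iffD2], intro ballI)
  fix \<sigma> assume \<sigma>: "\<sigma> \<in> {\<tau> \<in> galois_carrier K. \<tau> x = y}"
  obtain E where E: "x \<in> E" "K \<subseteq> E" "subfield E (ring_of_type_algebra :: 'a ring)"
    "ring.finite_dimension (ring_of_type_algebra :: 'a ring) K E"
    using ex_finite_extension[of x] by metis
  let ?U = "{\<tau> \<in> galois_carrier K. \<forall>z\<in>E. \<tau> z = \<sigma> z}"
  have "openin (krull_topology K) ?U"
    unfolding krull_topology_def using \<sigma> E by (intro topology_generated_by_Basis) blast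
  moreover have "\<sigma> \<in> ?U" "?U \<subseteq> {\<tau> \<in> galois_carrier K. \<tau> x = y}" using \<sigma> E(1) by auto
  ultimately show "\<exists>T. openin (krull_topology K) T \<and> \<sigma> \<in> T \<and> T \<subseteq> {\<tau> \<in> galois_carrier K. \<tau> x = y}"
    by blast
qed

lemma eq_on_Span:
  assumes "\<sigma> \<in> galois_carrier K" "\<tau> \<in> galois_carrier K" "\<forall>u\<in>set us. \<sigma> u = \<tau> u"
    and "x \<in> ring.Span (ring_of_type_algebra :: 'a ring) K us"
  shows "\<sigma> x = \<tau> x"
proof -
  interpret algebraic_closure "ring_of_type_algebra :: 'a ring" K by (rule cl)
  from assms(3,4) show ?thesis
  proof (induction us arbitrary: x)
    case Nil
    then show ?case using assms(1,2) by (simp add: galois_0)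
  next
    case (Cons u us)
    then obtain k v where "k \<in> K" "v \<in> Span K us" "x = k * u + v"
      by (auto simp: line_extension_mem_iff)
    then show ?case using Cons assms(1,2) by (simp add: galois_add galois_mult galois_fix)
  qed
qed

text \<open>With \<open>openin_krull_eval\<close> this identifies the Krull topology with pointwise
  convergence for the discrete topology on the field: on a finite extension an automorphism is
  determined by its values on a finite spanning list.\<close>

lemma continuous_map_krull:
  assumes f: "\<And>x. x \<in> topspace Y \<Longrightarrow> f x \<in> galois_carrier K"
    and "\<And>a b. openin Y {x \<in> topspace Y. f x a = b}"
  shows "continuous_map Y (krull_topology K) f"
  unfolding krull_topology_def
proof (rule continuous_on_generated_topo)
  show "f ` topspace Y \<subseteq> \<Union>{{\<tau> \<in> galois_carrier K. \<forall>x\<in>E. \<tau> x = \<sigma> x} | \<sigma> E.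
        \<sigma> \<in> galois_carrier K \<and> K \<subseteq> E \<and> subfield E (ring_of_type_algebra :: 'a ring) \<and>
        ring.finite_dimension (ring_of_type_algebra :: 'a ring) K E}"
    using f topspace_krull unfolding krull_topology_def topology_generated_by_topspace by blast
  fix U assume "U \<in> {{\<tau> \<in> galois_carrier K. \<forall>x\<in>E. \<tau> x = \<sigma> x} | \<sigma> E.
        \<sigma> \<in> galois_carrier K \<and> K \<subseteq> E \<and> subfield E (ring_of_type_algebra :: 'a ring) \<and>
        ring.finite_dimension (ring_of_type_algebra :: 'a ring) K E}"
  then obtain \<sigma> E where U: "U = {\<tau> \<in> galois_carrier K. \<forall>x\<in>E. \<tau> x = \<sigma> x}" and \<sigma>: "\<sigma> \<in> galois_carrier K"
    and E: "ring.finite_dimension (ring_of_type_algebra :: 'a ring) K E"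
    by blast
  obtain us where us: "set us \<subseteq> E" "E = ring.Span (ring_of_type_algebra :: 'a ring) K us"
    using finite_spanning_set[OF subfield_K E] by blast
  have "f -` U \<inter> topspace Y = topspace Y \<inter> (\<Inter>u\<in>set us. {x \<in> topspace Y. f x u = \<sigma> u})"
  proof
    show "f -` U \<inter> topspace Y \<subseteq> topspace Y \<inter> (\<Inter>u\<in>set us. {x \<in> topspace Y. f x u = \<sigma> u})"
      using us(1) by (auto simp: U)
    show "topspace Y \<inter> (\<Inter>u\<in>set us. {x \<in> topspace Y. f x u = \<sigma> u}) \<subseteq> f -` U \<inter> topspace Y"
      using eq_on_Span[OF f \<sigma>] f by (auto simp: U us(2))
  qed
  also have "openin Y \<dots>"
    by (cases "us = []") (auto intro!: openin_Int openin_INT2 assms(2))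
  finally show "openin Y (f -` U \<inter> topspace Y)" .
qed

text \<open>Every element has finitely many conjugates, so the Galois group sits in a product of
  finite discrete spaces, compact by Tychonoff. The conditions that define it there are
  closed.\<close>

lemma compact_space_krull: "compact_space (krull_topology K)"
proof -
  have "\<exists>p. p \<noteq> 0 \<and> poly (map_poly of_int p) x = 0" for x :: 'a
    using all_algebraic[of x] by (metis algebraicE')
  then obtain p where p: "\<And>x :: 'a. p x \<noteq> 0" "\<And>x :: 'a. poly (map_poly of_int (p x)) x = 0"
    by metis
  define R where "R x = {y :: 'a. poly (map_poly of_int (p x)) y = 0}" for x
  have "finite (R x)" for x
  proof -
    have "map_poly of_int (p x) \<noteq> (0 :: 'a poly)" using p(1)[of x] by (simp add: map_poly_eq_0_iff)
    then show ?thesis unfolding R_def by (rule poly_roots_finite)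
  qed
  define T where "T = product_topology (\<lambda>x. discrete_topology (R x)) UNIV"
  have T: "compact_space T"
    unfolding T_def using \<open>\<And>x. finite (R x)\<close>
    by (simp add: compact_space_product_topology compact_space_discrete_topology)
  have tT: "topspace T = (\<Pi>\<^sub>E x\<in>UNIV. R x)" by (simp add: T_def)
  have ev: "openin T {f \<in> topspace T. P (f x)}" "closedin T {f \<in> topspace T. P (f x)}" for x P
  proof -
    have "continuous_map T (discrete_topology (R x)) (\<lambda>f. f x)"
      unfolding T_def by (rule continuous_map_product_projection) simp
    then show "openin T {f \<in> topspace T. P (f x)}" "closedin T {f \<in> topspace T. P (f x)}"
      using continuous_map_discrete_openin[of T "R x" "\<lambda>f. f x" P] continuous_map_discrete_closedin[of T "R x" "\<lambda>f. f x" P]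
      by auto
  qed
  \<comment> \<open>A violation involves only the three coordinates x, y and h x y, so it persists
    on an open set.\<close>
  have binary: "closedin T {f \<in> topspace T. f (h x y) = h (f x) (f y)}" for h x y
  proof -
    have "topspace T - {f \<in> topspace T. f (h x y) = h (f x) (f y)} =
       (\<Union>a. \<Union>b. {f \<in> topspace T. f x = a} \<inter> {f \<in> topspace T. f y = b} \<inter> {f \<in> topspace T. f (h x y) \<noteq> h a b})"
      by blast
    also have "openin T \<dots>" by (auto intro!: openin_Union openin_Int ev)
    finally show ?thesis by (simp add: closedin_def)
  qed
  let ?C = "(\<Inter>x. \<Inter>y. {f \<in> topspace T. f (x + y) = f x + f y}) \<inter> (\<Inter>x. \<Inter>y. {f \<in> topspace T. f (x * y) = f x * f y})
    \<inter> (\<Inter>x\<in>K. {f \<in> topspace T. f x = x})"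
  have "0 \<in> K" "1 \<in> K" using subfield_ring_of_type_algebraD[OF subfield_K] by auto
  have gal: "galois_carrier K = ?C"
  proof
    have "\<sigma> \<in> topspace T" if "\<sigma> \<in> galois_carrier K" for \<sigma>
      using galois_poly[OF that] p(2) by (auto simp: tT R_def galois_0[OF that])
    then show "galois_carrier K \<subseteq> ?C"
      by (auto simp: galois_add galois_mult galois_fix)
    show "?C \<subseteq> galois_carrier K"
    proof
      fix f assume f: "f \<in> ?C"
      then have add: "f (x + y) = f x + f y" and mult: "f (x * y) = f x * f y" for x y by auto
      have fixK: "f x = x" if "x \<in> K" for x using f that by auto
      have "inj f"
      proof (rule injI, rule ccontr)
        fix x y assume xy: "f x = f y" "x \<noteq> y"
        have "f (x - y) + f y = f x" by (simp flip: add)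
        then have "f (x - y) = 0" using xy by simp
        moreover have "f ((x - y) * inverse (x - y)) = f (x - y) * f (inverse (x - y))" by (rule mult)
        ultimately have "f 1 = 0" using xy by simp
        then show False using fixK \<open>1 \<in> K\<close> by simp
      qed
      have ofint: "f (of_int n) = of_int n" for n
      proof -
        have nat: "f (of_nat m) = of_nat m" for m
          by (induction m) (simp_all add: fixK \<open>0 \<in> K\<close> \<open>1 \<in> K\<close> add)
        have "f (- of_nat m) + f (of_nat m) = f (- of_nat m + of_nat m)" for m by (rule add[symmetric])
        then have "f (- of_nat m) = - of_nat m" for m
          by (simp add: nat fixK \<open>0 \<in> K\<close> eq_neg_iff_add_eq_0)
        with nat show ?thesis by (cases n rule: int_cases2) simp_all
      qed
      have poly: "poly (map_poly of_int q) (f x) = f (poly (map_poly of_int q) x)" for q x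
        by (induction q) (simp_all add: map_poly_pCons fixK \<open>0 \<in> K\<close> add mult ofint)
      \<comment> \<open>Surjectivity is not a closed condition; it follows because an injective map
        permutes each finite set of conjugates.\<close>
      have "\<exists>x. f x = y" for y
      proof -
        have "f ` R y \<subseteq> R y" using fixK[OF \<open>0 \<in> K\<close>] by (auto simp: R_def poly)
        then have "f ` R y = R y"
          using \<open>finite (R y)\<close> inj_on_subset[OF \<open>inj f\<close>] by (simp add: endo_inj_surj)
        moreover have "y \<in> R y" using p(2) by (simp add: R_def)
        ultimately have "y \<in> f ` R y" by simp
        then show ?thesis by blast
      qed
      then have "bij f" using \<open>inj f\<close> by (metis bijI surjI)
      then show "f \<in> galois_carrier K" using add mult fixK by (simp add: galois_carrier_iff)
    qed
  qed
  have "closedin T ?C"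
    using \<open>0 \<in> K\<close> by (intro closedin_Int closedin_INT binary ev) auto
  then have "closedin T (galois_carrier K)" unfolding gal .
  then have cpt: "compactin T (galois_carrier K)" using T by (rule closedin_compact_space[rotated])
  \<comment> \<open>Compactness is known for the subspace topology of the product and carried over
    to the Krull topology by the identity map.\<close>
  have "continuous_map (subtopology T (galois_carrier K)) (krull_topology K) id"
  proof (rule continuous_map_krull)
    have sub: "galois_carrier K \<subseteq> topspace T" using closedin_subset[OF \<open>closedin T (galois_carrier K)\<close>] .
    then show "id x \<in> galois_carrier K" if "x \<in> topspace (subtopology T (galois_carrier K))" for x
      using that by simp
    fix a b
    have "openin (subtopology T (galois_carrier K)) (galois_carrier K \<inter> {f \<in> topspace T. f a = b})"
      by (intro openin_subtopology_Int2 ev)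
    moreover have "galois_carrier K \<inter> {f \<in> topspace T. f a = b} = {x \<in> topspace (subtopology T (galois_carrier K)). id x a = b}"
      by auto
    ultimately show "openin (subtopology T (galois_carrier K)) {x \<in> topspace (subtopology T (galois_carrier K)). id x a = b}"
      by simp
  qed
  then have "compactin (krull_topology K) (id ` galois_carrier K)"
    by (rule image_compactin[rotated]) (simp add: compactin_subtopology cpt)
  then show ?thesis by (simp add: compact_space_def)
qed

section \<open>Inertia and Weil monoids\<close>

definition residue_card :: "'a set \<Rightarrow> nat" where
  "residue_card v = card (carrier (int_ring K Quot (v \<inter> K)))"

text \<open>A common form for inertia (exponent 1) and Frobenius (the residue cardinality). The
  exponent multiplies under composition and thus replaces the degree on the Weil monoid.\<close>

definition power_mod :: "'a set \<Rightarrow> nat \<Rightarrow> ('a \<Rightarrow> 'a) \<Rightarrow> bool" where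
  "power_mod v m \<sigma> \<longleftrightarrow> (\<forall>x. algebraic_int x \<longrightarrow> \<sigma> x - x ^ m \<in> v)"

abbreviation conj_by :: "('a \<Rightarrow> 'a) \<Rightarrow> ('a \<Rightarrow> 'a) \<Rightarrow> 'a \<Rightarrow> 'a" where
  "conj_by \<sigma> \<rho> \<equiv> \<sigma> \<circ> \<rho> \<circ> inv_into UNIV \<sigma>"

abbreviation frob_power :: "'a set \<Rightarrow> nat \<Rightarrow> ('a \<Rightarrow> 'a) set" where
  "frob_power v n \<equiv> frobenius K v [^]\<^bsub>decomp_group K v Mod inertia K v\<^esub> n"

abbreviation inertia_coset :: "'a set \<Rightarrow> ('a \<Rightarrow> 'a) \<Rightarrow> ('a \<Rightarrow> 'a) set" where
  "inertia_coset v \<sigma> \<equiv> inertia K v #>\<^bsub>decomp_group K v\<^esub> \<sigma>"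

lemma frobenius_eq: "frobenius K v = {\<sigma> \<in> decomp K v. power_mod v (residue_card v) \<sigma>}"
  by (simp add: frobenius_def power_mod_def residue_card_def)

lemma frob_power_simps:
  "frob_power v 0 = inertia K v"
  "frob_power v (Suc n) = {\<sigma> \<circ> \<tau> | \<sigma> \<tau>. \<sigma> \<in> frob_power v n \<and> \<tau> \<in> frobenius K v}"
  by (auto simp: FactGroup_def set_mult_def decomp_group_def)

lemma inertia_coset_eq: "inertia_coset v \<sigma> = {u \<circ> \<sigma> | u. u \<in> inertia K v}"
  by (auto simp: r_coset_def decomp_group_def)

lemma galois_image_comp: "(\<sigma> \<circ> \<tau>) ` v = \<sigma> ` \<tau> ` v"
  by (simp add: image_comp)

lemma decomp_subset: "decomp K v \<subseteq> galois_carrier K"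
  by (auto simp: decomp_def)

lemma decomp_comp: "\<sigma> \<in> decomp K v \<Longrightarrow> \<tau> \<in> decomp K v \<Longrightarrow> \<sigma> \<circ> \<tau> \<in> decomp K v"
  unfolding decomp_def mem_Collect_eq galois_image_comp by (simp add: galois_comp)

lemma conj_galois: "\<sigma> \<in> galois_carrier K \<Longrightarrow> \<rho> \<in> galois_carrier K \<Longrightarrow> conj_by \<sigma> \<rho> \<in> galois_carrier K"
  by (intro galois_comp galois_inv)

lemma conj_comp: "\<sigma> \<in> galois_carrier K \<Longrightarrow> conj_by \<sigma> (\<rho> \<circ> \<tau>) = conj_by \<sigma> \<rho> \<circ> conj_by \<sigma> \<tau>"
  by (simp add: fun_eq_iff galois_inv_apply)

lemma conj_inverse: "\<sigma> \<in> galois_carrier K \<Longrightarrow> conj_by (inv_into UNIV \<sigma>) (conj_by \<sigma> \<rho>) = \<rho>"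
  by (simp add: fun_eq_iff galois_inv_apply inv_inv_eq galois_bij)

lemma conj_inverse': "\<sigma> \<in> galois_carrier K \<Longrightarrow> conj_by \<sigma> (conj_by (inv_into UNIV \<sigma>) \<rho>) = \<rho>"
  by (simp add: fun_eq_iff galois_inv_apply inv_inv_eq galois_bij)

lemma image_inverse: "\<sigma> \<in> galois_carrier K \<Longrightarrow> inv_into UNIV \<sigma> ` \<sigma> ` v = v"
  by (simp add: image_comp galois_inv_comp)

lemma conj_decomp:
  assumes "\<sigma> \<in> galois_carrier K" "\<rho> \<in> decomp K v"
  shows "conj_by \<sigma> \<rho> \<in> decomp K (\<sigma> ` v)"
  using assms unfolding decomp_def mem_Collect_eq galois_image_comp
  by (simp only: image_inverse conj_galois simp_thms)

lemma conj_power_mod: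
  assumes \<sigma>: "\<sigma> \<in> galois_carrier K" and "power_mod v m \<rho>"
  shows "power_mod (\<sigma> ` v) m (conj_by \<sigma> \<rho>)"
  unfolding power_mod_def
proof (intro allI impI)
  fix x :: 'a assume "algebraic_int x"
  then have "algebraic_int (inv_into UNIV \<sigma> x)" using galois_algebraic_int[OF galois_inv[OF \<sigma>]] by simp
  then have "\<sigma> (\<rho> (inv_into UNIV \<sigma> x) - inv_into UNIV \<sigma> x ^ m) \<in> \<sigma> ` v"
    using assms(2) by (auto simp: power_mod_def)
  then show "conj_by \<sigma> \<rho> x - x ^ m \<in> \<sigma> ` v"
    by (simp add: galois_diff[OF \<sigma>] galois_power[OF \<sigma>] galois_inv_apply[OF \<sigma>])
qed

lemma residue_card_image:
  "\<sigma> \<in> galois_carrier K \<Longrightarrow> v \<in> primes_of UNIV \<Longrightarrow> residue_card (\<sigma> ` v) = residue_card v"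
  by (simp add: residue_card_def galois_image_prime)

lemma conj_image_eqI:
  assumes \<sigma>: "\<sigma> \<in> galois_carrier K" and v: "v \<in> primes_of UNIV"
    and sub: "\<And>\<sigma> v \<rho>. \<sigma> \<in> galois_carrier K \<Longrightarrow> v \<in> primes_of UNIV \<Longrightarrow> \<rho> \<in> A v \<Longrightarrow> conj_by \<sigma> \<rho> \<in> A (\<sigma> ` v)"
  shows "conj_by \<sigma> \<rho> \<in> A (\<sigma> ` v) \<longleftrightarrow> \<rho> \<in> A v" and "A (\<sigma> ` v) = conj_by \<sigma> ` A v"
proof -
  have pull: "conj_by (inv_into UNIV \<sigma>) \<rho> \<in> A v" if "\<rho> \<in> A (\<sigma> ` v)" for \<rho>
    using sub[OF galois_inv[OF \<sigma>] galois_image_prime(1)[OF \<sigma> v] that] unfolding image_inverse[OF \<sigma>] .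
  show "conj_by \<sigma> \<rho> \<in> A (\<sigma> ` v) \<longleftrightarrow> \<rho> \<in> A v"
    using pull[of "conj_by \<sigma> \<rho>"] sub[OF \<sigma> v] unfolding conj_inverse[OF \<sigma>] by blast
  show "A (\<sigma> ` v) = conj_by \<sigma> ` A v"
  proof
    show "A (\<sigma> ` v) \<subseteq> conj_by \<sigma> ` A v"
    proof
      fix \<rho> assume "\<rho> \<in> A (\<sigma> ` v)"
      then show "\<rho> \<in> conj_by \<sigma> ` A v"
        using pull conj_inverse'[OF \<sigma>, of \<rho>] by (intro image_eqI[of _ _ "conj_by (inv_into UNIV \<sigma>) \<rho>"]) simp_all
    qed
  qed (use sub[OF \<sigma> v] in blast)
qed

context
  fixes v :: "'a set"
  assumes v: "v \<in> primes_of UNIV"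
begin

text \<open>An automorphism that is the identity modulo \<open>v\<close> maps \<open>v\<close> onto
  itself, so the membership in the decomposition group is automatic.\<close>

lemma inertia_eq: "inertia K v = {\<sigma> \<in> galois_carrier K. power_mod v 1 \<sigma>}"
proof
  show "inertia K v \<subseteq> {\<sigma> \<in> galois_carrier K. power_mod v 1 \<sigma>}"
    by (auto simp: inertia_def decomp_def power_mod_def)
  show "{\<sigma> \<in> galois_carrier K. power_mod v 1 \<sigma>} \<subseteq> inertia K v"
  proof
    fix \<sigma> assume "\<sigma> \<in> {\<sigma> \<in> galois_carrier K. power_mod v 1 \<sigma>}"
    then have \<sigma>: "\<sigma> \<in> galois_carrier K" and I: "\<And>x. algebraic_int x \<Longrightarrow> \<sigma> x - x \<in> v"
      by (auto simp: power_mod_def)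
    have alg: "algebraic_int x" if "x \<in> v" for x using prime_subset[OF subfield_UNIV v] that by auto
    have "\<sigma> x \<in> v" if "x \<in> v" for x
      using prime_add[OF subfield_UNIV v I[OF alg[OF that]] that] by simp
    moreover have "x \<in> v" if "\<sigma> x \<in> v" for x
    proof -
      have "algebraic_int x" using alg[OF that] galois_algebraic_int[OF \<sigma>] by simp
      then show ?thesis using prime_diff[OF subfield_UNIV v that I, of x] by simp
    qed
    ultimately have "\<sigma> ` v = v"
      using galois_inv_apply(1)[OF \<sigma>] by (metis (no_types, lifting) image_subsetI image_eqI subsetI subset_antisym)
    then show "\<sigma> \<in> inertia K v" using \<sigma> I by (simp add: inertia_def decomp_def)
  qed
qed

lemma power_mod_comp:
  assumes \<sigma>: "\<sigma> \<in> galois_carrier K" "power_mod v m \<sigma>" and \<tau>: "\<tau> \<in> galois_carrier K" "power_mod v k \<tau>"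
  shows "power_mod v (k * m) (\<sigma> \<circ> \<tau>)"
  unfolding power_mod_def
proof (intro allI impI)
  fix x :: 'a assume x: "algebraic_int x"
  have \<tau>x: "algebraic_int (\<tau> x)" using galois_algebraic_int[OF \<tau>(1)] x by simp
  have xk: "algebraic_int (x ^ k)"
    using x by (induction k) (auto intro: prime_int_mult[OF subfield_UNIV v])
  have "\<tau> x ^ m - (x ^ k) ^ m \<in> v"
    using \<tau>(2) x \<tau>x xk by (intro prime_power_diff[OF subfield_UNIV v]) (auto simp: power_mod_def)
  moreover have "\<sigma> (\<tau> x) - \<tau> x ^ m \<in> v" using \<sigma>(2) \<tau>x by (auto simp: power_mod_def)
  ultimately have "(\<sigma> (\<tau> x) - \<tau> x ^ m) + (\<tau> x ^ m - (x ^ k) ^ m) \<in> v"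
    by (intro prime_add[OF subfield_UNIV v])
  then show "(\<sigma> \<circ> \<tau>) x - x ^ (k * m) \<in> v" by (simp add: power_mult)
qed

lemma inertia_group:
  "id \<in> inertia K v" "\<sigma> \<in> inertia K v \<Longrightarrow> \<tau> \<in> inertia K v \<Longrightarrow> \<sigma> \<circ> \<tau> \<in> inertia K v"
  "\<sigma> \<in> inertia K v \<Longrightarrow> inv_into UNIV \<sigma> \<in> inertia K v"
proof -
  show "id \<in> inertia K v" using galois_id prime_0[OF subfield_UNIV v] by (simp add: inertia_eq power_mod_def)
  show "\<sigma> \<in> inertia K v \<Longrightarrow> \<tau> \<in> inertia K v \<Longrightarrow> \<sigma> \<circ> \<tau> \<in> inertia K v"
    using galois_comp power_mod_comp[of \<sigma> 1 \<tau> 1] by (simp add: inertia_eq)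
  assume "\<sigma> \<in> inertia K v"
  then have \<sigma>: "\<sigma> \<in> galois_carrier K" "power_mod v 1 \<sigma>" by (simp_all add: inertia_eq)
  have "inv_into UNIV \<sigma> x - x \<in> v" if "algebraic_int x" for x
  proof -
    have "algebraic_int (inv_into UNIV \<sigma> x)" using galois_algebraic_int[OF galois_inv[OF \<sigma>(1)]] that by simp
    then have "x - inv_into UNIV \<sigma> x \<in> v"
      using \<sigma>(2) galois_inv_apply[OF \<sigma>(1), of x] by (force simp: power_mod_def)
    then show ?thesis using prime_minus[OF subfield_UNIV v] by fastforce
  qed
  then show "inv_into UNIV \<sigma> \<in> inertia K v"
    using galois_inv[OF \<sigma>(1)] by (simp add: inertia_eq power_mod_def)
qed

lemma inertia_coset_self: "\<sigma> \<in> inertia_coset v \<sigma>"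
proof -
  have "\<sigma> = id \<circ> \<sigma>" by simp
  then show ?thesis unfolding inertia_coset_eq using inertia_group(1) by blast
qed

lemma inertia_coset_absorb:
  assumes "u \<in> inertia K v"
  shows "inertia_coset v (u \<circ> \<sigma>) = inertia_coset v \<sigma>"
proof
  show "inertia_coset v (u \<circ> \<sigma>) \<subseteq> inertia_coset v \<sigma>"
    unfolding inertia_coset_eq using inertia_group(2)[OF _ assms] by (auto simp: o_assoc)
  have u: "u \<in> galois_carrier K" using assms by (simp add: inertia_eq)
  show "inertia_coset v \<sigma> \<subseteq> inertia_coset v (u \<circ> \<sigma>)"
  proof
    fix \<tau> assume "\<tau> \<in> inertia_coset v \<sigma>"
    then obtain w where w: "w \<in> inertia K v" "\<tau> = w \<circ> \<sigma>" by (auto simp: inertia_coset_eq)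
    have "\<tau> = (w \<circ> inv_into UNIV u) \<circ> (u \<circ> \<sigma>)"
      using w by (simp add: fun_eq_iff galois_inv_apply[OF u])
    then show "\<tau> \<in> inertia_coset v (u \<circ> \<sigma>)"
      unfolding inertia_coset_eq using inertia_group(2)[OF w(1) inertia_group(3)[OF assms]] by blast
  qed
qed

lemma weil_subset: "weil K v \<subseteq> decomp K v"
  by (auto simp: weil_def)

lemma inertia_subset_weil: "inertia K v \<subseteq> weil K v"
proof
  fix \<sigma> assume \<sigma>: "\<sigma> \<in> inertia K v"
  have "inertia_coset v \<sigma> = inertia K v"
    using inertia_coset_absorb[OF \<sigma>, of id] by (auto simp: inertia_coset_eq)
  then have "inertia_coset v \<sigma> = frob_power v 0" unfolding frob_power_simps .
  moreover have "\<sigma> \<in> decomp K v" using \<sigma> by (simp add: inertia_def)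
  ultimately show "\<sigma> \<in> weil K v" unfolding weil_def by blast
qed

text \<open>Powers in the quotient group are cosets, and each representative of the n-th one acts
  modulo \<open>v\<close> with exponent \<open>residue_card v ^ n\<close>. In this form degrees can
  be compared.\<close>

lemma frob_power_mod: "\<sigma> \<in> frob_power v n \<Longrightarrow> \<sigma> \<in> galois_carrier K \<and> power_mod v (residue_card v ^ n) \<sigma>"
proof (induction n arbitrary: \<sigma>)
  case (Suc n)
  then obtain \<rho> \<tau> where "\<sigma> = \<rho> \<circ> \<tau>" "\<rho> \<in> frob_power v n" "\<tau> \<in> frobenius K v"
    unfolding frob_power_simps by blast
  moreover have "\<tau> \<in> galois_carrier K" "power_mod v (residue_card v) \<tau>"
    using calculation decomp_subset by (auto simp: frobenius_eq)
  ultimately show ?case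
    using Suc.IH[of \<rho>] galois_comp[of \<rho> \<tau>] power_mod_comp[of \<rho> "residue_card v ^ n" \<tau> "residue_card v"]
    unfolding power_Suc by blast
qed (simp add: frob_power_simps(1) inertia_eq)

lemma weil_power_mod:
  assumes "\<sigma> \<in> weil K v"
  obtains n where "\<sigma> \<in> galois_carrier K" "power_mod v (residue_card v ^ n) \<sigma>"
proof -
  obtain n where "inertia_coset v \<sigma> = frob_power v n" using assms unfolding weil_def by blast
  then have "\<sigma> \<in> frob_power v n" using inertia_coset_self by metis
  then show thesis using frob_power_mod that by blast
qed

text \<open>The cosets of 0 and 1 modulo \<open>v \<inter> K\<close> differ. Since
  \<open>card\<close> gives 0 to infinite sets, the possible values are 0 and those above 1; a power
  of any of them is 1 for exponent 0 only.\<close>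

lemma residue_card_neq_1: "residue_card v \<noteq> 1"
proof
  let ?P = "v \<inter> K"
  have P: "?P \<in> primes_of K" by (rule prime_over_in_primes_of[OF v])
  then interpret maximalideal ?P "int_ring K" by (simp add: primes_of_def)
  have one: "1 \<in> carrier (int_ring K)" using subfield_ring_of_type_algebraD[OF subfield_K] by simp
  have zero: "0 \<in> carrier (int_ring K)" using subfield_ring_of_type_algebraD[OF subfield_K] by simp
  assume "residue_card v = 1"
  then obtain c where c: "carrier (int_ring K Quot ?P) = {c}"
    unfolding residue_card_def by (auto simp: card_1_singleton_iff)
  have "?P +>\<^bsub>int_ring K\<^esub> 1 \<in> carrier (int_ring K Quot ?P)" "?P +>\<^bsub>int_ring K\<^esub> 0 \<in> carrier (int_ring K Quot ?P)"
    using one zero by (auto simp: FactRing_def A_RCOSETS_def' simp del: carrier_int_ring)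
  moreover have "?P +>\<^bsub>int_ring K\<^esub> 0 = ?P"
    using a_rcos_zero[OF is_ideal, of 0] prime_0[OF subfield_K P] by simp
  ultimately have "?P +>\<^bsub>int_ring K\<^esub> 1 = ?P" using c by auto
  then have "1 \<in> ?P" using rcos_const_imp_mem one by blast
  then show False using prime_1[OF subfield_K P] by simp
qed

text \<open>Modulo a prime of the algebraic closure no power map other than the identity is trivial: for
  exponent \<open>m \<ge> 2\<close> take a root of \<open>x ^ m - x - 1\<close>.\<close>

lemma power_mod_id:
  assumes "power_mod v m id"
  shows "m = 1"
proof (rule ccontr)
  assume "m \<noteq> 1"
  have ex: "x - x ^ m \<in> v" if "algebraic_int x" for x
    using assms that by (simp add: power_mod_def)
  show False
  proof (cases "m = 0")
    case True
    then have "- (0 - 1) \<in> v" using ex[of 0] prime_minus[OF subfield_UNIV v, of "0 - 1"] by simp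
    then show False using prime_1[OF subfield_UNIV v] by simp
  next
    case False
    define p :: "int poly" where "p = Polynomial.monom 1 m - [:1, 1:]"
    have cf: "Polynomial.coeff p k = (if k = m then 1 else if k \<le> 1 then - 1 else 0)" for k
      using \<open>m \<noteq> 1\<close> False by (auto simp: p_def coeff_pCons split: nat.splits)
    have deg: "Polynomial.degree p = m"
      using \<open>m \<noteq> 1\<close> False by (intro antisym degree_le le_degree) (auto simp: cf)
    have "Polynomial.lead_coeff (map_poly of_int p :: 'a poly) = 1" "Polynomial.degree (map_poly of_int p :: 'a poly) > 0"
      using False by (simp_all add: degree_map_poly deg coeff_map_poly cf)
    then obtain x :: 'a where x: "poly (map_poly of_int p) x = 0"
      using monic_root by blast
    have mp: "map_poly of_int p = Polynomial.monom 1 m - [:1, 1 :: 'a:]"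
      by (rule poly_eqI) (simp add: coeff_map_poly p_def coeff_pCons split: nat.splits)
    have "x ^ m - x - 1 = 0" using x unfolding mp by (simp add: poly_monom algebra_simps)
    moreover have "algebraic_int x"
      using x deg cf[of m] unfolding algebraic_int_altdef_ipoly by auto
    then have "- (x - x ^ m) \<in> v" by (intro prime_minus[OF subfield_UNIV v] ex)
    moreover have "- (x - x ^ m) = 1" using \<open>x ^ m - x - 1 = 0\<close> by simp
    ultimately show False using prime_1[OF subfield_UNIV v] by metis
  qed
qed

text \<open>Degrees are natural numbers and add under composition, so a sum that is zero has both
  summands zero.\<close>

lemma weil_comp_inertia:
  assumes "\<sigma> \<in> weil K v" "\<tau> \<in> weil K v"
  shows "\<sigma> \<circ> \<tau> \<in> inertia K v \<longleftrightarrow> \<sigma> \<in> inertia K v \<and> \<tau> \<in> inertia K v"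
proof
  obtain n where n: "\<sigma> \<in> galois_carrier K" "power_mod v (residue_card v ^ n) \<sigma>"
    using weil_power_mod[OF assms(1)] by blast
  obtain k where k: "\<tau> \<in> galois_carrier K" "power_mod v (residue_card v ^ k) \<tau>"
    using weil_power_mod[OF assms(2)] by blast
  assume "\<sigma> \<circ> \<tau> \<in> inertia K v"
  then have "inv_into UNIV (\<sigma> \<circ> \<tau>) \<in> inertia K v" by (rule inertia_group(3))
  then have "inv_into UNIV (\<sigma> \<circ> \<tau>) \<in> galois_carrier K" "power_mod v 1 (inv_into UNIV (\<sigma> \<circ> \<tau>))"
    by (simp_all add: inertia_eq)
  \<comment> \<open>Composing the product with its inverse, which is inertial, shows that the
    identity acts modulo \<open>v\<close> with the combined exponent; \<open>power_mod_id\<close>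
    then makes this exponent 1.\<close>
  from power_mod_comp[OF this galois_comp[OF n(1) k(1)] power_mod_comp[OF n k]]
  have "power_mod v (residue_card v ^ (k + n)) id"
    by (simp add: galois_inv_comp[OF galois_comp[OF n(1) k(1)]] power_add)
  then have "k + n = 0"
    using power_mod_id residue_card_neq_1 by (metis power_eq_1_iff nat_power_eq_Suc_0_iff One_nat_def)
  then show "\<sigma> \<in> inertia K v \<and> \<tau> \<in> inertia K v"
    using n k by (simp add: inertia_eq)
qed (use inertia_group(2) in blast)

end

section \<open>Conjugation of inertia groups, Frobenius cosets and Weil monoids\<close>

lemma conj_inertia:
  assumes "\<sigma> \<in> galois_carrier K" "v \<in> primes_of UNIV"
  shows "conj_by \<sigma> \<rho> \<in> inertia K (\<sigma> ` v) \<longleftrightarrow> \<rho> \<in> inertia K v" and "inertia K (\<sigma> ` v) = conj_by \<sigma> ` inertia K v"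
proof -
  have "conj_by \<sigma> \<rho> \<in> inertia K (\<sigma> ` v)"
    if "\<sigma> \<in> galois_carrier K" "v \<in> primes_of UNIV" "\<rho> \<in> inertia K v" for \<sigma> v \<rho>
    using that(3) conj_galois[OF that(1), of \<rho>] conj_power_mod[OF that(1), of v 1 \<rho>]
    unfolding inertia_eq[OF that(2)] inertia_eq[OF galois_image_prime(1)[OF that(1,2)]] by blast
  from conj_image_eqI[of \<sigma> v "inertia K", OF assms this]
  show "conj_by \<sigma> \<rho> \<in> inertia K (\<sigma> ` v) \<longleftrightarrow> \<rho> \<in> inertia K v" "inertia K (\<sigma> ` v) = conj_by \<sigma> ` inertia K v"
    by auto
qed

lemma conj_frobenius:
  assumes "\<sigma> \<in> galois_carrier K" "v \<in> primes_of UNIV"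
  shows "frobenius K (\<sigma> ` v) = conj_by \<sigma> ` frobenius K v"
proof -
  have "conj_by \<sigma> \<rho> \<in> frobenius K (\<sigma> ` v)"
    if "\<sigma> \<in> galois_carrier K" "v \<in> primes_of UNIV" "\<rho> \<in> frobenius K v" for \<sigma> v \<rho>
    using that conj_decomp conj_power_mod residue_card_image by (simp add: frobenius_eq)
  from conj_image_eqI(2)[of \<sigma> v "frobenius K", OF assms this] show ?thesis .
qed

lemma conj_set_mult:
  assumes "\<sigma> \<in> galois_carrier K"
  shows "{\<rho> \<circ> \<tau> |\<rho> \<tau>. \<rho> \<in> conj_by \<sigma> ` A \<and> \<tau> \<in> conj_by \<sigma> ` B} = conj_by \<sigma> ` {\<rho> \<circ> \<tau> |\<rho> \<tau>. \<rho> \<in> A \<and> \<tau> \<in> B}"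
    (is "?L = ?R")
proof (intro equalityI subsetI)
  fix x assume "x \<in> ?L"
  then obtain \<rho> \<tau> where "x = conj_by \<sigma> \<rho> \<circ> conj_by \<sigma> \<tau>" "\<rho> \<in> A" "\<tau> \<in> B" by blast
  then show "x \<in> ?R" unfolding conj_comp[OF assms(1), symmetric] by blast
next
  fix x assume "x \<in> ?R"
  then obtain \<rho> \<tau> where x: "x = conj_by \<sigma> (\<rho> \<circ> \<tau>)" "\<rho> \<in> A" "\<tau> \<in> B" by blast
  then show "x \<in> ?L" unfolding x(1) conj_comp[OF assms(1)] by blast
qed

lemma conj_frob_power:
  assumes "\<sigma> \<in> galois_carrier K" "v \<in> primes_of UNIV"
  shows "frob_power (\<sigma> ` v) n = conj_by \<sigma> ` frob_power v n"
proof (induction n)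
  case 0
  show ?case unfolding frob_power_simps by (rule conj_inertia(2)[OF assms])
next
  case (Suc n)
  show ?case
    unfolding frob_power_simps(2) Suc
    unfolding conj_frobenius[OF assms]
    by (rule conj_set_mult[OF assms(1)])
qed

lemma conj_inertia_coset:
  assumes "\<sigma> \<in> galois_carrier K" "v \<in> primes_of UNIV"
  shows "inertia_coset (\<sigma> ` v) (conj_by \<sigma> \<rho>) = conj_by \<sigma> ` inertia_coset v \<rho>"
  unfolding inertia_coset_eq
  unfolding conj_inertia(2)[OF assms]
proof (intro equalityI subsetI)
  fix x assume "x \<in> {u \<circ> conj_by \<sigma> \<rho> |u. u \<in> conj_by \<sigma> ` inertia K v}"
  then obtain u where "x = conj_by \<sigma> u \<circ> conj_by \<sigma> \<rho>" "u \<in> inertia K v" by blast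
  then show "x \<in> conj_by \<sigma> ` {u \<circ> \<rho> |u. u \<in> inertia K v}"
    unfolding conj_comp[OF assms(1), symmetric] by blast
next
  fix x assume "x \<in> conj_by \<sigma> ` {u \<circ> \<rho> |u. u \<in> inertia K v}"
  then obtain u where x: "x = conj_by \<sigma> (u \<circ> \<rho>)" "u \<in> inertia K v" by blast
  then show "x \<in> {u \<circ> conj_by \<sigma> \<rho> |u. u \<in> conj_by \<sigma> ` inertia K v}"
    unfolding x(1) conj_comp[OF assms(1)] by blast
qed

lemma conj_weil:
  assumes "\<sigma> \<in> galois_carrier K" "v \<in> primes_of UNIV"
  shows "conj_by \<sigma> \<rho> \<in> weil K (\<sigma> ` v) \<longleftrightarrow> \<rho> \<in> weil K v"
proof -
  have "conj_by \<sigma> \<rho> \<in> weil K (\<sigma> ` v)"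
    if a: "\<sigma> \<in> galois_carrier K" "v \<in> primes_of UNIV" "\<rho> \<in> weil K v" for \<sigma> v \<rho>
  proof -
    obtain n where n: "\<rho> \<in> decomp K v" "inertia_coset v \<rho> = frob_power v n"
      using a(3) unfolding weil_def by blast
    have "inertia_coset (\<sigma> ` v) (conj_by \<sigma> \<rho>) = frob_power (\<sigma> ` v) n"
      unfolding conj_inertia_coset[OF a(1,2)] conj_frob_power[OF a(1,2)] n(2) ..
    then show ?thesis unfolding weil_def using conj_decomp[OF a(1) n(1)] by blast
  qed
  from conj_image_eqI(1)[of \<sigma> v "weil K", OF assms this] show ?thesis .
qed

lemma continuous_map_conj_krull:
  assumes \<sigma>: "\<sigma> \<in> galois_carrier K"
  shows "continuous_map (krull_topology K) (krull_topology K) (conj_by \<sigma>)"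
proof (rule continuous_map_krull)
  show "conj_by \<sigma> \<rho> \<in> galois_carrier K" if "\<rho> \<in> topspace (krull_topology K)" for \<rho>
    using that conj_galois[OF \<sigma>] by simp
  fix a b
  have "{\<rho> \<in> topspace (krull_topology K). conj_by \<sigma> \<rho> a = b} =
      {\<rho> \<in> galois_carrier K. \<rho> (inv_into UNIV \<sigma> a) = inv_into UNIV \<sigma> b}"
    using galois_inv_apply[OF \<sigma>] by (auto simp: galois_eq_iff[OF \<sigma>])
  then show "openin (krull_topology K) {\<rho> \<in> topspace (krull_topology K). conj_by \<sigma> \<rho> a = b}"
    using openin_krull_eval by simp
qed

section \<open>Topology of the Weil monoid and its compactification\<close>

context
  fixes v :: "'a set"
  assumes v: "v \<in> primes_of UNIV"
begin

lemma inertia_coset_subset_weil: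
  assumes "\<sigma> \<in> weil K v"
  shows "inertia_coset v \<sigma> \<subseteq> weil K v"
proof
  fix \<tau> assume "\<tau> \<in> inertia_coset v \<sigma>"
  then obtain u where u: "u \<in> inertia K v" "\<tau> = u \<circ> \<sigma>" by (auto simp: inertia_coset_eq)
  have "u \<in> decomp K v" "\<sigma> \<in> decomp K v" using u assms by (auto simp: inertia_def weil_def)
  then have "\<tau> \<in> decomp K v" using decomp_comp u by simp
  moreover have "inertia_coset v \<tau> = inertia_coset v \<sigma>" using inertia_coset_absorb[OF v u(1)] u(2) by simp
  ultimately show "\<tau> \<in> weil K v" using assms by (simp add: weil_def)
qed

lemma topspace_weil [simp]: "topspace (weil_topology K v) = weil K v"
proof -
  have "\<sigma> \<in> galois_carrier K \<inter> inertia_coset v \<sigma>" if "\<sigma> \<in> weil K v" for \<sigma>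
    using that weil_subset[OF v] decomp_subset inertia_coset_self[OF v] by blast
  moreover have "openin (krull_topology K) (galois_carrier K)"
    using openin_topspace[of "krull_topology K"] by simp
  ultimately have "weil K v \<subseteq> topspace (weil_topology K v)"
    unfolding weil_topology_def topology_generated_by_topspace by blast
  then show ?thesis
    using inertia_coset_subset_weil unfolding weil_topology_def topology_generated_by_topspace by blast
qed

lemma inertia_coset_id: "inertia_coset v id = inertia K v"
  by (auto simp: inertia_coset_eq)

lemma openin_weil_coset: "openin (krull_topology K) U \<Longrightarrow> \<sigma> \<in> weil K v \<Longrightarrow> openin (weil_topology K v) (U \<inter> inertia_coset v \<sigma>)"
  unfolding weil_topology_def by (rule topology_generated_by_Basis) blast

lemma id_weil: "id \<in> weil K v"
  using inertia_group(1)[OF v] inertia_subset_weil[OF v] by blast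

lemma closedin_inertia_krull: "closedin (krull_topology K) (inertia K v)"
proof -
  have "galois_carrier K - inertia K v = (\<Union>x\<in>{x. algebraic_int x}. \<Union>y\<in>{y. y - x \<notin> v}. {\<sigma> \<in> galois_carrier K. \<sigma> x = y})"
    by (auto simp: inertia_eq[OF v] power_mod_def)
  also have "openin (krull_topology K) \<dots>"
    by (auto intro!: openin_Union openin_krull_eval)
  finally show ?thesis by (auto simp: closedin_def inertia_eq[OF v])
qed

text \<open>Neighbourhoods of the added point are complements of closed compact sets. These facts
  make the inertia group such a set, and its clopen pieces open, in the Weil topology.\<close>

lemma clopen_weil:
  assumes "openin (krull_topology K) U" "closedin (krull_topology K) U"
  shows "openin (weil_topology K v) (U \<inter> inertia K v)" "closedin (weil_topology K v) (U \<inter> inertia K v)"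
    "compactin (weil_topology K v) (U \<inter> inertia K v)"
proof -
  show op: "openin (weil_topology K v) (U \<inter> inertia K v)"
    using openin_weil_coset[OF assms(1) id_weil] by (simp add: inertia_coset_id)
  have disj: "inertia_coset v \<sigma> \<inter> inertia K v = {}" if "\<sigma> \<in> weil K v" "\<sigma> \<notin> inertia K v" for \<sigma>
  proof -
    have "u \<circ> \<sigma> \<notin> inertia K v" if "u \<in> inertia K v" for u
      using weil_comp_inertia[OF v, of u \<sigma>] that inertia_subset_weil[OF v] \<open>\<sigma> \<in> weil K v\<close> \<open>\<sigma> \<notin> inertia K v\<close> by blast
    then show ?thesis by (auto simp: inertia_coset_eq)
  qed
  have sub: "U \<inter> inertia K v \<subseteq> weil K v" using inertia_subset_weil[OF v] by blast
  \<comment> \<open>Cosets of non-inertial Weil elements avoid the inertia group, so the complement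
    is a union of basic open sets.\<close>
  have eq: "weil K v - U \<inter> inertia K v = ((galois_carrier K - U) \<inter> inertia_coset v id) \<union>
      (\<Union>\<sigma>\<in>weil K v - inertia K v. galois_carrier K \<inter> inertia_coset v \<sigma>)"
    (is "_ = ?R")
  proof
    show "weil K v - U \<inter> inertia K v \<subseteq> ?R"
      using weil_subset[OF v] decomp_subset inertia_coset_self[OF v] unfolding inertia_coset_id by blast
    show "?R \<subseteq> weil K v - U \<inter> inertia K v"
      using disj inertia_coset_subset_weil inertia_subset_weil[OF v] unfolding inertia_coset_id by blast
  qed
  have Uop: "openin (krull_topology K) (galois_carrier K - U)" "openin (krull_topology K) (galois_carrier K)"
    using assms(2) openin_topspace[of "krull_topology K"] by (auto simp: closedin_def)
  have "openin (weil_topology K v) (weil K v - U \<inter> inertia K v)"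
    unfolding eq
  proof (intro openin_Un openin_Union)
    show "openin (weil_topology K v) ((galois_carrier K - U) \<inter> inertia_coset v id)"
      by (rule openin_weil_coset[OF Uop(1) id_weil])
    show "openin (weil_topology K v) V"
      if "V \<in> (\<lambda>\<sigma>. galois_carrier K \<inter> inertia_coset v \<sigma>) ` (weil K v - inertia K v)" for V
      using that openin_weil_coset[OF Uop(2)] by blast
  qed
  then show "closedin (weil_topology K v) (U \<inter> inertia K v)"
    using sub by (simp add: closedin_def)
  have cpt: "compactin (krull_topology K) (U \<inter> inertia K v)"
    using closedin_compact_space[OF compact_space_krull closedin_Int[OF assms(2) closedin_inertia_krull]] .
  \<comment> \<open>On the inertia group both topologies give the same open sets, as each coset
    contains it or misses it; so compactness carries over from the Krull topology.\<close>
  have "continuous_map (subtopology (krull_topology K) (inertia K v)) (weil_topology K v) id"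
    unfolding weil_topology_def
  proof (rule continuous_on_generated_topo)
    have ts: "topspace (subtopology (krull_topology K) (inertia K v)) = inertia K v"
      by (auto simp: inertia_eq[OF v])
    show "id ` topspace (subtopology (krull_topology K) (inertia K v)) \<subseteq>
       \<Union>{U \<inter> (inertia_coset v \<sigma>) | U \<sigma>. openin (krull_topology K) U \<and> \<sigma> \<in> weil K v}"
      using topspace_weil inertia_subset_weil[OF v] unfolding weil_topology_def topology_generated_by_topspace ts by simp
    fix V assume "V \<in> {U \<inter> (inertia_coset v \<sigma>) | U \<sigma>. openin (krull_topology K) U \<and> \<sigma> \<in> weil K v}"
    then obtain W \<sigma> where V: "V = W \<inter> inertia_coset v \<sigma>" "openin (krull_topology K) W" "\<sigma> \<in> weil K v" by blast
    have "id -` V \<inter> topspace (subtopology (krull_topology K) (inertia K v)) = V \<inter> inertia K v"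
      unfolding ts by simp
    also have "openin (subtopology (krull_topology K) (inertia K v)) \<dots>"
    proof (cases "\<sigma> \<in> inertia K v")
      case True
      then have "V \<inter> inertia K v = W \<inter> inertia K v"
        using inertia_coset_absorb[OF v True, of id] V by (auto simp: inertia_coset_id)
      then show ?thesis using V by (simp add: openin_subtopology_Int)
    next
      case False
      then have "V \<inter> inertia K v = {}" using disj V by blast
      then show ?thesis by simp
    qed
    finally show "openin (subtopology (krull_topology K) (inertia K v))
      (id -` V \<inter> topspace (subtopology (krull_topology K) (inertia K v)))" .
  qed
  moreover have "compactin (subtopology (krull_topology K) (inertia K v)) (U \<inter> inertia K v)"
    using cpt by (simp add: compactin_subtopology)
  ultimately show "compactin (weil_topology K v) (U \<inter> inertia K v)"
    using image_compactin by fastforce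
qed

lemma weil_compact_simps [simp]:
  "carrier (weil_compact K v) = insert None (Some ` weil K v)"
  "\<one>\<^bsub>weil_compact K v\<^esub> = Some id"
  "Some \<sigma> \<otimes>\<^bsub>weil_compact K v\<^esub> Some \<tau> = Some (\<sigma> \<circ> \<tau>)"
  "None \<otimes>\<^bsub>weil_compact K v\<^esub> y = None" "x \<otimes>\<^bsub>weil_compact K v\<^esub> None = None"
  "topspace (topol (weil_compact K v)) = insert None (Some ` weil K v)"
  by (auto simp: weil_compact_def split: option.splits)

text \<open>Killing everything outside the inertia group is multiplicative, since an element of
  positive degree in the Weil monoid never becomes inertial again, and it is continuous, since the
  inertia group is open and compact.\<close>

lemma weil_compact_chom:
  assumes N: "Group.monoid N" "z \<in> carrier N" "\<And>x. x \<in> carrier N \<Longrightarrow> z \<otimes>\<^bsub>N\<^esub> x = z \<and> x \<otimes>\<^bsub>N\<^esub> z = z"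
    and g: "\<And>u. u \<in> inertia K v \<Longrightarrow> g u \<in> carrier N" "g id = \<one>\<^bsub>N\<^esub>"
      "\<And>u w. u \<in> inertia K v \<Longrightarrow> w \<in> inertia K v \<Longrightarrow> g (u \<circ> w) = g u \<otimes>\<^bsub>N\<^esub> g w"
    and cont: "continuous_map (krull_topology K) (discrete_topology (carrier N)) g"
    and nz: "\<And>u. u \<in> inertia K v \<Longrightarrow> g u \<noteq> z"
  shows "case_option z (\<lambda>u. if u \<in> inertia K v then g u else z) \<in> chom (weil_compact K v) (discrete_monoid N)"
    (is "?f \<in> _")
proof -
  interpret N: Group.monoid N by (rule N(1))
  have subs: "inertia K v \<subseteq> weil K v" "inertia K v \<subseteq> galois_carrier K"
    using inertia_subset_weil[OF v] by (auto simp: inertia_eq[OF v])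
  have fN: "?f x \<in> carrier N" for x
    using N(2) g(1) by (cases x) auto
  have mult: "?f (x \<otimes>\<^bsub>weil_compact K v\<^esub> y) = ?f x \<otimes>\<^bsub>N\<^esub> ?f y"
    if "x \<in> carrier (weil_compact K v)" "y \<in> carrier (weil_compact K v)" for x y
    using that N g weil_comp_inertia[OF v] by (cases x; cases y) auto
  have "?f \<in> hom (weil_compact K v) (discrete_monoid N)"
    by (rule homI) (simp_all only: discrete_monoid_simps fN mult)
  moreover have "?f \<one>\<^bsub>weil_compact K v\<^esub> = \<one>\<^bsub>N\<^esub>"
    using inertia_group(1)[OF v] g(2) by simp
  moreover have "continuous_map (topol (weil_compact K v)) (discrete_topology (carrier N)) ?f"
  proof (rule continuous_map_into_discrete)
    show "?f x \<in> carrier N" if "x \<in> topspace (topol (weil_compact K v))" for x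
      by (rule fN)
    have clopen: "openin (krull_topology K) {u \<in> galois_carrier K. P (g u)}" "closedin (krull_topology K) {u \<in> galois_carrier K. P (g u)}" for P
      using continuous_map_discrete_openin[OF cont, of P] continuous_map_discrete_closedin[OF cont, of P] by auto
    fix y assume y: "y \<in> carrier N"
    show "openin (topol (weil_compact K v)) {x \<in> topspace (topol (weil_compact K v)). ?f x = y}"
    proof (cases "y = z")
      case True
      \<comment> \<open>The fibre over \<open>z\<close> contains the added point and is the
        complement of the whole inertia group. The constant predicate brings this group into the
        form of \<open>clopen_weil\<close>.\<close>
      have "{x \<in> topspace (topol (weil_compact K v)). ?f x = y} =
          insert None (Some ` (topspace (weil_topology K v) - {u \<in> galois_carrier K. True} \<inter> inertia K v))"
      proof (rule Set.set_eqI)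
        fix x
        show "x \<in> {x \<in> topspace (topol (weil_compact K v)). ?f x = y} \<longleftrightarrow>
            x \<in> insert None (Some ` (topspace (weil_topology K v) - {u \<in> galois_carrier K. True} \<inter> inertia K v))"
          using nz True subs by (cases x) auto
      qed
      also have "openin (topol (weil_compact K v)) \<dots>"
        unfolding weil_compact_def openin_Alexandroff_compactification top_monoid.simps
        using clopen_weil(2,3)[OF clopen[of "\<lambda>_. True"]] by blast
      finally show ?thesis .
    next
      case False
      have "{x \<in> topspace (topol (weil_compact K v)). ?f x = y} = Some ` ({u \<in> galois_carrier K. g u = y} \<inter> inertia K v)"
      proof (rule Set.set_eqI)
        fix x
        show "x \<in> {x \<in> topspace (topol (weil_compact K v)). ?f x = y} \<longleftrightarrow>
            x \<in> Some ` ({u \<in> galois_carrier K. g u = y} \<inter> inertia K v)"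
          using False subs by (cases x) auto
      qed
      also have "openin (topol (weil_compact K v)) \<dots>"
        unfolding weil_compact_def openin_Alexandroff_compactification top_monoid.simps
        using clopen_weil(1)[OF clopen[of "\<lambda>w. w = y"]] by blast
      finally show ?thesis .
    qed
  qed
  ultimately show ?thesis by (simp add: chom_def)
qed

end

lemma continuous_map_conj_weil:
  assumes \<sigma>: "\<sigma> \<in> galois_carrier K" and v: "v \<in> primes_of UNIV"
  shows "continuous_map (weil_topology K v) (weil_topology K (\<sigma> ` v)) (conj_by \<sigma>)"
proof -
  note v' = galois_image_prime(1)[OF \<sigma> v]
  have "continuous_map (weil_topology K v) (topology_generated_by
     {U \<inter> (inertia_coset (\<sigma> ` v) \<tau>) | U \<tau>. openin (krull_topology K) U \<and> \<tau> \<in> weil K (\<sigma> ` v)}) (conj_by \<sigma>)"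
  proof (rule continuous_on_generated_topo)
    show "conj_by \<sigma> ` topspace (weil_topology K v) \<subseteq>
      \<Union>{U \<inter> (inertia_coset (\<sigma> ` v) \<tau>) | U \<tau>. openin (krull_topology K) U \<and> \<tau> \<in> weil K (\<sigma> ` v)}"
      using topspace_weil[OF v'] conj_weil[OF \<sigma> v] unfolding weil_topology_def topology_generated_by_topspace
      by (auto simp: topspace_weil[OF v, unfolded weil_topology_def topology_generated_by_topspace])
    fix V assume "V \<in> {U \<inter> (inertia_coset (\<sigma> ` v) \<tau>) | U \<tau>. openin (krull_topology K) U \<and> \<tau> \<in> weil K (\<sigma> ` v)}"
    then obtain U \<tau> where V: "V = U \<inter> inertia_coset (\<sigma> ` v) \<tau>" "openin (krull_topology K) U" "\<tau> \<in> weil K (\<sigma> ` v)" by blast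
    define \<rho> where "\<rho> = conj_by (inv_into UNIV \<sigma>) \<tau>"
    have \<tau>: "\<tau> = conj_by \<sigma> \<rho>" unfolding \<rho>_def by (rule conj_inverse'[OF \<sigma>, symmetric])
    have \<rho>: "\<rho> \<in> weil K v" using V(3) conj_weil[OF \<sigma> v] unfolding \<tau> by blast
    have inj: "conj_by \<sigma> x = conj_by \<sigma> y \<Longrightarrow> x = y" for x y
      using conj_inverse[OF \<sigma>] by metis
    have "conj_by \<sigma> -` V \<inter> topspace (weil_topology K v) =
      {x \<in> topspace (krull_topology K). conj_by \<sigma> x \<in> U} \<inter> inertia_coset v \<rho>"
    proof -
      have 1: "conj_by \<sigma> x \<in> inertia_coset (\<sigma> ` v) \<tau> \<longleftrightarrow> x \<in> inertia_coset v \<rho>" for x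
        unfolding \<tau> conj_inertia_coset[OF \<sigma> v] using inj by blast
      have 2: "inertia_coset v \<rho> \<subseteq> weil K v" "weil K v \<subseteq> galois_carrier K"
        using inertia_coset_subset_weil[OF v \<rho>] weil_subset[OF v] decomp_subset by blast+
      show ?thesis
        unfolding V(1) topspace_weil[OF v] topspace_krull using 1 2 by blast
    qed
    also have "openin (weil_topology K v) \<dots>"
      using openin_weil_coset[OF v openin_continuous_map_preimage[OF continuous_map_conj_krull[OF \<sigma>] V(2)] \<rho>] .
    finally show "openin (weil_topology K v) (conj_by \<sigma> -` V \<inter> topspace (weil_topology K v))" .
  qed
  then show ?thesis unfolding weil_topology_def[of K "\<sigma> ` v"] .
qed

text \<open>Continuity at the added point asks that preimages of closed compact sets be compact;
  this comes from the continuous inverse.\<close>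

lemma continuous_map_Alexandroff:
  assumes "homeomorphic_maps S T f g"
  shows "continuous_map (Alexandroff_compactification S) (Alexandroff_compactification T) (map_option f)"
proof -
  have f: "continuous_map S T f" and g: "continuous_map T S g"
    and gf: "\<And>x. x \<in> topspace S \<Longrightarrow> g (f x) = x" and fg: "\<And>y. y \<in> topspace T \<Longrightarrow> f (g y) = y"
    using assms by (auto simp: homeomorphic_maps_def)
  have fS: "f x \<in> topspace T" if "x \<in> topspace S" for x using continuous_map_funspace[OF f] that by blast
  show ?thesis
    unfolding continuous_map_def
  proof (intro conjI allI impI)
    show "map_option f \<in> topspace (Alexandroff_compactification S) \<rightarrow> topspace (Alexandroff_compactification T)"
      using fS by auto
    fix V assume "openin (Alexandroff_compactification T) V"
    then consider U where "openin T U" "V = Some ` U"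
      | C where "compactin T C" "closedin T C" "V = insert None (Some ` (topspace T - C))"
      by (auto simp: openin_Alexandroff_compactification)
    then show "openin (Alexandroff_compactification S) {x \<in> topspace (Alexandroff_compactification S). map_option f x \<in> V}"
    proof cases
      case (1 U)
      have "{x \<in> topspace (Alexandroff_compactification S). map_option f x \<in> V} = Some ` {x \<in> topspace S. f x \<in> U}"
        by (auto simp: 1)
      then show ?thesis using openin_continuous_map_preimage[OF f 1(1)] by simp
    next
      case (2 C)
      have C: "{x \<in> topspace S. f x \<in> C} = g ` C"
        using gf fg compactin_subset_topspace[OF 2(1)] continuous_map_funspace[OF g] by force
      have "{x \<in> topspace (Alexandroff_compactification S). map_option f x \<in> V} = insert None (Some ` (topspace S - {x \<in> topspace S. f x \<in> C}))"
        using fS by (auto simp: 2)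
      moreover have "closedin S {x \<in> topspace S. f x \<in> C}" by (rule closedin_continuous_map_preimage[OF f 2(2)])
      moreover have "compactin S {x \<in> topspace S. f x \<in> C}" unfolding C by (rule image_compactin[OF 2(1) g])
      ultimately show ?thesis unfolding openin_Alexandroff_compactification by blast
    qed
  qed
qed

lemma conj_chom:
  assumes \<sigma>: "\<sigma> \<in> galois_carrier K" and v: "v \<in> primes_of UNIV"
  shows "map_option (conj_by \<sigma>) \<in> chom (weil_compact K v) (weil_compact K (\<sigma> ` v))"
proof -
  note v' = galois_image_prime(1)[OF \<sigma> v]
  have "homeomorphic_maps (weil_topology K v) (weil_topology K (\<sigma> ` v)) (conj_by \<sigma>) (conj_by (inv_into UNIV \<sigma>))"
    using continuous_map_conj_weil[OF \<sigma> v] continuous_map_conj_weil[OF galois_inv[OF \<sigma>] v']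
      conj_inverse[OF \<sigma>] conj_inverse'[OF \<sigma>]
    unfolding homeomorphic_maps_def image_inverse[OF \<sigma>] by blast
  then have "continuous_map (topol (weil_compact K v)) (topol (weil_compact K (\<sigma> ` v))) (map_option (conj_by \<sigma>))"
    using continuous_map_Alexandroff by (auto simp: weil_compact_def)
  moreover have "map_option (conj_by \<sigma>) x \<in> carrier (weil_compact K (\<sigma> ` v))" if "x \<in> carrier (weil_compact K v)" for x
    using that conj_weil[OF \<sigma> v] unfolding weil_compact_simps(1)[OF v] weil_compact_simps(1)[OF v'] by auto
  moreover have "map_option (conj_by \<sigma>) (x \<otimes>\<^bsub>weil_compact K v\<^esub> y) =
      map_option (conj_by \<sigma>) x \<otimes>\<^bsub>weil_compact K (\<sigma> ` v)\<^esub> map_option (conj_by \<sigma>) y" for x y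
    using conj_comp[OF \<sigma>] by (cases x; cases y) (simp_all add: weil_compact_simps[OF v] weil_compact_simps[OF v'] del: comp_apply)
  moreover have "map_option (conj_by \<sigma>) \<one>\<^bsub>weil_compact K v\<^esub> = \<one>\<^bsub>weil_compact K (\<sigma> ` v)\<^esub>"
    by (simp add: weil_compact_simps[OF v] weil_compact_simps[OF v'] galois_inv_comp[OF \<sigma>])
  ultimately show ?thesis by (simp add: chom_def hom_def)
qed

end

section \<open>Continuous homomorphisms and free products\<close>

lemma chom_comp:
  assumes "f \<in> chom L M" "g \<in> chom M N"
  shows "(\<lambda>x. g (f x)) \<in> chom L N"
  using assms continuous_map_compose[of "topol L" "topol M" f "topol N" g]
  by (auto simp: chom_def hom_def o_def Pi_iff)

lemma chom_const_one:
  assumes "Group.monoid N" "topspace (topol N) = carrier N"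
  shows "(\<lambda>x. \<one>\<^bsub>N\<^esub>) \<in> chom M N"
proof -
  interpret Group.monoid N by fact
  show ?thesis using assms(2) by (simp add: chom_def hom_def)
qed

lemma chomD:
  assumes "f \<in> chom M N"
  shows "x \<in> carrier M \<Longrightarrow> f x \<in> carrier N"
    and "x \<in> carrier M \<Longrightarrow> y \<in> carrier M \<Longrightarrow> f (x \<otimes>\<^bsub>M\<^esub> y) = f x \<otimes>\<^bsub>N\<^esub> f y"
    and "f \<one>\<^bsub>M\<^esub> = \<one>\<^bsub>N\<^esub>" and "continuous_map (topol M) (topol N) f"
  using assms by (auto simp: chom_def hom_def)

lemma profinite_monoidD:
  assumes "profinite_monoid M"
  shows "Group.monoid M" "topspace (topol M) = carrier M" "compact_space (topol M)" "Hausdorff_space (topol M)"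
  using assms by (simp_all add: profinite_monoid_def topological_monoid_def)

text \<open>Minimality of the free product as an induction rule, with closedness taken inside the
  free product instead of the ambient product.\<close>

lemma free_product_induct:
  assumes H: "H \<subseteq> carrier (free_product I D)" "\<one>\<^bsub>free_product I D\<^esub> \<in> H"
    "\<And>x y. x \<in> H \<Longrightarrow> y \<in> H \<Longrightarrow> x \<otimes>\<^bsub>free_product I D\<^esub> y \<in> H"
    "closedin (topol (free_product I D)) H"
    "\<And>i x. i \<in> I \<Longrightarrow> x \<in> carrier (D i) \<Longrightarrow> free_inj I D i x \<in> H"
    and x: "x \<in> carrier (free_product I D)"
  shows "x \<in> H"
proof -
  have "carrier (free_product I D) \<subseteq> H"
  proof (rule free_product_least)
    show "submonoid H (free_ambient I D)"
      using H(1-3) submonoid.subset[OF submonoid_free_product, of I D] unfolding free_product_simps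
      by (intro submonoid.intro) auto
    show "closedin (topol (free_ambient I D)) H"
      using H(4) unfolding free_product_simps(3) by (rule closedin_trans_full[OF _ closedin_free_product])
  qed (rule H(5))
  then show ?thesis using x by blast
qed

text \<open>A form of \<open>free_inj_chom\<close> whose premise on \<open>D i\<close> is just the
  fact at hand for \<open>weil_compact\<close>.\<close>

lemma free_inj_chom':
  assumes i: "i \<in> I" and ts: "topspace (topol (D i)) = carrier (D i)"
  shows "free_inj I D i \<in> chom (D i) (free_product I D)"
proof -
  have phi: "\<phi> i \<in> chom (D i) (discrete_monoid N)" if "(N, \<phi>) \<in> free_targets I D" for N \<phi>
    using that i by (simp add: free_targets_def)
  have "continuous_map (topol (D i)) (topol (free_ambient I D)) (free_inj I D i)"
    unfolding free_ambient_simps(4) continuous_map_componentwise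
    using chomD(4)[OF phi] by (auto simp: free_inj_def)
  then have "continuous_map (topol (D i)) (topol (free_product I D)) (free_inj I D i)"
    unfolding free_product_simps(3) continuous_map_in_subtopology ts using free_inj_carrier[OF i] by auto
  moreover have "free_inj I D i (x \<otimes>\<^bsub>D i\<^esub> y) = free_inj I D i x \<otimes>\<^bsub>free_product I D\<^esub> free_inj I D i y"
    if "x \<in> carrier (D i)" "y \<in> carrier (D i)" for x y
    using chomD(2)[OF phi that] unfolding free_product_simps(1) free_ambient_simps(2) free_inj_def
    by (intro restrict_ext) auto
  moreover have "free_inj I D i \<one>\<^bsub>D i\<^esub> = \<one>\<^bsub>free_product I D\<^esub>"
    using chomD(3)[OF phi] unfolding free_product_simps(2) free_ambient_simps(3) free_inj_def
    by (intro restrict_ext) auto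
  ultimately show ?thesis
    using free_inj_carrier[OF i, of _ D] by (simp add: chom_def hom_def Pi_iff)
qed

lemma free_product_ext:
  assumes f: "f \<in> chom (free_product I D) N" and g: "g \<in> chom (free_product I D) N"
    and "Hausdorff_space (topol N)"
    and eq: "\<And>i x. i \<in> I \<Longrightarrow> x \<in> carrier (D i) \<Longrightarrow> f (free_inj I D i x) = g (free_inj I D i x)"
    and x: "x \<in> carrier (free_product I D)"
  shows "f x = g x"
proof -
  let ?P = "free_product I D"
  interpret P: Group.monoid ?P by (rule profinite_monoidD(1)[OF profinite_monoid_free_product])
  have "x \<in> {y \<in> carrier ?P. f y = g y}"
  proof (rule free_product_induct[OF _ _ _ _ _ x])
    show "closedin (topol ?P) {y \<in> carrier ?P. f y = g y}"
      using closedin_continuous_maps_eq[OF assms(3) chomD(4)[OF f] chomD(4)[OF g]] by (simp add: free_product_simps(4))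
  qed (use chomD[OF f] chomD[OF g] eq free_inj_carrier in auto)
  then show ?thesis by blast
qed

text \<open>The ambient product is indexed by the families of maps to finite monoids, so the
  homomorphism induced by such a family is the coordinate at this very index.\<close>

lemma free_product_coordinate:
  assumes p: "(N, \<phi>) \<in> free_targets I D"
  shows "(\<lambda>x. x (N, \<phi>)) \<in> chom (free_product I D) (discrete_monoid N)"
    and "i \<in> I \<Longrightarrow> free_inj I D i x (N, \<phi>) = \<phi> i x"
proof -
  have "continuous_map (topol (free_product I D)) (discrete_topology (carrier N)) (\<lambda>x. x (N, \<phi>))"
    unfolding free_product_simps free_ambient_simps
    using continuous_map_product_projection[OF p, of "\<lambda>(N, \<phi>). discrete_topology (carrier N)"]
    by (intro continuous_map_from_subtopology) simp
  moreover have "carrier (free_product I D) \<subseteq> carrier (free_ambient I D)"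
    using submonoid_free_product by (rule submonoid.subset)
  ultimately show "(\<lambda>x. x (N, \<phi>)) \<in> chom (free_product I D) (discrete_monoid N)"
    using p by (auto simp: chom_def hom_def free_product_simps free_ambient_simps(1-3) PiE_iff)
  show "i \<in> I \<Longrightarrow> free_inj I D i x (N, \<phi>) = \<phi> i x"
    using p by (simp add: free_inj_def)
qed

section \<open>Inverse limits\<close>

lemma inverse_limit_simps:
  "carrier (inverse_limit J ord M t) =
     {x \<in> (\<Pi>\<^sub>E j\<in>J. carrier (M j)). \<forall>i\<in>J. \<forall>j\<in>J. ord i j \<longrightarrow> t i j (x j) = x i}"
  "x \<otimes>\<^bsub>inverse_limit J ord M t\<^esub> y = (\<lambda>j\<in>J. x j \<otimes>\<^bsub>M j\<^esub> y j)"
  "\<one>\<^bsub>inverse_limit J ord M t\<^esub> = (\<lambda>j\<in>J. \<one>\<^bsub>M j\<^esub>)"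
  "topol (inverse_limit J ord M t) =
     subtopology (product_topology (\<lambda>j. topol (M j)) J) (carrier (inverse_limit J ord M t))"
  by (simp_all add: inverse_limit_def product_monoid_def)

context
  fixes J :: "'j set" and ord and M :: "'j \<Rightarrow> 'b top_monoid" and t
  assumes M: "\<And>j. j \<in> J \<Longrightarrow> profinite_monoid (M j)"
    and t: "\<And>i j. i \<in> J \<Longrightarrow> j \<in> J \<Longrightarrow> ord i j \<Longrightarrow> t i j \<in> chom (M j) (M i)"
begin

abbreviation (input) L where "L \<equiv> inverse_limit J ord M t"

lemma monoid_inverse_limit: "Group.monoid L"
proof (rule monoidI)
  note Mj = profinite_monoidD(1)[OF M]
  have comp: "j \<in> J \<Longrightarrow> x \<in> carrier L \<Longrightarrow> x j \<in> carrier (M j)" for x j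
    by (auto simp: inverse_limit_simps(1))
  have ext: "x \<in> carrier L \<Longrightarrow> x \<in> extensional J" for x
    by (auto simp: inverse_limit_simps(1) PiE_def)
  show "x \<otimes>\<^bsub>L\<^esub> y \<in> carrier L" if "x \<in> carrier L" "y \<in> carrier L" for x y
    using that comp monoid.m_closed[OF Mj] chomD(2)[OF t] unfolding inverse_limit_simps(1,2) by auto
  show "\<one>\<^bsub>L\<^esub> \<in> carrier L"
    using monoid.one_closed[OF Mj] chomD(3)[OF t] unfolding inverse_limit_simps(1,3) by auto
  show "x \<otimes>\<^bsub>L\<^esub> y \<otimes>\<^bsub>L\<^esub> z = x \<otimes>\<^bsub>L\<^esub> (y \<otimes>\<^bsub>L\<^esub> z)"
    if "x \<in> carrier L" "y \<in> carrier L" "z \<in> carrier L" for x y z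
    using that comp monoid.m_assoc[OF Mj] unfolding inverse_limit_simps(2) by (auto intro!: restrict_ext)
  show "\<one>\<^bsub>L\<^esub> \<otimes>\<^bsub>L\<^esub> x = x" "x \<otimes>\<^bsub>L\<^esub> \<one>\<^bsub>L\<^esub> = x" if "x \<in> carrier L" for x
    using ext[OF that] comp[OF _ that] monoid.l_one[OF Mj] monoid.r_one[OF Mj]
    unfolding inverse_limit_simps(2,3) by (auto intro!: extensionalityI[of _ J])
qed

lemma topspace_inverse_limit: "topspace (topol L) = carrier L"
proof -
  have "topspace (product_topology (\<lambda>j. topol (M j)) J) = (\<Pi>\<^sub>E j\<in>J. carrier (M j))"
    using profinite_monoidD(2)[OF M] by (auto simp: PiE_iff)
  then have "carrier L \<subseteq> topspace (product_topology (\<lambda>j. topol (M j)) J)"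
    unfolding inverse_limit_simps(1) by blast
  then show ?thesis unfolding inverse_limit_simps(4) topspace_subtopology by blast
qed

lemma inverse_limit_projection:
  assumes "j \<in> J"
  shows "(\<lambda>x. x j) \<in> chom L (M j)"
proof -
  have "continuous_map (topol L) (topol (M j)) (\<lambda>x. x j)"
    unfolding inverse_limit_simps(4)
    by (intro continuous_map_from_subtopology continuous_map_product_projection assms)
  then show ?thesis
    using assms by (auto simp: chom_def hom_def inverse_limit_simps)
qed

lemma compact_space_inverse_limit: "compact_space (topol L)"
proof -
  let ?P = "product_topology (\<lambda>j. topol (M j)) J"
  have tP: "topspace ?P = (\<Pi>\<^sub>E j\<in>J. carrier (M j))"
    using profinite_monoidD(2)[OF M] by (auto simp: PiE_iff)
  have cl: "closedin ?P {x \<in> topspace ?P. t i j (x j) = x i}" if "i \<in> J" "j \<in> J" "ord i j" for i j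
    using that profinite_monoidD(4)[OF M] chomD(4)[OF t]
    by (intro closedin_continuous_maps_eq[of "topol (M i)"] continuous_map_product_projection
        continuous_map_compose[of ?P "topol (M j)" "\<lambda>x. x j" _ "t i j", unfolded o_def])
  \<comment> \<open>The whole space is inserted so that the intersection is over a nonempty family
    even if no indices are related.\<close>
  have "closedin ?P (\<Inter>(insert (topspace ?P) {{x \<in> topspace ?P. t i j (x j) = x i} | i j. i \<in> J \<and> j \<in> J \<and> ord i j}))"
  proof (rule closedin_Inter)
    show "closedin ?P V" if "V \<in> insert (topspace ?P) {{x \<in> topspace ?P. t i j (x j) = x i} | i j. i \<in> J \<and> j \<in> J \<and> ord i j}" for V
      using that cl closedin_topspace[of ?P] by blast
  qed blast
  also have "\<Inter>(insert (topspace ?P) {{x \<in> topspace ?P. t i j (x j) = x i} | i j. i \<in> J \<and> j \<in> J \<and> ord i j}) = carrier L"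
    unfolding tP inverse_limit_simps(1) by blast
  finally have "closedin ?P (carrier L)" .
  moreover have "compact_space ?P"
    using profinite_monoidD(3)[OF M] by (simp add: compact_space_product_topology)
  ultimately show ?thesis
    unfolding inverse_limit_simps(4) by (intro compact_space_subtopology closedin_compact_space)
qed

text \<open>Near each point a map to a discrete space depends on finitely many coordinates, hence by
  directedness on one. Compactness and directedness then give a single coordinate for all
  points.\<close>

lemma inverse_limit_factor:
  assumes f: "continuous_map (topol L) (discrete_topology N) f"
    and directed: "\<And>A. finite A \<Longrightarrow> A \<subseteq> J \<Longrightarrow> \<exists>j\<in>J. \<forall>i\<in>A. ord i j"
  shows "\<exists>j\<in>J. \<forall>x\<in>carrier L. \<forall>y\<in>carrier L. x j = y j \<longrightarrow> f x = f y"
proof -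
  \<comment> \<open>Only \<open>y\<close> is required to lie in U: equality at j has to carry the
    value of f to points for which membership in U is not known.\<close>
  define \<U> where "\<U> = {U. openin (topol L) U \<and>
      (\<exists>j\<in>J. \<forall>y\<in>carrier L. \<forall>z\<in>carrier L. y j = z j \<longrightarrow> y \<in> U \<longrightarrow> f y = f z)}"
  have "\<exists>U\<in>\<U>. x \<in> U"
    if x: "x \<in> carrier L" for x
  proof -
    have "openin (topol L) {y \<in> carrier L. f y = f x}"
      using continuous_map_discrete_openin[OF f, of "\<lambda>w. w = f x"] by (simp add: topspace_inverse_limit)
    then obtain V where V: "openin (product_topology (\<lambda>j. topol (M j)) J) V" "{y \<in> carrier L. f y = f x} = V \<inter> carrier L"
      unfolding inverse_limit_simps(4) openin_subtopology by blast
    then have "x \<in> V" using x by blast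
    then obtain B where B: "x \<in> (\<Pi>\<^sub>E i\<in>J. B i)" "\<And>i. openin (topol (M i)) (B i)"
      "finite {i. B i \<noteq> topspace (topol (M i))}" "(\<Pi>\<^sub>E i\<in>J. B i) \<subseteq> V"
      using product_topology_open_contains_basis[OF V(1)] by blast
    \<comment> \<open>The coordinates that a basic neighbourhood restricts; all of them are
      determined by the coordinate at one index above them.\<close>
    let ?A = "{i \<in> J. B i \<noteq> topspace (topol (M i))}"
    have "finite ?A" using B(3) by (rule rev_finite_subset) auto
    then obtain j where j: "j \<in> J" "\<forall>i\<in>?A. ord i j" using directed[of ?A] by blast
    let ?U = "(\<Pi>\<^sub>E i\<in>J. B i) \<inter> carrier L"
    have "openin (product_topology (\<lambda>j. topol (M j)) J) (\<Pi>\<^sub>E i\<in>J. B i)"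
      by (rule product_topology_basis[OF B(2,3)])
    then have "openin (topol L) ?U"
      unfolding inverse_limit_simps(4) by (rule openin_subtopology_Int)
    moreover have "f y = f z" if yz: "y \<in> carrier L" "z \<in> carrier L" "y j = z j" "y \<in> ?U" for y z
    proof -
      have "z i \<in> B i" if i: "i \<in> J" for i
      proof (cases "i \<in> ?A")
        case True
        then have "z i = t i j (z j)" "y i = t i j (y j)"
          using yz(1,2) i j unfolding inverse_limit_simps(1) by auto
        then have "z i = y i" using yz(3) by simp
        moreover have "y i \<in> B i" using yz(4) i by (blast dest: PiE_mem)
        ultimately show ?thesis by simp
      next
        case False
        then have "B i = carrier (M i)" using i profinite_monoidD(2)[OF M] by auto
        then show ?thesis using yz(2) i unfolding inverse_limit_simps(1) by auto
      qed
      moreover have "z \<in> extensional J" using yz(2) unfolding inverse_limit_simps(1) PiE_def by blast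
      ultimately have "z \<in> ?U" using yz(2) by (auto simp: PiE_iff)
      then have "f z = f x" "f y = f x" using V(2) B(4) yz(4) by blast+
      then show ?thesis by simp
    qed
    ultimately have "?U \<in> \<U>" using j(1) unfolding \<U>_def by blast
    then show ?thesis using B(1) x by blast
  qed
  then have cover: "topspace (topol L) \<subseteq> \<Union>\<U>"
    unfolding topspace_inverse_limit by blast
  have cpt: "compactin (topol L) (topspace (topol L))"
    using compact_space_inverse_limit by (simp add: compact_space_def)
  have op: "openin (topol L) U" if "U \<in> \<U>" for U
    using that by (simp add: \<U>_def)
  have "\<exists>F. finite F \<and> F \<subseteq> \<U> \<and> topspace (topol L) \<subseteq> \<Union>F"
    by (rule compactinD[OF cpt _ cover]) (rule op)
  then obtain F where F: "finite F" "F \<subseteq> \<U>" "topspace (topol L) \<subseteq> \<Union>F"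
    by (elim exE conjE)
  have "\<forall>V\<in>F. \<exists>j. j \<in> J \<and> (\<forall>y\<in>carrier L. \<forall>z\<in>carrier L. y j = z j \<longrightarrow> y \<in> V \<longrightarrow> f y = f z)"
  proof
    fix V assume "V \<in> F"
    then have "V \<in> \<U>" using F(2) by blast
    then show "\<exists>j. j \<in> J \<and> (\<forall>y\<in>carrier L. \<forall>z\<in>carrier L. y j = z j \<longrightarrow> y \<in> V \<longrightarrow> f y = f z)"
      unfolding \<U>_def by blast
  qed
  from bchoice[OF this] obtain s where s:
    "\<forall>V\<in>F. s V \<in> J \<and> (\<forall>y\<in>carrier L. \<forall>z\<in>carrier L. y (s V) = z (s V) \<longrightarrow> y \<in> V \<longrightarrow> f y = f z)" ..
  then obtain j where j: "j \<in> J" "\<forall>i\<in>s ` F. ord i j" using directed[of "s ` F"] F(1) by blast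
  have "f x = f y" if xy: "x \<in> carrier L" "y \<in> carrier L" "x j = y j" for x y
  proof -
    obtain V where V: "V \<in> F" "x \<in> V" using F(3) xy(1) unfolding topspace_inverse_limit by blast
    then have "s V \<in> J" "ord (s V) j" using s j by blast+
    then have "x (s V) = t (s V) j (x j)" "y (s V) = t (s V) j (y j)"
      using xy(1,2) j(1) unfolding inverse_limit_simps(1) by auto
    then have "x (s V) = y (s V)" using xy(3) by simp
    then show ?thesis using s V xy(1,2) by blast
  qed
  then show ?thesis using j(1) by blast
qed

end

section \<open>The monoids \<open>Q_S\<close> and their limit\<close>

context number_field_closure
begin

lemma primes_over_subset: "v \<in> primes_over K S \<Longrightarrow> v \<in> primes_of UNIV"
  by (simp add: primes_over_def)

lemma galois_primes_over:
  "\<sigma> \<in> galois_carrier K \<Longrightarrow> v \<in> primes_of UNIV \<Longrightarrow> \<sigma> ` v \<in> primes_over K S \<longleftrightarrow> v \<in> primes_over K S"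
  by (simp add: primes_over_def galois_image_prime)

lemma profinite_QS: "profinite_monoid (QS K S)"
  unfolding QS_def by (rule profinite_monoid_free_product)

lemmas QS_monoid = profinite_monoidD(1)[OF profinite_QS]
  and topspace_QS = profinite_monoidD(2)[OF profinite_QS]
  and Hausdorff_QS = profinite_monoidD(4)[OF profinite_QS]

lemma QS_inj_chom:
  assumes v: "v \<in> primes_of UNIV"
  shows "QS_inj K S v \<in> chom (weil_compact K v) (QS K S)"
proof (cases "v \<in> primes_over K S")
  case True
  have "QS_inj K S v = free_inj (primes_over K S) (weil_compact K) v"
    using True by (simp add: QS_inj_def fun_eq_iff)
  then show ?thesis
    unfolding QS_def using True v by (simp add: free_inj_chom')
next
  case False
  have "QS_inj K S v = (\<lambda>x. \<one>\<^bsub>QS K S\<^esub>)" using False by (simp add: QS_inj_def fun_eq_iff)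
  then show ?thesis using chom_const_one[OF QS_monoid topspace_QS] by simp
qed

lemma QS_inj_one: "v \<notin> primes_over K S \<Longrightarrow> QS_inj K S v x = \<one>\<^bsub>QS K S\<^esub>"
  by (simp add: QS_inj_def)

lemma QS_ext:
  assumes "f \<in> chom (QS K S) N" "g \<in> chom (QS K S) N" "Hausdorff_space (topol N)"
    and "\<And>v x. v \<in> primes_over K S \<Longrightarrow> x \<in> carrier (weil_compact K v) \<Longrightarrow> f (QS_inj K S v x) = g (QS_inj K S v x)"
    and "x \<in> carrier (QS K S)"
  shows "f x = g x"
  by (rule free_product_ext[OF assms(1,2)[unfolded QS_def] assms(3) _ assms(5)[unfolded QS_def]])
    (use assms(4) in \<open>simp add: QS_inj_def\<close>)

lemma QS_induct:
  assumes "H \<subseteq> carrier (QS K S)" "\<one>\<^bsub>QS K S\<^esub> \<in> H" "\<And>x y. x \<in> H \<Longrightarrow> y \<in> H \<Longrightarrow> x \<otimes>\<^bsub>QS K S\<^esub> y \<in> H"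
    "closedin (topol (QS K S)) H"
    "\<And>v x. v \<in> primes_over K S \<Longrightarrow> x \<in> carrier (weil_compact K v) \<Longrightarrow> QS_inj K S v x \<in> H"
    and x: "x \<in> carrier (QS K S)"
  shows "x \<in> H"
proof (rule free_product_induct[OF assms(1-4)[unfolded QS_def] _ x[unfolded QS_def]])
  fix v y assume "v \<in> primes_over K S" "y \<in> carrier (weil_compact K v)"
  then show "free_inj (primes_over K S) (weil_compact K) v y \<in> H"
    using assms(5)[of v y] by (simp add: QS_inj_def)
qed

lemma QS_trans_chom: "QS_trans K S S' \<in> chom (QS K S') (QS K S)"
  unfolding QS_trans_def QS_def[of K S']
  using QS_inj_chom primes_over_subset by (intro free_lift(1) profinite_QS) blast

lemma QS_trans_inj:
  assumes "v \<in> primes_of UNIV" "S \<subseteq> S'" and x: "x \<in> carrier (weil_compact K v)"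
  shows "QS_trans K S S' (QS_inj K S' v x) = QS_inj K S v x"
proof (cases "v \<in> primes_over K S'")
  case True
  have "QS_trans K S S' (free_inj (primes_over K S') (weil_compact K) v x) = QS_inj K S v x"
    unfolding QS_trans_def using QS_inj_chom primes_over_subset True x by (intro free_lift(2) profinite_QS) blast+
  then show ?thesis using True by (simp add: QS_inj_def)
next
  case False
  then have "v \<notin> primes_over K S" using assms(2) by (auto simp: primes_over_def)
  then show ?thesis using False chomD(3)[OF QS_trans_chom] by (simp add: QS_inj_one)
qed

context
  fixes \<sigma> assumes \<sigma>: "\<sigma> \<in> galois_carrier K"
begin

lemma conj_QS_inj_chom:
  "v \<in> primes_of UNIV \<Longrightarrow> (\<lambda>x. QS_inj K S (\<sigma> ` v) (map_option (conj_by \<sigma>) x)) \<in> chom (weil_compact K v) (QS K S)"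
  by (rule chom_comp[OF conj_chom[OF \<sigma>] QS_inj_chom[OF galois_image_prime(1)[OF \<sigma>]]])

lemma QS_act_eq: "QS_act K S \<sigma> = free_lift (primes_over K S) (weil_compact K) (QS K S)
     (\<lambda>v x. QS_inj K S (\<sigma> ` v) (map_option (conj_by \<sigma>) x))"
  unfolding QS_act_def inv_abs_galois[OF \<sigma>] ..

lemma QS_act_chom: "QS_act K S \<sigma> \<in> chom (QS K S) (QS K S)"
  unfolding QS_act_eq
  by (subst QS_def) (intro free_lift(1) profinite_QS conj_QS_inj_chom primes_over_subset)

lemma QS_act_inj:
  assumes "v \<in> primes_of UNIV" and x: "x \<in> carrier (weil_compact K v)"
  shows "QS_act K S \<sigma> (QS_inj K S v x) = QS_inj K S (\<sigma> ` v) (map_option (conj_by \<sigma>) x)"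
proof (cases "v \<in> primes_over K S")
  case True
  have "QS_act K S \<sigma> (free_inj (primes_over K S) (weil_compact K) v x) = QS_inj K S (\<sigma> ` v) (map_option (conj_by \<sigma>) x)"
    unfolding QS_act_eq using True x by (intro free_lift(2) profinite_QS conj_QS_inj_chom primes_over_subset)
  then show ?thesis using True by (simp add: QS_inj_def)
next
  case False
  then show ?thesis using galois_primes_over[OF \<sigma> assms(1)] chomD(3)[OF QS_act_chom] by (simp add: QS_inj_one)
qed

text \<open>What keeps \<open>Qhat_act\<close> inside the limit. Both composites are continuous
  homomorphisms, so they are compared on the local monoids.\<close>

lemma QS_trans_act:
  assumes "S \<subseteq> S'" "x \<in> carrier (QS K S')"
  shows "QS_trans K S S' (QS_act K S' \<sigma> x) = QS_act K S \<sigma> (QS_trans K S S' x)"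
proof (rule QS_ext[OF chom_comp[OF QS_act_chom QS_trans_chom] chom_comp[OF QS_trans_chom QS_act_chom] Hausdorff_QS _ assms(2)])
  fix v x assume "v \<in> primes_over K S'" and x: "x \<in> carrier (weil_compact K v)"
  then have v: "v \<in> primes_of UNIV" using primes_over_subset by blast
  show "QS_trans K S S' (QS_act K S' \<sigma> (QS_inj K S' v x)) = QS_act K S \<sigma> (QS_trans K S S' (QS_inj K S' v x))"
    using chomD(1)[OF conj_chom[OF \<sigma> v] x]
    by (simp only: QS_act_inj[OF v x] QS_trans_inj[OF v assms(1) x] QS_trans_inj[OF galois_image_prime(1)[OF \<sigma> v] assms(1)])
qed

end

lemma QS_act_id:
  assumes "x \<in> carrier (QS K S)"
  shows "QS_act K S id x = x"
proof -
  have id: "(\<lambda>x. x) \<in> chom (QS K S) (QS K S)" by (simp add: chom_def hom_def)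
  show ?thesis
  proof (rule QS_ext[OF QS_act_chom[OF galois_id] id Hausdorff_QS _ assms])
    fix v x assume v: "v \<in> primes_over K S" and x: "x \<in> carrier (weil_compact K v)"
    have "conj_by id = (id :: ('a \<Rightarrow> 'a) \<Rightarrow> _)" by (simp add: fun_eq_iff)
    then show "QS_act K S id (QS_inj K S v x) = QS_inj K S v x"
      using QS_act_inj[OF galois_id primes_over_subset[OF v] x] by (simp add: option.map_id0)
  qed
qed

lemma QS_act_comp:
  assumes \<sigma>: "\<sigma> \<in> galois_carrier K" and \<tau>: "\<tau> \<in> galois_carrier K" and "x \<in> carrier (QS K S)"
  shows "QS_act K S (\<sigma> \<circ> \<tau>) x = QS_act K S \<sigma> (QS_act K S \<tau> x)"
proof (rule QS_ext[OF QS_act_chom[OF galois_comp[OF \<sigma> \<tau>]] chom_comp[OF QS_act_chom[OF \<tau>] QS_act_chom[OF \<sigma>]] Hausdorff_QS _ assms(3)])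
  fix v x assume "v \<in> primes_over K S" and x: "x \<in> carrier (weil_compact K v)"
  then have v: "v \<in> primes_of UNIV" using primes_over_subset by blast
  have inv: "inv_into UNIV (\<sigma> \<circ> \<tau>) = inv_into UNIV \<tau> \<circ> inv_into UNIV \<sigma>"
    by (rule o_inv_distrib[OF galois_bij[OF \<sigma>] galois_bij[OF \<tau>]])
  have "map_option (conj_by (\<sigma> \<circ> \<tau>)) x = map_option (conj_by \<sigma>) (map_option (conj_by \<tau>) x)"
    unfolding inv by (cases x) (simp_all add: o_assoc)
  then show "QS_act K S (\<sigma> \<circ> \<tau>) (QS_inj K S v x) = QS_act K S \<sigma> (QS_act K S \<tau> (QS_inj K S v x))"
    using chomD(1)[OF conj_chom[OF \<tau> v] x]
    by (simp only: QS_act_inj[OF galois_comp[OF \<sigma> \<tau>] v x] QS_act_inj[OF \<tau> v x]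
        QS_act_inj[OF \<sigma> galois_image_prime(1)[OF \<tau> v]] galois_image_comp)
qed

lemmas Qhat_lim = profinite_QS QS_trans_chom

lemma Qhat_simps:
  "carrier (Qhat K) = {x \<in> (\<Pi>\<^sub>E S\<in>finite_prime_sets K. carrier (QS K S)).
     \<forall>S\<in>finite_prime_sets K. \<forall>S'\<in>finite_prime_sets K. S \<subseteq> S' \<longrightarrow> QS_trans K S S' (x S') = x S}"
  "x \<otimes>\<^bsub>Qhat K\<^esub> y = (\<lambda>S\<in>finite_prime_sets K. x S \<otimes>\<^bsub>QS K S\<^esub> y S)"
  "\<one>\<^bsub>Qhat K\<^esub> = (\<lambda>S\<in>finite_prime_sets K. \<one>\<^bsub>QS K S\<^esub>)"
  unfolding Qhat_def inverse_limit_simps by simp_all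

lemma monoid_Qhat: "Group.monoid (Qhat K)"
  and topspace_Qhat: "topspace (topol (Qhat K)) = carrier (Qhat K)"
  and compact_space_Qhat: "compact_space (topol (Qhat K))"
  unfolding Qhat_def
  by (rule monoid_inverse_limit topspace_inverse_limit compact_space_inverse_limit; rule Qhat_lim)+

lemma Qhat_projection: "S \<in> finite_prime_sets K \<Longrightarrow> (\<lambda>x. x S) \<in> chom (Qhat K) (QS K S)"
  unfolding Qhat_def by (rule inverse_limit_projection) (rule Qhat_lim)+

text \<open>The finite sets of primes are directed by union.\<close>

lemma Qhat_factor:
  assumes "continuous_map (topol (Qhat K)) (discrete_topology N) f"
  shows "\<exists>S\<in>finite_prime_sets K. \<forall>x\<in>carrier (Qhat K). \<forall>y\<in>carrier (Qhat K). x S = y S \<longrightarrow> f x = f y"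
  using assms unfolding Qhat_def
proof (rule inverse_limit_factor[rotated 2])
  fix A assume "finite A" "A \<subseteq> finite_prime_sets K"
  then have "\<Union>A \<in> finite_prime_sets K" by (auto simp: finite_prime_sets_def)
  then show "\<exists>S\<in>finite_prime_sets K. \<forall>T\<in>A. T \<subseteq> S" by blast
qed (rule Qhat_lim)+

lemma Qhat_inj_carrier:
  assumes "v \<in> primes_of UNIV" "x \<in> carrier (weil_compact K v)"
  shows "Qhat_inj K v x \<in> carrier (Qhat K)"
  using chomD(1)[OF QS_inj_chom[OF assms(1)] assms(2)] QS_trans_inj[OF assms(1) _ assms(2)]
  unfolding Qhat_simps(1) Qhat_inj_def by auto

lemma Qhat_act_carrier:
  assumes "\<sigma> \<in> galois_carrier K" "x \<in> carrier (Qhat K)"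
  shows "Qhat_act K \<sigma> x \<in> carrier (Qhat K)"
  using assms(2) chomD(1)[OF QS_act_chom[OF assms(1)]] QS_trans_act[OF assms(1)]
  unfolding Qhat_simps(1) Qhat_act_def by (auto simp: PiE_iff)

lemma Qhat_act_mult:
  assumes "\<sigma> \<in> galois_carrier K" "x \<in> carrier (Qhat K)" "y \<in> carrier (Qhat K)"
  shows "Qhat_act K \<sigma> (x \<otimes>\<^bsub>Qhat K\<^esub> y) = Qhat_act K \<sigma> x \<otimes>\<^bsub>Qhat K\<^esub> Qhat_act K \<sigma> y"
  using assms(2,3) chomD(2)[OF QS_act_chom[OF assms(1)]]
  unfolding Qhat_simps Qhat_act_def by (intro restrict_ext) (auto simp: PiE_iff)

lemma Qhat_act_one: "\<sigma> \<in> galois_carrier K \<Longrightarrow> Qhat_act K \<sigma> \<one>\<^bsub>Qhat K\<^esub> = \<one>\<^bsub>Qhat K\<^esub>"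
  using chomD(3)[OF QS_act_chom] unfolding Qhat_simps Qhat_act_def by (intro restrict_ext) auto

lemma Qhat_act_id:
  assumes "x \<in> carrier (Qhat K)"
  shows "Qhat_act K id x = x"
  using assms QS_act_id unfolding Qhat_simps(1) Qhat_act_def
  by (intro extensionalityI[of _ "finite_prime_sets K"]) (auto simp: PiE_iff)

lemma Qhat_act_comp:
  assumes "\<sigma> \<in> galois_carrier K" "\<tau> \<in> galois_carrier K" "x \<in> carrier (Qhat K)"
  shows "Qhat_act K (\<sigma> \<circ> \<tau>) x = Qhat_act K \<sigma> (Qhat_act K \<tau> x)"
  using assms(3) QS_act_comp[OF assms(1,2)]
  unfolding Qhat_simps(1) Qhat_act_def by (intro restrict_ext) (auto simp: PiE_iff)

lemma Qhat_semidirect_simps [simp]: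
  "carrier (Qhat_semidirect K) = carrier (Qhat K) \<times> galois_carrier K"
  "(a, g) \<otimes>\<^bsub>Qhat_semidirect K\<^esub> (b, h) = (a \<otimes>\<^bsub>Qhat K\<^esub> Qhat_act K g b, g \<circ> h)"
  "\<one>\<^bsub>Qhat_semidirect K\<^esub> = (\<one>\<^bsub>Qhat K\<^esub>, id)"
  "topol (Qhat_semidirect K) = prod_topology (topol (Qhat K)) (krull_topology K)"
  by (simp_all add: Qhat_semidirect_def semidirect_def)

lemma topspace_Qhat_semidirect: "topspace (topol (Qhat_semidirect K)) = carrier (Qhat_semidirect K)"
  by (simp add: topspace_Qhat)

lemma monoid_Qhat_semidirect: "Group.monoid (Qhat_semidirect K)"
proof (rule monoidI)
  interpret Q: Group.monoid "Qhat K" by (rule monoid_Qhat)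
  fix x y z
  assume "x \<in> carrier (Qhat_semidirect K)" "y \<in> carrier (Qhat_semidirect K)" "z \<in> carrier (Qhat_semidirect K)"
  then show "x \<otimes>\<^bsub>Qhat_semidirect K\<^esub> y \<otimes>\<^bsub>Qhat_semidirect K\<^esub> z = x \<otimes>\<^bsub>Qhat_semidirect K\<^esub> (y \<otimes>\<^bsub>Qhat_semidirect K\<^esub> z)"
    by (auto simp: Q.m_assoc Qhat_act_mult Qhat_act_comp Qhat_act_carrier o_assoc)
qed (auto simp: monoid.one_closed[OF monoid_Qhat] monoid.m_closed[OF monoid_Qhat] monoid.l_one[OF monoid_Qhat]
    monoid.r_one[OF monoid_Qhat] galois_id galois_comp Qhat_act_carrier Qhat_act_id Qhat_act_one)

end

section \<open>Finite monoids, kernels and quotients\<close>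

text \<open>Finite targets are required to have natural numbers as elements; monoids built from
  automorphisms or products are transported to this form.\<close>

lemma ex_iso_nat_monoid:
  assumes "Group.monoid N" "finite (carrier N)"
  obtains N' :: "nat monoid" and e where "Group.monoid N'" "finite (carrier N')" "e \<in> iso N N'" "e \<one>\<^bsub>N\<^esub> = \<one>\<^bsub>N'\<^esub>"
proof -
  interpret Group.monoid N by fact
  obtain e :: "'a \<Rightarrow> nat" and n where e: "inj_on e (carrier N)"
    using finite_imp_inj_to_nat_seg[OF assms(2)] by blast
  define d where "d = inv_into (carrier N) e"
  define N' :: "nat monoid" where "N' = \<lparr>carrier = e ` carrier N, mult = (\<lambda>x y. e (d x \<otimes>\<^bsub>N\<^esub> d y)), one = e \<one>\<^bsub>N\<^esub>\<rparr>"
  have de: "d (e x) = x" if "x \<in> carrier N" for x using that e by (simp add: d_def)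
  have simps: "carrier N' = e ` carrier N" "x \<otimes>\<^bsub>N'\<^esub> y = e (d x \<otimes>\<^bsub>N\<^esub> d y)" "\<one>\<^bsub>N'\<^esub> = e \<one>\<^bsub>N\<^esub>" for x y
    by (simp_all add: N'_def)
  have "Group.monoid N'"
    by (rule monoidI) (auto simp: simps de m_assoc)
  moreover have "e \<in> iso N N'"
    using e by (auto simp: iso_def hom_def bij_betw_def simps de)
  ultimately show thesis using that assms(2) simps by auto
qed

text \<open>A device: multiplication in a quotient does not see the topology, and with the discrete
  one every monoid meets the premise of \<open>quotient_monoid_mult\<close>.\<close>

lemma topological_monoid_discrete:
  assumes "Group.monoid M"
  shows "topological_monoid (M\<lparr>topol := discrete_topology (carrier M)\<rparr>)"
proof -
  interpret Group.monoid M by fact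
  have "Group.monoid (M\<lparr>topol := discrete_topology (carrier M)\<rparr>)"
    by (rule monoidI) (auto simp: m_assoc)
  then show ?thesis
    by (auto simp: topological_monoid_def prod_topology_discrete_topology[symmetric])
qed

context
  fixes M :: "'a top_monoid" and r
  assumes M: "Group.monoid M" and r: "congruence_on M r"
begin

lemma congruence_on_discrete: "congruence_on (M\<lparr>topol := T\<rparr>) r"
  using r by (simp add: congruence_on_def)

lemma quotient_mult: "x \<in> carrier M \<Longrightarrow> y \<in> carrier M \<Longrightarrow>
    r `` {x} \<otimes>\<^bsub>quotient_monoid M r\<^esub> r `` {y} = r `` {x \<otimes>\<^bsub>M\<^esub> y}"
  using quotient_monoid_mult[OF topological_monoid_discrete[OF M] congruence_on_discrete, of x y]
  by (simp add: quotient_monoid_def)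

lemma quotient_simps:
  "carrier (quotient_monoid M r) = (\<lambda>x. r `` {x}) ` carrier M"
  "\<one>\<^bsub>quotient_monoid M r\<^esub> = r `` {\<one>\<^bsub>M\<^esub>}"
  by (auto simp: quotient_monoid_def quotient_def)

lemma monoid_quotient: "Group.monoid (quotient_monoid M r)"
proof -
  interpret Group.monoid M by (rule M)
  show ?thesis
    by (rule monoidI) (auto simp: quotient_simps quotient_mult m_assoc)
qed

lemma congruence_class_eq_iff: "x \<in> carrier M \<Longrightarrow> y \<in> carrier M \<Longrightarrow> r `` {x} = r `` {y} \<longleftrightarrow> (x, y) \<in> r"
  using r eq_equiv_class_iff[of "carrier M" r x y] by (simp add: congruence_on_def)

lemma quotient_map_quotient:
  assumes "topspace (topol M) = carrier M"
  shows "quotient_map (topol M) (topol (quotient_monoid M r)) (\<lambda>x. r `` {x})"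
  using quotient_map_quotient_topology[of "topol M" r] assms r
  by (simp add: quotient_monoid_def congruence_on_def)

lemma topspace_quotient:
  assumes "topspace (topol M) = carrier M"
  shows "topspace (topol (quotient_monoid M r)) = carrier (quotient_monoid M r)"
  using quotient_imp_surjective_map[OF quotient_map_quotient[OF assms]] assms by (simp add: quotient_simps)

lemma quotient_proj_chom:
  assumes "topspace (topol M) = carrier M"
  shows "(\<lambda>x. r `` {x}) \<in> chom M (quotient_monoid M r)"
  using quotient_imp_continuous_map[OF quotient_map_quotient[OF assms]]
  by (auto simp: chom_def hom_def quotient_simps quotient_mult)

lemma quotient_lift:
  assumes "topspace (topol M) = carrier M" and f: "f \<in> chom M N"
    and resp: "\<And>x y. (x, y) \<in> r \<Longrightarrow> f x = f y"
  obtains g where "g \<in> chom (quotient_monoid M r) N" "\<forall>x\<in>carrier M. g (r `` {x}) = f x"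
proof -
  interpret Group.monoid M by (rule M)
  define g where "g C = f (SOME a. a \<in> C)" for C
  have g: "g (r `` {x}) = f x" if "x \<in> carrier M" for x
  proof -
    have "x \<in> r `` {x}" using that r equiv_class_self[of "carrier M" r x] by (simp add: congruence_on_def)
    then have "(SOME a. a \<in> r `` {x}) \<in> r `` {x}" by (rule someI)
    then show ?thesis using resp by (auto simp: g_def)
  qed
  have "continuous_map (topol M) (topol N) (g \<circ> (\<lambda>x. r `` {x}))"
    by (rule continuous_map_eq[OF chomD(4)[OF f]]) (simp add: assms(1) g)
  then have "continuous_map (topol (quotient_monoid M r)) (topol N) g"
    by (rule continuous_compose_quotient_map[OF quotient_map_quotient[OF assms(1)]])
  then have "g \<in> chom (quotient_monoid M r) N"
    using chomD(1-3)[OF f] by (auto simp: chom_def hom_def quotient_simps quotient_mult g)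
  then show thesis using g that by blast
qed

end

text \<open>The quotient by the kernel embeds continuously into the finite monoid \<open>N\<close>.
  This makes it finite and discrete, and its multiplication is then continuous whatever that of
  \<open>M\<close> is.\<close>

lemma profinite_congruence_kernel:
  fixes M :: "'a top_monoid" and N :: "nat monoid"
  assumes M: "Group.monoid M" "topspace (topol M) = carrier M"
    and N: "Group.monoid N" "finite (carrier N)" and f: "f \<in> chom M (discrete_monoid N)"
  defines "r \<equiv> {(x, y). x \<in> carrier M \<and> y \<in> carrier M \<and> f x = f y}"
  shows "profinite_congruence M r"
proof -
  interpret M: Group.monoid M by (rule M)
  have cong: "congruence_on M r"
    using chomD(2)[OF f] by (auto simp: congruence_on_def equiv_def refl_on_def sym_def trans_def r_def)
  let ?Q = "quotient_monoid M r"
  have resp: "f x = f y" if "(x, y) \<in> r" for x y using that by (simp add: r_def)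
  obtain g where g: "g \<in> chom ?Q (discrete_monoid N)" "\<And>x. x \<in> carrier M \<Longrightarrow> g (r `` {x}) = f x"
    using quotient_lift[OF M(1) cong M(2) f resp] by metis
  have inj: "inj_on g (carrier ?Q)"
  proof (rule inj_onI)
    fix A B assume AB: "A \<in> carrier ?Q" "B \<in> carrier ?Q" "g A = g B"
    then obtain x y where xy: "A = r `` {x}" "B = r `` {y}" "x \<in> carrier M" "y \<in> carrier M"
      unfolding quotient_simps[OF M(1) cong] by blast
    then have "(x, y) \<in> r" using AB(3) g(2) by (simp add: r_def)
    then show "A = B" using congruence_class_eq_iff[OF M(1) cong xy(3,4)] xy by simp
  qed
  have "g ` carrier ?Q \<subseteq> carrier N" using chomD(1)[OF g(1)] by auto
  then have fin: "finite (carrier ?Q)" using inj N(2) by (meson finite_imageD finite_subset)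
  have ts: "topspace (topol ?Q) = carrier ?Q" by (rule topspace_quotient[OF M(1) cong M(2)])
  have disc: "topol ?Q = discrete_topology (carrier ?Q)"
  proof -
    have "openin (topol ?Q) {A}" if A: "A \<in> carrier ?Q" for A
    proof -
      have "openin (topol ?Q) {B \<in> topspace (topol ?Q). g B = g A}"
        using continuous_map_discrete_openin[of "topol ?Q" "carrier N" g "\<lambda>w. w = g A"] chomD(4)[OF g(1)] by simp
      moreover have "{B \<in> topspace (topol ?Q). g B = g A} = {A}"
        using A inj unfolding ts by (auto dest: inj_onD)
      ultimately show ?thesis by simp
    qed
    then show ?thesis using ts by (metis discrete_topology_unique)
  qed
  interpret Q: Group.monoid ?Q by (rule monoid_quotient[OF M(1) cong])
  have "topological_monoid ?Q"
    unfolding topological_monoid_def disc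
    using Q.monoid_axioms by (auto simp: prod_topology_discrete_topology[symmetric])
  then have "profinite_monoid ?Q"
    unfolding profinite_monoid_def disc
    using fin N g(1) inj by (auto simp: compact_space_discrete_topology dest: inj_onD intro!: exI[of _ N] exI[of _ g])
  then show ?thesis using cong by (simp add: profinite_congruence_def)
qed

text \<open>Unlike \<open>min_profinite_congruence\<close>, the following facts do not need the multiplication of
  \<open>M\<close> to be continuous. This matters because the free product over infinitely many primes is
  taken without a finiteness condition, so that the Galois action on it is not jointly continuous.\<close>

context
  fixes M :: "'a top_monoid" and R
  assumes M: "Group.monoid M" and ts: "topspace (topol M) = carrier M" and R: "R \<subseteq> carrier M \<times> carrier M"
begin

lemma congruence_on_min: "congruence_on M (min_profinite_congruence M R)"
proof -
  interpret Group.monoid M by (rule M)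
  let ?F = "{r. profinite_congruence M r \<and> R \<subseteq> r}"
  have cong: "congruence_on M r" if "r \<in> ?F" for r
    using that by (simp add: profinite_congruence_def)
  \<comment> \<open>A map to the one-element monoid shows that the full relation is a profinite
    congruence, so the intersection is over a nonempty family and stays in the carrier.\<close>
  define N :: "nat monoid" where "N = \<lparr>carrier = {0}, mult = (\<lambda>_ _. 0), one = 0\<rparr>"
  have "Group.monoid N" "finite (carrier N)" by (auto simp: N_def intro: monoidI)
  moreover have "(\<lambda>_. 0) \<in> chom M (discrete_monoid N)"
    using ts by (simp add: chom_def hom_def N_def)
  ultimately have "profinite_congruence M {(x, y). x \<in> carrier M \<and> y \<in> carrier M \<and> (0::nat) = 0}"
    by (rule profinite_congruence_kernel[OF M ts])
  moreover have "{(x, y). x \<in> carrier M \<and> y \<in> carrier M \<and> (0::nat) = 0} = carrier M \<times> carrier M" by auto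
  ultimately have "carrier M \<times> carrier M \<in> ?F" using R by simp
  then have "\<Inter>?F \<subseteq> carrier M \<times> carrier M" by (rule Inter_lower)
  moreover have "refl_on (carrier M) (\<Inter>?F)"
    using cong by (simp add: congruence_on_def equiv_def refl_on_def)
  moreover have "sym (\<Inter>?F)"
    using cong by (intro symI InterI) (meson InterD congruence_on_def equiv_def symD)
  moreover have "trans (\<Inter>?F)"
    using cong by (intro transI InterI) (meson InterD congruence_on_def equiv_def transD)
  moreover have "(x \<otimes>\<^bsub>M\<^esub> x', y \<otimes>\<^bsub>M\<^esub> y') \<in> \<Inter>?F"
    if "(x, y) \<in> \<Inter>?F" "(x', y') \<in> \<Inter>?F" for x y x' y'
  proof (rule InterI)
    fix r assume r: "r \<in> ?F"
    then have "(x, y) \<in> r" "(x', y') \<in> r" using that by blast+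
    then show "(x \<otimes>\<^bsub>M\<^esub> x', y \<otimes>\<^bsub>M\<^esub> y') \<in> r"
      using cong[OF r] by (simp add: congruence_on_def)
  qed
  ultimately show ?thesis
    unfolding min_profinite_congruence_def congruence_on_def equiv_def by blast
qed

lemma min_congruence_contains: "R \<subseteq> min_profinite_congruence M R"
  by (auto simp: min_profinite_congruence_def)

text \<open>The kernel of \<open>f\<close> is one of the congruences that are intersected.\<close>

lemma min_congruence_respects:
  fixes N :: "nat monoid"
  assumes "Group.monoid N" "finite (carrier N)" "f \<in> chom M (discrete_monoid N)"
    and "\<And>x y. (x, y) \<in> R \<Longrightarrow> f x = f y" and "(x, y) \<in> min_profinite_congruence M R"
  shows "f x = f y"
proof -
  let ?r = "{(x, y). x \<in> carrier M \<and> y \<in> carrier M \<and> f x = f y}"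
  have "profinite_congruence M ?r" "R \<subseteq> ?r"
    using profinite_congruence_kernel[OF M ts assms(1-3)] assms(4) R by auto
  then have "(x, y) \<in> ?r" using assms(5) unfolding min_profinite_congruence_def by blast
  then show ?thesis by blast
qed

text \<open>A pair outside the intersection is missed by one profinite congruence. The finite
  quotients of the monoid modulo that congruence separate the pair, and they factor through the
  finer minimal quotient.\<close>

lemma min_quotient_separated:
  assumes A: "A \<in> carrier (quotient_monoid M (min_profinite_congruence M R))"
    and B: "B \<in> carrier (quotient_monoid M (min_profinite_congruence M R))" and "A \<noteq> B"
  obtains N :: "nat monoid" and g where "Group.monoid N" "finite (carrier N)"
    "g \<in> chom (quotient_monoid M (min_profinite_congruence M R)) (discrete_monoid N)" "g A \<noteq> g B"
proof -
  let ?r = "min_profinite_congruence M R"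
  note cong = congruence_on_min
  obtain x y where xy: "A = ?r `` {x}" "B = ?r `` {y}" "x \<in> carrier M" "y \<in> carrier M"
    using A B unfolding quotient_simps[OF M cong] by blast
  then have "(x, y) \<notin> ?r" using assms(3) congruence_class_eq_iff[OF M cong] by blast
  then obtain r where r: "profinite_congruence M r" "R \<subseteq> r" "(x, y) \<notin> r"
    unfolding min_profinite_congruence_def by blast
  then have rc: "congruence_on M r" and pr: "profinite_monoid (quotient_monoid M r)"
    by (simp_all add: profinite_congruence_def)
  have "r `` {x} \<noteq> r `` {y}" using congruence_class_eq_iff[OF M rc xy(3,4)] r(3) by simp
  moreover have "r `` {x} \<in> carrier (quotient_monoid M r)" "r `` {y} \<in> carrier (quotient_monoid M r)"
    using xy(3,4) unfolding quotient_simps[OF M rc] by blast+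
  ultimately obtain N :: "nat monoid" and f where N: "Group.monoid N" "finite (carrier N)"
    and f: "f \<in> chom (quotient_monoid M r) (discrete_monoid N)" "f (r `` {x}) \<noteq> f (r `` {y})"
    using pr unfolding profinite_monoid_def by meson
  have h: "(\<lambda>x. f (r `` {x})) \<in> chom M (discrete_monoid N)"
    by (rule chom_comp[OF quotient_proj_chom[OF M rc ts] f(1)])
  have "?r \<subseteq> r" using r by (auto simp: min_profinite_congruence_def)
  moreover have "r `` {a} = r `` {b}" if "(a, b) \<in> r" for a b
    using that rc equiv_class_eq[of "carrier M" r] by (simp add: congruence_on_def)
  ultimately have resp: "f (r `` {a}) = f (r `` {b})" if "(a, b) \<in> ?r" for a b
    using that by (metis subsetD)
  obtain g where g: "g \<in> chom (quotient_monoid M ?r) (discrete_monoid N)"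
    "\<And>x. x \<in> carrier M \<Longrightarrow> g (?r `` {x}) = f (r `` {x})"
    using quotient_lift[OF M cong ts h resp] by metis
  show thesis using that[OF N g(1)] g(2) f(2) xy by simp
qed

lemma Hausdorff_min_quotient: "Hausdorff_space (topol (quotient_monoid M (min_profinite_congruence M R)))"
  (is "Hausdorff_space ?T")
  unfolding Hausdorff_space_def
proof (intro allI impI)
  let ?Q = "quotient_monoid M (min_profinite_congruence M R)"
  fix A B assume AB: "A \<in> topspace ?T \<and> B \<in> topspace ?T \<and> A \<noteq> B"
  then obtain N :: "nat monoid" and g where g: "g \<in> chom ?Q (discrete_monoid N)" "g A \<noteq> g B"
    using min_quotient_separated[of A B] topspace_quotient[OF M congruence_on_min ts] by metis
  have c: "continuous_map ?T (discrete_topology (carrier N)) g"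
    using chomD(4)[OF g(1)] by simp
  show "\<exists>U V. openin ?T U \<and> openin ?T V \<and> A \<in> U \<and> B \<in> V \<and> disjnt U V"
    using AB g(2) continuous_map_discrete_openin[OF c, of "\<lambda>w. w = g A"] continuous_map_discrete_openin[OF c, of "\<lambda>w. w = g B"]
    by (intro exI[of _ "{x \<in> topspace ?T. g x = g A}"] exI[of _ "{x \<in> topspace ?T. g x = g B}"]) (auto simp: disjnt_def)
qed

end

text \<open>The map into the product of the finite targets decides all of them at once. It turns the
  finite family that compactness yields into a single finite quotient.\<close>

lemma common_refinement:
  assumes Q: "Group.monoid Q" "topspace (topol Q) = carrier Q" and "finite \<F>"
    and "\<And>N g. (N, g) \<in> \<F> \<Longrightarrow> Group.monoid N \<and> finite (carrier N) \<and> g \<in> chom Q (discrete_monoid (N :: nat monoid))"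
  obtains N :: "nat monoid" and g where "Group.monoid N" "finite (carrier N)" "g \<in> chom Q (discrete_monoid N)"
    "\<forall>p\<in>\<F>. \<forall>x\<in>carrier Q. \<forall>y\<in>carrier Q. g x = g y \<longrightarrow> snd p x = snd p y"
proof -
  have "\<exists>(N :: nat monoid) g. Group.monoid N \<and> finite (carrier N) \<and> g \<in> chom Q (discrete_monoid N) \<and>
    (\<forall>p\<in>\<F>. \<forall>x\<in>carrier Q. \<forall>y\<in>carrier Q. g x = g y \<longrightarrow> snd p x = snd p y)"
    using assms(3,4)
  proof (induction \<F> rule: finite_induct)
    case empty
    define N :: "nat monoid" where "N = \<lparr>carrier = {0}, mult = (\<lambda>_ _. 0), one = 0\<rparr>"
    have "Group.monoid N" "finite (carrier N)" by (auto simp: N_def intro: monoidI)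
    moreover have "(\<lambda>_. 0) \<in> chom Q (discrete_monoid N)"
      using Q(2) by (simp add: chom_def hom_def N_def)
    ultimately show ?case by blast
  next
    case (insert p \<F>)
    obtain N g where p: "p = (N, g)" by force
    have N: "Group.monoid N" "finite (carrier N)" and g: "g \<in> chom Q (discrete_monoid N)"
      using insert.prems[of N g] p by auto
    obtain N' :: "nat monoid" and g' where N': "Group.monoid N'" "finite (carrier N')" and g': "g' \<in> chom Q (discrete_monoid N')"
      and ref: "\<forall>p\<in>\<F>. \<forall>x\<in>carrier Q. \<forall>y\<in>carrier Q. g' x = g' y \<longrightarrow> snd p x = snd p y"
      using insert by (metis insertI2)
    have "finite (carrier (N \<times>\<times> N'))" using N(2) N'(2) by (simp add: DirProd_def)
    then obtain P :: "nat monoid" and e where P: "Group.monoid P" "finite (carrier P)"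
      and e: "e \<in> iso (N \<times>\<times> N') P" "e \<one>\<^bsub>N \<times>\<times> N'\<^esub> = \<one>\<^bsub>P\<^esub>"
      using ex_iso_nat_monoid[OF DirProd_monoid[OF N(1) N'(1)]] by metis
    have eh: "e (a, b) \<in> carrier P" "inj_on e (carrier (N \<times>\<times> N'))"
      "a' \<in> carrier N \<Longrightarrow> b' \<in> carrier N' \<Longrightarrow> e (a \<otimes>\<^bsub>N\<^esub> a', b \<otimes>\<^bsub>N'\<^esub> b') = e (a, b) \<otimes>\<^bsub>P\<^esub> e (a', b')"
      if "a \<in> carrier N" "b \<in> carrier N'" for a b a' b'
      using e(1) that by (auto simp: iso_def hom_def bij_betw_def DirProd_def)
    define h where "h x = e (g x, g' x)" for x
    have inj: "g x = g y \<and> g' x = g' y" if "x \<in> carrier Q" "y \<in> carrier Q" "h x = h y" for x y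
    proof -
      have "(g x, g' x) \<in> carrier (N \<times>\<times> N')" "(g y, g' y) \<in> carrier (N \<times>\<times> N')"
        using chomD(1)[OF g] chomD(1)[OF g'] that(1,2) by auto
      then have "(g x, g' x) = (g y, g' y)"
        using eh(2)[of "g x" "g' x"] that chomD(1)[OF g] chomD(1)[OF g'] unfolding h_def by (auto dest: inj_onD)
      then show ?thesis by simp
    qed
    have "continuous_map (topol Q) (discrete_topology (carrier P)) h"
    proof (rule continuous_map_into_discrete)
      show "h x \<in> carrier P" if "x \<in> topspace (topol Q)" for x
        using that chomD(1)[OF g] chomD(1)[OF g'] eh(1) by (simp add: Q(2) h_def)
      fix y assume "y \<in> carrier P"
      have cg: "openin (topol Q) {x \<in> topspace (topol Q). B (g x)}" for B
        using continuous_map_discrete_openin[of "topol Q" "carrier N" g] chomD(4)[OF g] by simp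
      have cg': "openin (topol Q) {x \<in> topspace (topol Q). B (g' x)}" for B
        using continuous_map_discrete_openin[of "topol Q" "carrier N'" g'] chomD(4)[OF g'] by simp
      have "{x \<in> topspace (topol Q). h x = y} =
        (\<Union>a. {x \<in> topspace (topol Q). g x = a} \<inter> {x \<in> topspace (topol Q). e (a, g' x) = y})"
        by (auto simp: h_def)
      also have "openin (topol Q) \<dots>" by (auto intro!: openin_Union openin_Int cg cg')
      finally show "openin (topol Q) {x \<in> topspace (topol Q). h x = y}" .
    qed
    moreover have "h \<one>\<^bsub>Q\<^esub> = \<one>\<^bsub>P\<^esub>"
      using e(2) chomD(3)[OF g] chomD(3)[OF g'] by (simp add: h_def DirProd_def)
    ultimately have "h \<in> chom Q (discrete_monoid P)"
      using chomD(1,2)[OF g] chomD(1,2)[OF g'] eh(1,3) by (auto simp: chom_def hom_def h_def)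
    moreover have "\<forall>q\<in>insert p \<F>. \<forall>x\<in>carrier Q. \<forall>y\<in>carrier Q. h x = h y \<longrightarrow> snd q x = snd q y"
      using inj ref p by (metis insertE snd_conv)
    ultimately show ?case using P by blast
  qed
  then show thesis by (elim exE conjE) (rule that)
qed

section \<open>Finite quotients of the free deformation\<close>

context number_field_closure
begin

text \<open>The roots of a monic integer polynomial of \<open>a\<close> are permuted by all
  automorphisms.\<close>

lemma ex_finite_stable_set:
  assumes "algebraic_int a"
  obtains A where "finite A" "a \<in> A" "\<forall>x\<in>A. algebraic_int x" "\<forall>\<sigma>\<in>galois_carrier K. \<forall>x\<in>A. \<sigma> x \<in> A"
proof -
  obtain p where p: "poly (map_poly of_int p) a = 0" "Polynomial.lead_coeff p = 1"
    using assms by (auto simp: algebraic_int_altdef_ipoly)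
  define A where "A = {x :: 'a. poly (map_poly of_int p) x = 0}"
  have "map_poly of_int p \<noteq> (0 :: 'a poly)" using p(2) by (auto simp: map_poly_eq_0_iff)
  then have "finite A" unfolding A_def by (rule poly_roots_finite)
  moreover have "algebraic_int x" if "x \<in> A" for x
    using that p(2) unfolding A_def algebraic_int_altdef_ipoly by blast
  moreover have "\<sigma> x \<in> A" if "\<sigma> \<in> galois_carrier K" "x \<in> A" for \<sigma> x
    using that by (simp add: A_def galois_poly galois_0)
  moreover have "a \<in> A" using p(1) by (simp add: A_def)
  ultimately show thesis using that[of A] by blast
qed

text \<open>If an inertia element at \<open>v\<close> moves a point of \<open>A\<close>, then
  \<open>v\<close> contains a nonzero difference of two points of \<open>A\<close>. There are
  finitely many differences, and each lies over finitely many primes of \<open>K\<close>; they do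
  the work of a discriminant.\<close>

lemma ramified_primes:
  assumes "finite A" and alg: "\<forall>x\<in>A. algebraic_int x"
    and stable: "\<forall>\<sigma>\<in>galois_carrier K. \<forall>x\<in>A. \<sigma> x \<in> A"
  shows "{v \<inter> K | v. v \<in> primes_of UNIV \<and> (\<exists>u\<in>inertia K v. \<exists>x\<in>A. u x \<noteq> x)} \<in> finite_prime_sets K"
    (is "?R \<in> _")
proof -
  have "?R \<subseteq> (\<Union>(x, y)\<in>{(x, y). x \<in> A \<and> y \<in> A \<and> x \<noteq> y}. {v \<inter> K |v. v \<in> primes_of UNIV \<and> y - x \<in> v})"
  proof
    fix P assume "P \<in> ?R"
    then obtain v u x where P: "P = v \<inter> K" "v \<in> primes_of UNIV" "u \<in> inertia K v" "x \<in> A" "u x \<noteq> x" by blast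
    then have "u x \<in> A" "u x - x \<in> v" using alg stable by (auto simp: inertia_eq power_mod_def)
    then show "P \<in> (\<Union>(x, y)\<in>{(x, y). x \<in> A \<and> y \<in> A \<and> x \<noteq> y}. {v \<inter> K |v. v \<in> primes_of UNIV \<and> y - x \<in> v})"
      using P by (intro UN_I[of "(x, u x)"]) auto
  qed
  moreover have "finite {(x, y). x \<in> A \<and> y \<in> A \<and> x \<noteq> y}"
    by (rule finite_subset[of _ "A \<times> A"]) (use assms(1) in auto)
  then have "finite (\<Union>(x, y)\<in>{(x, y). x \<in> A \<and> y \<in> A \<and> x \<noteq> y}. {v \<inter> K |v. v \<in> primes_of UNIV \<and> y - x \<in> v})"
    by (rule finite_UN_I) (auto intro!: finite_primes_under)
  ultimately have "finite ?R" by (rule finite_subset)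
  moreover have "?R \<subseteq> primes_of K" using prime_over_in_primes_of by blast
  ultimately show ?thesis by (simp add: finite_prime_sets_def)
qed

text \<open>The restrictions to \<open>A\<close> form a finite group, to which a zero is adjoined as
  the target for non-inertial elements. That \<open>e\<close> avoids the zero keeps it different
  from 1.\<close>

lemma restriction_monoid:
  assumes A: "finite A" and st: "\<forall>\<sigma>\<in>galois_carrier K. \<forall>x\<in>A. \<sigma> x \<in> A"
  obtains N :: "nat monoid" and z e where "Group.monoid N" "finite (carrier N)"
    "z \<in> carrier N" "\<forall>x\<in>carrier N. z \<otimes>\<^bsub>N\<^esub> x = z \<and> x \<otimes>\<^bsub>N\<^esub> z = z"
    "\<forall>\<sigma>\<in>galois_carrier K. e \<sigma> \<in> carrier N \<and> e \<sigma> \<noteq> z" "e id = \<one>\<^bsub>N\<^esub>"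
    "\<forall>\<sigma>\<in>galois_carrier K. \<forall>\<tau>\<in>galois_carrier K. e (\<sigma> \<circ> \<tau>) = e \<sigma> \<otimes>\<^bsub>N\<^esub> e \<tau>"
    "\<forall>\<sigma>\<in>galois_carrier K. \<forall>\<tau>\<in>galois_carrier K. e \<sigma> = e \<tau> \<longleftrightarrow> (\<forall>x\<in>A. \<sigma> x = \<tau> x)"
    "continuous_map (krull_topology K) (discrete_topology (carrier N)) e"
proof -
  have stable: "\<sigma> x \<in> A" if "\<sigma> \<in> galois_carrier K" "x \<in> A" for \<sigma> x
    using st that by blast
  define H where "H = (\<lambda>\<sigma>. restrict \<sigma> A) ` galois_carrier K"
  \<comment> \<open>\<open>None\<close> is the zero. Restricted maps make equality mean agreement on
    \<open>A\<close>; for empty \<open>A\<close> only zero and one remain.\<close>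
  define N0 :: "('a \<Rightarrow> 'a) option monoid" where
    "N0 = \<lparr>carrier = insert None (Some ` H),
      mult = (\<lambda>a b. case (a, b) of (Some f, Some g) \<Rightarrow> Some (compose A f g) | _ \<Rightarrow> None), one = Some (restrict id A)\<rparr>"
  have comp: "compose A (restrict \<sigma> A) (restrict \<tau> A) = restrict (\<sigma> \<circ> \<tau>) A" if "\<tau> \<in> galois_carrier K" for \<sigma> \<tau>
    using stable[OF that] by (auto simp: compose_def fun_eq_iff)
  have simps: "carrier N0 = insert None (Some ` H)" "\<one>\<^bsub>N0\<^esub> = Some (restrict id A)"
    "None \<otimes>\<^bsub>N0\<^esub> b = None" "a \<otimes>\<^bsub>N0\<^esub> None = None" "Some f \<otimes>\<^bsub>N0\<^esub> Some g = Some (compose A f g)" for a b f g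
    by (auto simp: N0_def split: option.splits)
  have HI: "restrict \<sigma> A \<in> H" if "\<sigma> \<in> galois_carrier K" for \<sigma> using that by (simp add: H_def)
  have "Group.monoid N0"
  proof (rule monoidI)
    show "a \<otimes>\<^bsub>N0\<^esub> b \<in> carrier N0" if "a \<in> carrier N0" "b \<in> carrier N0" for a b
      using that galois_comp by (auto simp: simps H_def comp)
    show "\<one>\<^bsub>N0\<^esub> \<in> carrier N0" using HI[OF galois_id] by (simp add: simps)
    show "a \<otimes>\<^bsub>N0\<^esub> b \<otimes>\<^bsub>N0\<^esub> c = a \<otimes>\<^bsub>N0\<^esub> (b \<otimes>\<^bsub>N0\<^esub> c)" if "a \<in> carrier N0" "b \<in> carrier N0" "c \<in> carrier N0" for a b c
      using that galois_comp by (auto simp: simps H_def comp o_assoc)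
    show "\<one>\<^bsub>N0\<^esub> \<otimes>\<^bsub>N0\<^esub> a = a" "a \<otimes>\<^bsub>N0\<^esub> \<one>\<^bsub>N0\<^esub> = a" if "a \<in> carrier N0" for a
      using that galois_id by (auto simp: simps H_def comp)
  qed
  moreover have "H \<subseteq> (\<Pi>\<^sub>E x\<in>A. A)" using stable by (auto simp: H_def)
  then have "finite H" by (rule finite_subset) (intro finite_PiE A)
  then have "finite (carrier N0)" by (simp add: simps)
  ultimately obtain N :: "nat monoid" and d where N: "Group.monoid N" "finite (carrier N)"
    and d: "d \<in> iso N0 N" "d \<one>\<^bsub>N0\<^esub> = \<one>\<^bsub>N\<^esub>"
    by (rule ex_iso_nat_monoid)
  have dc: "d a \<in> carrier N" if "a \<in> carrier N0" for a using d(1) that by (auto simp: iso_def hom_def)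
  have dm: "d (a \<otimes>\<^bsub>N0\<^esub> b) = d a \<otimes>\<^bsub>N\<^esub> d b" if "a \<in> carrier N0" "b \<in> carrier N0" for a b
    using d(1) that by (auto simp: iso_def hom_def)
  have dinj: "d a = d b \<longleftrightarrow> a = b" if "a \<in> carrier N0" "b \<in> carrier N0" for a b
    using d(1) that by (auto simp: iso_def bij_betw_def dest: inj_onD)
  have dsurj: "carrier N = d ` carrier N0" using d(1) by (simp add: iso_def bij_betw_def)
  define e where "e \<sigma> = d (Some (restrict \<sigma> A))" for \<sigma>
  have mem: "None \<in> carrier N0" "\<sigma> \<in> galois_carrier K \<Longrightarrow> Some (restrict \<sigma> A) \<in> carrier N0" for \<sigma>
    using HI by (auto simp: simps)
  have e_eq: "e \<sigma> = e \<tau> \<longleftrightarrow> (\<forall>x\<in>A. \<sigma> x = \<tau> x)" if "\<sigma> \<in> galois_carrier K" "\<tau> \<in> galois_carrier K" for \<sigma> \<tau>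
  proof -
    have "e \<sigma> = e \<tau> \<longleftrightarrow> restrict \<sigma> A = restrict \<tau> A"
      using dinj[OF mem(2)[OF that(1)] mem(2)[OF that(2)]] by (simp add: e_def)
    then show ?thesis by (metis restrict_apply' restrict_ext)
  qed
  have zN: "d None \<in> carrier N" using dc mem by blast
  have abs: "d None \<otimes>\<^bsub>N\<^esub> x = d None \<and> x \<otimes>\<^bsub>N\<^esub> d None = d None" if "x \<in> carrier N" for x
  proof -
    obtain a where a: "x = d a" "a \<in> carrier N0" using \<open>x \<in> carrier N\<close> dsurj by blast
    show ?thesis
      using dm[OF mem(1) a(2)] dm[OF a(2) mem(1)] by (simp add: a(1) simps)
  qed
  have eN: "e \<sigma> \<in> carrier N \<and> e \<sigma> \<noteq> d None" if "\<sigma> \<in> galois_carrier K" for \<sigma>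
    using dc mem that by (simp add: e_def dinj)
  have e1: "e id = \<one>\<^bsub>N\<^esub>" using d(2) by (simp add: e_def simps)
  have em: "e (\<sigma> \<circ> \<tau>) = e \<sigma> \<otimes>\<^bsub>N\<^esub> e \<tau>" if "\<sigma> \<in> galois_carrier K" "\<tau> \<in> galois_carrier K" for \<sigma> \<tau>
    using dm[OF mem(2)[OF that(1)] mem(2)[OF that(2)]] by (simp add: e_def simps comp[OF that(2)])
  have cont: "continuous_map (krull_topology K) (discrete_topology (carrier N)) e"
  proof (rule continuous_map_into_discrete)
    show "e \<sigma> \<in> carrier N" if "\<sigma> \<in> topspace (krull_topology K)" for \<sigma>
      using that dc mem by (simp add: e_def)
    fix y
    show "openin (krull_topology K) {\<sigma> \<in> topspace (krull_topology K). e \<sigma> = y}"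
    proof (cases "\<exists>\<tau>\<in>galois_carrier K. y = e \<tau>")
      case True
      then obtain \<tau> where \<tau>: "\<tau> \<in> galois_carrier K" "y = e \<tau>" by blast
      have "{\<sigma> \<in> topspace (krull_topology K). e \<sigma> = y} = topspace (krull_topology K) \<inter> (\<Inter>x\<in>A. {\<sigma> \<in> galois_carrier K. \<sigma> x = \<tau> x})"
        using e_eq \<tau> by auto
      also have "openin (krull_topology K) \<dots>"
        by (cases "A = {}") (auto intro!: openin_Int openin_INT2 openin_krull_eval A simp del: topspace_krull)
      finally show ?thesis .
    next
      case False
      then have "{\<sigma> \<in> topspace (krull_topology K). e \<sigma> = y} = {}" by auto
      then show ?thesis by (simp only: openin_empty)
    qed
  qed
  show thesis
    by (rule that[OF N zN _ _ e1 _ _ cont]) (use abs eN em e_eq in blast)+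
qed

lemma inertia_relationE:
  assumes "(x, y) \<in> inertia_relation K"
  obtains \<rho> \<sigma> v u where "x = (\<rho>, \<sigma>)" "y = (\<rho> \<otimes>\<^bsub>Qhat K\<^esub> Qhat_inj K v (Some u), inv_into UNIV u \<circ> \<sigma>)"
    "\<rho> \<in> carrier (Qhat K)" "\<sigma> \<in> galois_carrier K" "v \<in> primes_of UNIV" "u \<in> inertia K v" "u \<in> galois_carrier K"
    "Qhat_inj K v (Some u) \<in> carrier (Qhat K)" "Some u \<in> carrier (weil_compact K v)"
proof -
  obtain \<rho> \<sigma> v u where *: "x = (\<rho>, \<sigma>)" "y = (\<rho> \<otimes>\<^bsub>Qhat K\<^esub> Qhat_inj K v (Some u), inv\<^bsub>abs_galois K\<^esub> u \<otimes>\<^bsub>abs_galois K\<^esub> \<sigma>)"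
    "\<rho> \<in> carrier (Qhat K)" "\<sigma> \<in> galois_carrier K" "v \<in> primes_of UNIV" "u \<in> inertia K v"
    using assms unfolding inertia_relation_def by blast
  have u: "u \<in> galois_carrier K" using *(5,6) by (simp add: inertia_eq)
  have "Some u \<in> carrier (weil_compact K v)"
    using *(6) inertia_subset_weil[OF *(5)] by (auto simp: weil_compact_simps[OF *(5)])
  then show thesis
    using that * u Qhat_inj_carrier[OF *(5)] by (simp add: inv_abs_galois)
qed

lemma inertia_relation_subset:
  "inertia_relation K \<subseteq> carrier (Qhat_semidirect K) \<times> carrier (Qhat_semidirect K)"
proof -
  have "(x, y) \<in> carrier (Qhat_semidirect K) \<times> carrier (Qhat_semidirect K)" if "(x, y) \<in> inertia_relation K" for x y
    using that
  proof (rule inertia_relationE)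
    fix \<rho> \<sigma> v u
    assume *: "x = (\<rho>, \<sigma>)" "y = (\<rho> \<otimes>\<^bsub>Qhat K\<^esub> Qhat_inj K v (Some u), inv_into UNIV u \<circ> \<sigma>)"
      "\<rho> \<in> carrier (Qhat K)" "\<sigma> \<in> galois_carrier K" "u \<in> galois_carrier K" "Qhat_inj K v (Some u) \<in> carrier (Qhat K)"
    show ?thesis
      using monoid.m_closed[OF monoid_Qhat *(3,6)] galois_comp[OF galois_inv[OF *(5)] *(4)] * by simp
  qed
  then show ?thesis by auto
qed

text \<open>The quotient acts on the finite set \<open>A\<close>: inertia at the primes in \<open>S\<close> acts through the
  Galois group, everything else in the local monoids at these primes becomes the zero \<open>z\<close>, and the other
  local monoids are killed. This respects \<open>inertia_relation\<close> because the primes outside \<open>S\<close> are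
  unramified on \<open>A\<close>.\<close>

lemma finite_quotient:
  assumes A: "finite A" and st: "\<forall>\<sigma>\<in>galois_carrier K. \<forall>x\<in>A. \<sigma> x \<in> A"
    and S: "S \<in> finite_prime_sets K"
    and unram: "\<forall>v\<in>primes_of UNIV. v \<inter> K \<notin> S \<longrightarrow> (\<forall>u\<in>inertia K v. \<forall>x\<in>A. u x = x)"
  obtains N :: "nat monoid" and z \<phi> \<Psi> where "Group.monoid N" "finite (carrier N)" "z \<in> carrier N"
    "\<forall>x\<in>carrier N. z \<otimes>\<^bsub>N\<^esub> x = z \<and> x \<otimes>\<^bsub>N\<^esub> z = z" "z \<noteq> \<one>\<^bsub>N\<^esub>"
    "(N, \<phi>) \<in> free_targets (primes_over K S) (weil_compact K)"
    "\<forall>v\<in>primes_over K S. \<forall>x. x \<notin> Some ` inertia K v \<longrightarrow> \<phi> v x = z"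
    "\<Psi> \<in> chom (Qhat_semidirect K) (discrete_monoid N)" "\<forall>(x, y)\<in>inertia_relation K. \<Psi> x = \<Psi> y"
    "\<forall>\<rho>\<in>carrier (Qhat K). \<Psi> (\<rho>, id) = \<rho> S (N, \<phi>)"
    "\<forall>\<sigma>\<in>galois_carrier K. \<forall>\<tau>\<in>galois_carrier K.
       \<Psi> (\<one>\<^bsub>Qhat K\<^esub>, \<sigma>) = \<Psi> (\<one>\<^bsub>Qhat K\<^esub>, \<tau>) \<longrightarrow> (\<forall>x\<in>A. \<sigma> x = \<tau> x)"
proof -
  obtain N :: "nat monoid" and z e where N': "Group.monoid N" "finite (carrier N)" "z \<in> carrier N"
      "\<forall>x\<in>carrier N. z \<otimes>\<^bsub>N\<^esub> x = z \<and> x \<otimes>\<^bsub>N\<^esub> z = z"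
    and e': "\<forall>\<sigma>\<in>galois_carrier K. e \<sigma> \<in> carrier N \<and> e \<sigma> \<noteq> z" "e id = \<one>\<^bsub>N\<^esub>"
    and em': "\<forall>\<sigma>\<in>galois_carrier K. \<forall>\<tau>\<in>galois_carrier K. e (\<sigma> \<circ> \<tau>) = e \<sigma> \<otimes>\<^bsub>N\<^esub> e \<tau>"
    and e_eq': "\<forall>\<sigma>\<in>galois_carrier K. \<forall>\<tau>\<in>galois_carrier K. e \<sigma> = e \<tau> \<longleftrightarrow> (\<forall>x\<in>A. \<sigma> x = \<tau> x)"
    and ec: "continuous_map (krull_topology K) (discrete_topology (carrier N)) e"
    by (rule restriction_monoid[OF A st])
  note N = N'(1-3) N'(4)[rule_format] and e = e'(1)[rule_format] e'(2)
    and em = em'[rule_format] and e_eq = e_eq'[rule_format]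
  interpret N: Group.monoid N by (rule N)
  interpret Q: Group.monoid "Qhat K" by (rule monoid_Qhat)
  define \<phi> where "\<phi> v = case_option z (\<lambda>u. if u \<in> inertia K v then e u else z)" for v
  have gal: "u \<in> galois_carrier K" if "v \<in> primes_of UNIV" "u \<in> inertia K v" for u v
    using that by (simp add: inertia_eq)
  have "\<phi> v \<in> chom (weil_compact K v) (discrete_monoid N)" if "v \<in> primes_of UNIV" for v
    unfolding \<phi>_def using e em gal[OF that] by (intro weil_compact_chom[OF that N(1,3,4)] ec) auto
  then have p: "(N, \<phi>) \<in> free_targets (primes_over K S) (weil_compact K)"
    using N(1,2) primes_over_subset unfolding free_targets_def by blast
  have coord: "(\<lambda>y. y (N, \<phi>)) \<in> chom (QS K S) (discrete_monoid N)"
    unfolding QS_def by (rule free_product_coordinate(1)[OF p])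
  have coord_inj: "QS_inj K S v x (N, \<phi>) = \<phi> v x" if "v \<in> primes_over K S" for v x
    using that free_product_coordinate(2)[OF p that] by (simp add: QS_inj_def)
  have coordQ: "(\<lambda>\<rho>. \<rho> S (N, \<phi>)) \<in> chom (Qhat K) (discrete_monoid N)"
    by (rule chom_comp[OF Qhat_projection[OF S] coord])
  \<comment> \<open>The action of \<sigma> becomes conjugation by \<open>e \<sigma>\<close>, written
    without inverses in \<open>N\<close>. This is what makes \<open>\<Psi>\<close>
    multiplicative.\<close>
  have equiv: "QS_act K S \<sigma> y (N, \<phi>) \<otimes>\<^bsub>N\<^esub> e \<sigma> = e \<sigma> \<otimes>\<^bsub>N\<^esub> y (N, \<phi>)"
    if \<sigma>: "\<sigma> \<in> galois_carrier K" and y: "y \<in> carrier (QS K S)" for \<sigma> y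
  proof -
    note act = QS_act_chom[OF \<sigma>, of S]
    interpret QS: Group.monoid "QS K S" by (rule QS_monoid)
    have e\<sigma>: "e \<sigma> \<in> carrier N" using e \<sigma> by blast
    have c: "y (N, \<phi>) \<in> carrier N" "QS_act K S \<sigma> y (N, \<phi>) \<in> carrier N" if "y \<in> carrier (QS K S)" for y
      using chomD(1)[OF coord] chomD(1)[OF act] that by auto
    \<comment> \<open>The two sides need not be homomorphisms in y, so \<open>QS_ext\<close> does
      not apply; instead the solutions are shown to be a closed submonoid.\<close>
    have "y \<in> {y \<in> carrier (QS K S). QS_act K S \<sigma> y (N, \<phi>) \<otimes>\<^bsub>N\<^esub> e \<sigma> = e \<sigma> \<otimes>\<^bsub>N\<^esub> y (N, \<phi>)}"
    proof (rule QS_induct[OF _ _ _ _ _ y])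
      show "\<one>\<^bsub>QS K S\<^esub> \<in> {y \<in> carrier (QS K S). QS_act K S \<sigma> y (N, \<phi>) \<otimes>\<^bsub>N\<^esub> e \<sigma> = e \<sigma> \<otimes>\<^bsub>N\<^esub> y (N, \<phi>)}"
        using chomD(3)[OF act] chomD(3)[OF coord] e\<sigma> by simp
      fix y y'
      assume "y \<in> {y \<in> carrier (QS K S). QS_act K S \<sigma> y (N, \<phi>) \<otimes>\<^bsub>N\<^esub> e \<sigma> = e \<sigma> \<otimes>\<^bsub>N\<^esub> y (N, \<phi>)}"
        "y' \<in> {y \<in> carrier (QS K S). QS_act K S \<sigma> y (N, \<phi>) \<otimes>\<^bsub>N\<^esub> e \<sigma> = e \<sigma> \<otimes>\<^bsub>N\<^esub> y (N, \<phi>)}"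
      then have y: "y \<in> carrier (QS K S)" "QS_act K S \<sigma> y (N, \<phi>) \<otimes>\<^bsub>N\<^esub> e \<sigma> = e \<sigma> \<otimes>\<^bsub>N\<^esub> y (N, \<phi>)"
        and y': "y' \<in> carrier (QS K S)" "QS_act K S \<sigma> y' (N, \<phi>) \<otimes>\<^bsub>N\<^esub> e \<sigma> = e \<sigma> \<otimes>\<^bsub>N\<^esub> y' (N, \<phi>)" by auto
      have "QS_act K S \<sigma> (y \<otimes>\<^bsub>QS K S\<^esub> y') (N, \<phi>) \<otimes>\<^bsub>N\<^esub> e \<sigma> =
          QS_act K S \<sigma> y (N, \<phi>) \<otimes>\<^bsub>N\<^esub> (QS_act K S \<sigma> y' (N, \<phi>) \<otimes>\<^bsub>N\<^esub> e \<sigma>)"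
        using chomD(2)[OF act y(1) y'(1)] chomD(2)[OF coord chomD(1)[OF act y(1)] chomD(1)[OF act y'(1)]] c y(1) y'(1) e\<sigma>
        by (simp add: N.m_assoc)
      also have "\<dots> = (QS_act K S \<sigma> y (N, \<phi>) \<otimes>\<^bsub>N\<^esub> e \<sigma>) \<otimes>\<^bsub>N\<^esub> y' (N, \<phi>)"
        unfolding y'(2) using c y(1) y'(1) e\<sigma> by (simp add: N.m_assoc)
      also have "\<dots> = e \<sigma> \<otimes>\<^bsub>N\<^esub> (y \<otimes>\<^bsub>QS K S\<^esub> y') (N, \<phi>)"
        unfolding y(2) using chomD(2)[OF coord y(1) y'(1)] c y(1) y'(1) e\<sigma> by (simp add: N.m_assoc)
      finally show "y \<otimes>\<^bsub>QS K S\<^esub> y' \<in> {y \<in> carrier (QS K S). QS_act K S \<sigma> y (N, \<phi>) \<otimes>\<^bsub>N\<^esub> e \<sigma> = e \<sigma> \<otimes>\<^bsub>N\<^esub> y (N, \<phi>)}"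
        using y(1) y'(1) by simp
    next
      have "continuous_map (topol (QS K S)) (discrete_topology (carrier N)) (\<lambda>y. QS_act K S \<sigma> y (N, \<phi>) \<otimes>\<^bsub>N\<^esub> e \<sigma>)"
        using continuous_map_compose[OF chomD(4)[OF chom_comp[OF act coord]],
            of "discrete_topology (carrier N)" "\<lambda>w. w \<otimes>\<^bsub>N\<^esub> e \<sigma>"] e\<sigma> by (simp add: o_def)
      moreover have "continuous_map (topol (QS K S)) (discrete_topology (carrier N)) (\<lambda>y. e \<sigma> \<otimes>\<^bsub>N\<^esub> y (N, \<phi>))"
        using continuous_map_compose[OF chomD(4)[OF coord],
            of "discrete_topology (carrier N)" "\<lambda>w. e \<sigma> \<otimes>\<^bsub>N\<^esub> w"] e\<sigma> by (simp add: o_def)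
      ultimately show "closedin (topol (QS K S)) {y \<in> carrier (QS K S). QS_act K S \<sigma> y (N, \<phi>) \<otimes>\<^bsub>N\<^esub> e \<sigma> = e \<sigma> \<otimes>\<^bsub>N\<^esub> y (N, \<phi>)}"
        using closedin_continuous_maps_eq[of "discrete_topology (carrier N)" "topol (QS K S)"] by (simp add: topspace_QS)
    next
      fix v x assume vS: "v \<in> primes_over K S" and x: "x \<in> carrier (weil_compact K v)"
      then have v: "v \<in> primes_of UNIV" using primes_over_subset by blast
      have "\<phi> (\<sigma> ` v) (map_option (conj_by \<sigma>) x) \<otimes>\<^bsub>N\<^esub> e \<sigma> = e \<sigma> \<otimes>\<^bsub>N\<^esub> \<phi> v x"
      proof (cases "x \<in> Some ` inertia K v")
        case True
        then obtain u where u: "x = Some u" "u \<in> inertia K v" by blast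
        have "e (conj_by \<sigma> u) \<otimes>\<^bsub>N\<^esub> e \<sigma> = e (conj_by \<sigma> u \<circ> \<sigma>)"
          using em[OF conj_galois[OF \<sigma> gal[OF v u(2)]] \<sigma>] by simp
        also have "conj_by \<sigma> u \<circ> \<sigma> = \<sigma> \<circ> u" by (simp add: fun_eq_iff galois_inv_apply[OF \<sigma>])
        also have "e (\<sigma> \<circ> u) = e \<sigma> \<otimes>\<^bsub>N\<^esub> e u" by (rule em[OF \<sigma> gal[OF v u(2)]])
        finally have "e (conj_by \<sigma> u) \<otimes>\<^bsub>N\<^esub> e \<sigma> = e \<sigma> \<otimes>\<^bsub>N\<^esub> e u" .
        moreover have "\<phi> v x = e u" "\<phi> (\<sigma> ` v) (map_option (conj_by \<sigma>) x) = e (conj_by \<sigma> u)"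
          using u conj_inertia(1)[OF \<sigma> v, of u] by (simp_all add: \<phi>_def)
        ultimately show ?thesis by (simp only:)
      next
        case False
        then have "\<phi> v x = z" "\<phi> (\<sigma> ` v) (map_option (conj_by \<sigma>) x) = z"
          using conj_inertia(1)[OF \<sigma> v] by (auto simp: \<phi>_def split: option.splits)
        then show ?thesis using N(4) e\<sigma> by simp
      qed
      then show "QS_inj K S v x \<in> {y \<in> carrier (QS K S). QS_act K S \<sigma> y (N, \<phi>) \<otimes>\<^bsub>N\<^esub> e \<sigma> = e \<sigma> \<otimes>\<^bsub>N\<^esub> y (N, \<phi>)}"
        using chomD(1)[OF QS_inj_chom[OF v] x] galois_primes_over[OF \<sigma> v] vS
        by (simp add: QS_act_inj[OF \<sigma> v x] coord_inj)
    qed blast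
    then show ?thesis by blast
  qed
  define \<Psi> where "\<Psi> = (\<lambda>(\<rho>, \<sigma>). \<rho> S (N, \<phi>) \<otimes>\<^bsub>N\<^esub> e \<sigma>)"
  have \<Psi>c: "\<Psi> x \<in> carrier N" if "x \<in> carrier (Qhat_semidirect K)" for x
    using that chomD(1)[OF coordQ] e by (auto simp: \<Psi>_def)
  have "\<Psi> (x \<otimes>\<^bsub>Qhat_semidirect K\<^esub> y) = \<Psi> x \<otimes>\<^bsub>N\<^esub> \<Psi> y"
    if xy: "x \<in> carrier (Qhat_semidirect K)" "y \<in> carrier (Qhat_semidirect K)" for x y
  proof -
    obtain \<rho> \<sigma> \<rho>' \<sigma>' where x: "x = (\<rho>, \<sigma>)" and y: "y = (\<rho>', \<sigma>')" and \<rho>: "\<rho> \<in> carrier (Qhat K)" "\<rho>' \<in> carrier (Qhat K)"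
      and \<sigma>: "\<sigma> \<in> galois_carrier K" "\<sigma>' \<in> galois_carrier K"
      using xy by auto
    have c: "\<rho> S (N, \<phi>) \<in> carrier N" "\<rho>' S (N, \<phi>) \<in> carrier N" "e \<sigma> \<in> carrier N" "e \<sigma>' \<in> carrier N"
      using chomD(1)[OF coordQ] \<rho> e \<sigma> by auto
    have act: "Qhat_act K \<sigma> \<rho>' S = QS_act K S \<sigma> (\<rho>' S)" using S by (simp add: Qhat_act_def)
    have \<rho>S: "\<rho>' S \<in> carrier (QS K S)" by (rule chomD(1)[OF Qhat_projection[OF S] \<rho>(2)])
    have c': "QS_act K S \<sigma> (\<rho>' S) (N, \<phi>) \<in> carrier N"
      using chomD(1)[OF coord chomD(1)[OF QS_act_chom[OF \<sigma>(1)] \<rho>S]] by simp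
    have "\<Psi> (x \<otimes>\<^bsub>Qhat_semidirect K\<^esub> y) = (\<rho> S (N, \<phi>) \<otimes>\<^bsub>N\<^esub> QS_act K S \<sigma> (\<rho>' S) (N, \<phi>)) \<otimes>\<^bsub>N\<^esub> (e \<sigma> \<otimes>\<^bsub>N\<^esub> e \<sigma>')"
      using chomD(2)[OF coordQ \<rho>(1) Qhat_act_carrier[OF \<sigma>(1) \<rho>(2)]] em[OF \<sigma>] by (simp add: \<Psi>_def x y act)
    also have "\<dots> = \<rho> S (N, \<phi>) \<otimes>\<^bsub>N\<^esub> (QS_act K S \<sigma> (\<rho>' S) (N, \<phi>) \<otimes>\<^bsub>N\<^esub> e \<sigma>) \<otimes>\<^bsub>N\<^esub> e \<sigma>'"
      using c c' by (simp add: N.m_assoc)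
    also have "\<dots> = \<Psi> x \<otimes>\<^bsub>N\<^esub> \<Psi> y"
      unfolding equiv[OF \<sigma>(1) \<rho>S] using c by (simp add: \<Psi>_def x y N.m_assoc)
    finally show ?thesis .
  qed
  moreover have "\<Psi> \<one>\<^bsub>Qhat_semidirect K\<^esub> = \<one>\<^bsub>N\<^esub>"
    using chomD(3)[OF coordQ] e(2) by (simp add: \<Psi>_def)
  moreover have "continuous_map (topol (Qhat_semidirect K)) (discrete_topology (carrier N)) \<Psi>"
  proof -
    have "continuous_map (prod_topology (topol (Qhat K)) (krull_topology K))
        (prod_topology (discrete_topology (carrier N)) (discrete_topology (carrier N))) (\<lambda>(\<rho>, \<sigma>). (\<rho> S (N, \<phi>), e \<sigma>))"
      using chomD(4)[OF coordQ] ec by (simp add: continuous_map_prod_top)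
    moreover have "continuous_map (prod_topology (discrete_topology (carrier N)) (discrete_topology (carrier N)))
        (discrete_topology (carrier N)) (\<lambda>(a, b). a \<otimes>\<^bsub>N\<^esub> b)"
      by (auto simp: prod_topology_discrete_topology[symmetric])
    ultimately have "continuous_map (prod_topology (topol (Qhat K)) (krull_topology K)) (discrete_topology (carrier N))
        ((\<lambda>(a, b). a \<otimes>\<^bsub>N\<^esub> b) \<circ> (\<lambda>(\<rho>, \<sigma>). (\<rho> S (N, \<phi>), e \<sigma>)))"
      by (rule continuous_map_compose)
    moreover have "(\<lambda>(a, b). a \<otimes>\<^bsub>N\<^esub> b) \<circ> (\<lambda>(\<rho>, \<sigma>). (\<rho> S (N, \<phi>), e \<sigma>)) = \<Psi>"
      by (auto simp: \<Psi>_def fun_eq_iff)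
    ultimately show ?thesis by simp
  qed
  ultimately have \<Psi>: "\<Psi> \<in> chom (Qhat_semidirect K) (discrete_monoid N)"
    using \<Psi>c by (auto simp: chom_def hom_def)
  have resp: "\<Psi> x = \<Psi> y" if "(x, y) \<in> inertia_relation K" for x y
    using that
  proof (rule inertia_relationE)
    fix \<rho> \<sigma> v u
    assume x: "x = (\<rho>, \<sigma>)" and y: "y = (\<rho> \<otimes>\<^bsub>Qhat K\<^esub> Qhat_inj K v (Some u), inv_into UNIV u \<circ> \<sigma>)"
      and \<rho>: "\<rho> \<in> carrier (Qhat K)" and \<sigma>: "\<sigma> \<in> galois_carrier K" and v: "v \<in> primes_of UNIV"
      and u: "u \<in> inertia K v" "u \<in> galois_carrier K" "Qhat_inj K v (Some u) \<in> carrier (Qhat K)"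
    \<comment> \<open>An inertia element must have the same image locally and as a Galois element.
      Over \<open>S\<close> this is the choice of \<open>\<phi>\<close>; elsewhere the local image
      is 1, and so is \<open>e u\<close> because u fixes \<open>A\<close>.\<close>
    have inj: "Qhat_inj K v (Some u) S (N, \<phi>) = e u"
    proof (cases "v \<inter> K \<in> S")
      case True
      then have "v \<in> primes_over K S" using v by (simp add: primes_over_def)
      then show ?thesis using S u(1) by (simp add: Qhat_inj_def coord_inj \<phi>_def)
    next
      case False
      then have "v \<notin> primes_over K S" by (simp add: primes_over_def)
      then have "Qhat_inj K v (Some u) S (N, \<phi>) = \<one>\<^bsub>N\<^esub>"
        using S chomD(3)[OF coord] by (simp add: Qhat_inj_def QS_inj_one)
      also have "\<one>\<^bsub>N\<^esub> = e u"
      proof -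
        have "\<forall>x\<in>A. u x = x" using unram v False u(1) by blast
        then have "e id = e u" using e_eq[OF galois_id u(2)] by simp
        then show ?thesis using e(2) by simp
      qed
      finally show ?thesis .
    qed
    have c: "\<rho> S (N, \<phi>) \<in> carrier N" "e u \<in> carrier N" "e (inv_into UNIV u \<circ> \<sigma>) \<in> carrier N"
      using chomD(1)[OF coordQ] \<rho> e u galois_comp[OF galois_inv[OF u(2)] \<sigma>] by auto
    have "\<Psi> y = \<rho> S (N, \<phi>) \<otimes>\<^bsub>N\<^esub> (e u \<otimes>\<^bsub>N\<^esub> e (inv_into UNIV u \<circ> \<sigma>))"
      using chomD(2)[OF coordQ \<rho> u(3)] c by (simp add: \<Psi>_def y inj N.m_assoc)
    also have "e u \<otimes>\<^bsub>N\<^esub> e (inv_into UNIV u \<circ> \<sigma>) = e (u \<circ> (inv_into UNIV u \<circ> \<sigma>))"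
      by (rule em[OF u(2) galois_comp[OF galois_inv[OF u(2)] \<sigma>], symmetric])
    also have "u \<circ> (inv_into UNIV u \<circ> \<sigma>) = \<sigma>"
      by (simp add: fun_eq_iff galois_inv_apply[OF u(2)])
    finally show ?thesis by (simp add: \<Psi>_def x)
  qed
  have z1: "z \<noteq> \<one>\<^bsub>N\<^esub>" using e(1)[OF galois_id] e(2) by simp
  have kill: "\<forall>v\<in>primes_over K S. \<forall>x. x \<notin> Some ` inertia K v \<longrightarrow> \<phi> v x = z"
  proof (intro ballI allI impI)
    fix v x assume "x \<notin> Some ` inertia K v"
    then show "\<phi> v x = z" by (cases x) (auto simp: \<phi>_def)
  qed
  have \<Psi>\<rho>: "\<forall>\<rho>\<in>carrier (Qhat K). \<Psi> (\<rho>, id) = \<rho> S (N, \<phi>)"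
    using chomD(1)[OF coordQ] e(2) by (simp add: \<Psi>_def)
  have faith: "\<forall>\<sigma>\<in>galois_carrier K. \<forall>\<tau>\<in>galois_carrier K.
       \<Psi> (\<one>\<^bsub>Qhat K\<^esub>, \<sigma>) = \<Psi> (\<one>\<^bsub>Qhat K\<^esub>, \<tau>) \<longrightarrow> (\<forall>x\<in>A. \<sigma> x = \<tau> x)"
  proof (intro ballI impI)
    fix \<sigma> \<tau> x assume st: "\<sigma> \<in> galois_carrier K" "\<tau> \<in> galois_carrier K"
      "\<Psi> (\<one>\<^bsub>Qhat K\<^esub>, \<sigma>) = \<Psi> (\<one>\<^bsub>Qhat K\<^esub>, \<tau>)" and x: "x \<in> A"
    have "e \<sigma> = e \<tau>"
      using st chomD(3)[OF coordQ] e(1) by (simp add: \<Psi>_def)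
    then show "\<sigma> x = \<tau> x" using e_eq[OF st(1,2)] x by simp
  qed
  have "\<forall>(x, y)\<in>inertia_relation K. \<Psi> x = \<Psi> y" using resp by blast
  from that[OF N' z1 p kill \<Psi> this \<Psi>\<rho> faith] show thesis .
qed

end

text \<open>The natural map goes from the Galois group to the units, while the theorem asks for the
  opposite direction.\<close>

lemma top_iso_inverse:
  assumes M: "group M" and f: "f \<in> top_iso M N" and ts: "topspace (topol M) = carrier M"
  shows "inv_into (carrier M) f \<in> top_iso N M"
proof -
  have iso: "f \<in> iso M N" and hom: "homeomorphic_map (topol M) (topol N) f"
    using f by (auto simp: top_iso_def)
  have bij: "bij_betw f (carrier M) (carrier N)" using iso by (simp add: iso_def)
  obtain g where g: "homeomorphic_maps (topol M) (topol N) f g"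
    using hom unfolding homeomorphic_map_maps by blast
  have tN: "topspace (topol N) = carrier N"
    using homeomorphic_imp_surjective_map[OF hom] bij unfolding ts bij_betw_def by simp
  have "inv_into (carrier M) f y = g y" if "y \<in> carrier N" for y
  proof -
    have "f (g y) = y" "g y \<in> carrier M"
      using g that continuous_map_funspace[of "topol N" "topol M" g] unfolding homeomorphic_maps_def tN ts by auto
    then show ?thesis using inv_into_f_f[of f "carrier M" "g y"] bij by (simp add: bij_betw_def)
  qed
  then have "homeomorphic_maps (topol N) (topol M) (inv_into (carrier M) f) f"
    using homeomorphic_maps_eq[of "topol N" "topol M" g f "inv_into (carrier M) f" f] g
    unfolding homeomorphic_maps_sym[of "topol M"] tN by simp
  then show ?thesis
    using group.iso_set_sym[OF M iso] homeomorphic_map_maps by (auto simp: top_iso_def)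
qed

section \<open>The unit group\<close>

context number_field_closure
begin

definition deformation_class :: "'a Qhat_elem \<times> ('a \<Rightarrow> 'a) \<Rightarrow> ('a Qhat_elem \<times> ('a \<Rightarrow> 'a)) set" where
  "deformation_class x = min_profinite_congruence (Qhat_semidirect K) (inertia_relation K) `` {x}"

lemmas semidirect_facts = monoid_Qhat_semidirect topspace_Qhat_semidirect inertia_relation_subset

lemmas congruence_deformation = congruence_on_min[OF semidirect_facts]

lemma monoid_free_deformation: "Group.monoid (free_deformation K)"
  unfolding free_deformation_def by (rule monoid_quotient[OF semidirect_facts(1) congruence_deformation])

lemma topspace_free_deformation: "topspace (topol (free_deformation K)) = carrier (free_deformation K)"
  unfolding free_deformation_def
  by (rule topspace_quotient[OF semidirect_facts(1) congruence_deformation semidirect_facts(2)])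

lemma carrier_free_deformation: "carrier (free_deformation K) = deformation_class ` carrier (Qhat_semidirect K)"
  unfolding free_deformation_def quotient_simps[OF semidirect_facts(1) congruence_deformation]
  by (simp add: deformation_class_def)

lemma deformation_class_chom: "deformation_class \<in> chom (Qhat_semidirect K) (free_deformation K)"
  unfolding free_deformation_def deformation_class_def[abs_def]
  by (rule quotient_proj_chom[OF semidirect_facts(1) congruence_deformation semidirect_facts(2)])

lemma deformation_class_relation:
  assumes "(x, y) \<in> inertia_relation K"
  shows "deformation_class x = deformation_class y"
proof -
  have xy: "x \<in> carrier (Qhat_semidirect K)" "y \<in> carrier (Qhat_semidirect K)"
    using subsetD[OF inertia_relation_subset assms] by (simp_all only: mem_Times_iff fst_conv snd_conv)
  have "(x, y) \<in> min_profinite_congruence (Qhat_semidirect K) (inertia_relation K)"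
    using min_congruence_contains[OF semidirect_facts] assms by (rule subsetD)
  then show ?thesis
    unfolding deformation_class_def
    by (rule iffD2[OF congruence_class_eq_iff[OF semidirect_facts(1) congruence_deformation xy]])
qed

lemma deformation_lift:
  fixes N :: "nat monoid"
  assumes "Group.monoid N" "finite (carrier N)" "f \<in> chom (Qhat_semidirect K) (discrete_monoid N)"
    and "\<forall>(x, y)\<in>inertia_relation K. f x = f y"
  obtains g where "g \<in> chom (free_deformation K) (discrete_monoid N)"
    "\<forall>x\<in>carrier (Qhat_semidirect K). g (deformation_class x) = f x"
proof -
  have R: "f x = f y" if "(x, y) \<in> inertia_relation K" for x y
    using bspec[OF assms(4) that] by simp
  have resp: "f x = f y" if "(x, y) \<in> min_profinite_congruence (Qhat_semidirect K) (inertia_relation K)" for x y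
    by (rule min_congruence_respects[OF semidirect_facts assms(1-3) R that])
  obtain g where g: "g \<in> chom (free_deformation K) (discrete_monoid N)"
    "\<forall>x\<in>carrier (Qhat_semidirect K). g (deformation_class x) = f x"
    unfolding free_deformation_def deformation_class_def
    by (rule quotient_lift[OF semidirect_facts(1) congruence_deformation semidirect_facts(2) assms(3)]) (rule resp)
  show thesis by (rule that[OF g])
qed

definition galois_unit :: "('a \<Rightarrow> 'a) \<Rightarrow> ('a Qhat_elem \<times> ('a \<Rightarrow> 'a)) set" where
  "galois_unit \<sigma> = deformation_class (\<one>\<^bsub>Qhat K\<^esub>, \<sigma>)"

lemma one_Qhat: "\<one>\<^bsub>Qhat K\<^esub> \<in> carrier (Qhat K)"
  by (rule monoid.one_closed[OF monoid_Qhat])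

lemma galois_unit_chom: "galois_unit \<in> chom (abs_galois K) (free_deformation K)"
proof -
  have "continuous_map (krull_topology K) (prod_topology (topol (Qhat K)) (krull_topology K)) (\<lambda>\<sigma>. (\<one>\<^bsub>Qhat K\<^esub>, \<sigma>))"
    by (intro continuous_map_pairedI) (simp_all add: topspace_Qhat one_Qhat)
  then have "(\<lambda>\<sigma>. (\<one>\<^bsub>Qhat K\<^esub>, \<sigma>)) \<in> chom (abs_galois K) (Qhat_semidirect K)"
    by (simp add: chom_def hom_def one_Qhat Qhat_act_one monoid.l_one[OF monoid_Qhat])
  from chom_comp[OF this deformation_class_chom] show ?thesis
    by (simp add: galois_unit_def[abs_def])
qed

lemma galois_unit_Units:
  assumes "\<sigma> \<in> galois_carrier K"
  shows "galois_unit \<sigma> \<in> Units (free_deformation K)"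
proof -
  note h = chomD[OF galois_unit_chom]
  have "galois_unit \<sigma> \<otimes>\<^bsub>free_deformation K\<^esub> galois_unit (inv_into UNIV \<sigma>) = \<one>\<^bsub>free_deformation K\<^esub>"
    "galois_unit (inv_into UNIV \<sigma>) \<otimes>\<^bsub>free_deformation K\<^esub> galois_unit \<sigma> = \<one>\<^bsub>free_deformation K\<^esub>"
    using h(2)[of \<sigma> "inv_into UNIV \<sigma>"] h(2)[of "inv_into UNIV \<sigma>" \<sigma>] h(3) assms galois_inv[OF assms]
      galois_inv_comp[OF assms] by simp_all
  then show ?thesis
    using h(1)[of \<sigma>] h(1)[of "inv_into UNIV \<sigma>"] assms galois_inv[OF assms] by (auto simp: Units_def)
qed

lemma galois_unit_inj: "inj_on galois_unit (galois_carrier K)"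
proof (rule inj_onI, rule ext)
  fix \<sigma> \<tau> and x :: 'a
  assume st: "\<sigma> \<in> galois_carrier K" "\<tau> \<in> galois_carrier K" "galois_unit \<sigma> = galois_unit \<tau>"
  \<comment> \<open>Finite quotients only control algebraic integers. Automorphisms fix the integer
    \<open>n\<close>, so it cancels at the end.\<close>
  obtain n :: int where n: "n \<noteq> 0" "algebraic_int (of_int n * x)" using ex_multiple[of x] by (elim exE conjE)
  obtain A where A: "finite A" "of_int n * x \<in> A" "\<forall>x\<in>A. algebraic_int x"
    and stable: "\<forall>\<sigma>\<in>galois_carrier K. \<forall>x\<in>A. \<sigma> x \<in> A"
    by (rule ex_finite_stable_set[OF n(2)])
  define S where "S = {v \<inter> K | v. v \<in> primes_of UNIV \<and> (\<exists>u\<in>inertia K v. \<exists>x\<in>A. u x \<noteq> x)}"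
  have S: "S \<in> finite_prime_sets K" unfolding S_def by (rule ramified_primes[OF A(1,3) stable])
  have unram: "\<forall>v\<in>primes_of UNIV. v \<inter> K \<notin> S \<longrightarrow> (\<forall>u\<in>inertia K v. \<forall>x\<in>A. u x = x)"
    unfolding S_def by blast
  obtain N :: "nat monoid" and z \<phi> \<Psi> where N: "Group.monoid N" "finite (carrier N)"
    and \<Psi>: "\<Psi> \<in> chom (Qhat_semidirect K) (discrete_monoid N)" "\<forall>(x, y)\<in>inertia_relation K. \<Psi> x = \<Psi> y"
    and faith: "\<forall>\<sigma>\<in>galois_carrier K. \<forall>\<tau>\<in>galois_carrier K.
       \<Psi> (\<one>\<^bsub>Qhat K\<^esub>, \<sigma>) = \<Psi> (\<one>\<^bsub>Qhat K\<^esub>, \<tau>) \<longrightarrow> (\<forall>x\<in>A. \<sigma> x = \<tau> x)"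
    by (rule finite_quotient[OF A(1) stable S unram]) (rule that; assumption)
  obtain g where "\<forall>x\<in>carrier (Qhat_semidirect K). g (deformation_class x) = \<Psi> x"
    by (rule deformation_lift[OF N \<Psi>]) (rule that; assumption)
  then have "\<Psi> (\<one>\<^bsub>Qhat K\<^esub>, \<sigma>) = \<Psi> (\<one>\<^bsub>Qhat K\<^esub>, \<tau>)"
    using st one_Qhat unfolding galois_unit_def by (metis Qhat_semidirect_simps(1) mem_Sigma_iff)
  then have "\<sigma> (of_int n * x) = \<tau> (of_int n * x)" using faith st A(2) by blast
  then show "\<sigma> x = \<tau> x"
    using n(1) st by (simp add: galois_mult galois_of_int)
qed

text \<open>A finite quotient \<open>f\<close> of the deformation sees only the primes in some finite set \<open>S\<close>.
  Up to Galois elements, the local monoids at the primes in \<open>S\<close> are generated by elements that are killed by the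
  quotient with \<open>A = {}\<close>, so a unit, which cannot be killed, has the same image as a Galois element.\<close>

lemma unit_finite_quotient:
  fixes N :: "nat monoid"
  assumes \<rho>: "\<rho> \<in> carrier (Qhat K)" and unit: "deformation_class (\<rho>, id) \<in> Units (free_deformation K)"
    and N: "Group.monoid N" and g: "g \<in> chom (free_deformation K) (discrete_monoid N)"
  shows "\<exists>\<tau>\<in>galois_carrier K. g (deformation_class (\<rho>, id)) = g (galois_unit \<tau>)"
proof -
  define f where "f x = g (deformation_class (x, id))" for x
  have "(\<lambda>x. (x, id)) \<in> chom (Qhat K) (Qhat_semidirect K)"
  proof -
    have "continuous_map (topol (Qhat K)) (prod_topology (topol (Qhat K)) (krull_topology K)) (\<lambda>x. (x, id))"
      by (intro continuous_map_pairedI) (simp_all add: galois_id)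
    then show ?thesis by (simp add: chom_def hom_def galois_id Qhat_act_id)
  qed
  from chom_comp[OF chom_comp[OF this deformation_class_chom] g]
  have f: "f \<in> chom (Qhat K) (discrete_monoid N)" by (simp add: f_def[abs_def])
  note gal = chom_comp[OF galois_unit_chom g]
  obtain S where S: "S \<in> finite_prime_sets K"
    and fS: "\<forall>x\<in>carrier (Qhat K). \<forall>y\<in>carrier (Qhat K). x S = y S \<longrightarrow> f x = f y"
    using Qhat_factor[of "carrier N" f] chomD(4)[OF f] by auto
  \<comment> \<open>With \<open>A\<close> empty nothing is ramified, so any \<open>S\<close> is
    admissible; this quotient merely tells zero from nonzero.\<close>
  obtain N' :: "nat monoid" and z \<phi> \<Psi> where N': "Group.monoid N'" "finite (carrier N')" "z \<in> carrier N'"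
      "\<forall>x\<in>carrier N'. z \<otimes>\<^bsub>N'\<^esub> x = z \<and> x \<otimes>\<^bsub>N'\<^esub> z = z" "z \<noteq> \<one>\<^bsub>N'\<^esub>"
    and p: "(N', \<phi>) \<in> free_targets (primes_over K S) (weil_compact K)"
    and \<phi>: "\<forall>v\<in>primes_over K S. \<forall>x. x \<notin> Some ` inertia K v \<longrightarrow> \<phi> v x = z"
    and \<Psi>: "\<Psi> \<in> chom (Qhat_semidirect K) (discrete_monoid N')" "\<forall>(x, y)\<in>inertia_relation K. \<Psi> x = \<Psi> y"
    and \<Psi>\<rho>: "\<forall>\<rho>\<in>carrier (Qhat K). \<Psi> (\<rho>, id) = \<rho> S (N', \<phi>)"
    by (rule finite_quotient[of "{}", OF _ _ S]) simp_all
  have coord: "(\<lambda>y. y (N', \<phi>)) \<in> chom (QS K S) (discrete_monoid N')"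
    unfolding QS_def by (rule free_product_coordinate(1)[OF p])
  have pr: "(\<lambda>x. x S) \<in> chom (Qhat K) (QS K S)" by (rule Qhat_projection[OF S])
  \<comment> \<open>\<open>f\<close> lives on the limit, but generation by the local monoids is
    available in \<open>QS K S\<close>. Elements with a Galois image are therefore collected in the
    limit and then projected.\<close>
  define E where "E = {x \<in> carrier (Qhat K). \<exists>\<tau>\<in>galois_carrier K. f x = g (galois_unit \<tau>)}"
  \<comment> \<open>The first part is an ideal because \<open>z\<close> is absorbing, the second is
    the image of a submonoid; so the union is closed under products.\<close>
  define H where "H = {y \<in> carrier (QS K S). y (N', \<phi>) = z} \<union> (\<lambda>x. x S) ` E"
  have EH: "x S \<in> H" if "x \<in> E" for x using that by (auto simp: H_def)
  have "\<rho> S \<in> H"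
  proof (rule QS_induct[of H S])
    show "\<rho> S \<in> carrier (QS K S)" by (rule chomD(1)[OF pr \<rho>])
    show sub: "H \<subseteq> carrier (QS K S)" using chomD(1)[OF pr] by (auto simp: H_def E_def)
    have "f \<one>\<^bsub>Qhat K\<^esub> = g (galois_unit id)" by (simp add: f_def galois_unit_def)
    then have "\<one>\<^bsub>Qhat K\<^esub> \<in> E" using one_Qhat galois_id by (auto simp: E_def)
    from EH[OF this] show "\<one>\<^bsub>QS K S\<^esub> \<in> H" unfolding chomD(3)[OF pr] .
    show "x \<otimes>\<^bsub>QS K S\<^esub> y \<in> H" if x: "x \<in> H" and y: "y \<in> H" for x y
    proof (cases "x (N', \<phi>) = z \<or> y (N', \<phi>) = z")
      case True
      have xy: "x \<in> carrier (QS K S)" "y \<in> carrier (QS K S)" using x y sub by auto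
      have "(x \<otimes>\<^bsub>QS K S\<^esub> y) (N', \<phi>) = z"
        using True chomD(2)[OF coord xy] chomD(1)[OF coord] xy N'(4) by auto
      then show ?thesis using monoid.m_closed[OF QS_monoid xy] by (simp add: H_def)
    next
      case False
      then obtain a b where a: "a \<in> E" "x = a S" and b: "b \<in> E" "y = b S" using x y by (auto simp: H_def)
      obtain \<sigma> \<tau> where st: "\<sigma> \<in> galois_carrier K" "f a = g (galois_unit \<sigma>)" "\<tau> \<in> galois_carrier K" "f b = g (galois_unit \<tau>)"
        using a(1) b(1) by (auto simp: E_def)
      have ab: "a \<in> carrier (Qhat K)" "b \<in> carrier (Qhat K)" using a b by (auto simp: E_def)
      have "f (a \<otimes>\<^bsub>Qhat K\<^esub> b) = g (galois_unit (\<sigma> \<circ> \<tau>))"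
        using chomD(2)[OF f ab] chomD(2)[OF gal, of \<sigma> \<tau>] st by simp
      then have "a \<otimes>\<^bsub>Qhat K\<^esub> b \<in> E"
        using monoid.m_closed[OF monoid_Qhat ab] galois_comp[OF st(1,3)] by (auto simp: E_def)
      moreover have "x \<otimes>\<^bsub>QS K S\<^esub> y = (a \<otimes>\<^bsub>Qhat K\<^esub> b) S" using chomD(2)[OF pr ab] a b by simp
      ultimately show ?thesis unfolding H_def by blast
    qed
    show "closedin (topol (QS K S)) H"
      unfolding H_def
    proof (rule closedin_Un)
      show "closedin (topol (QS K S)) {y \<in> carrier (QS K S). y (N', \<phi>) = z}"
        using continuous_map_discrete_closedin[of "topol (QS K S)" "carrier N'" "\<lambda>y. y (N', \<phi>)" "\<lambda>w. w = z"]
          chomD(4)[OF coord] by (simp add: topspace_QS)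
      \<comment> \<open>Its projection is closed by compactness of the limit and the Hausdorff
        property of \<open>QS K S\<close>.\<close>
      have "closedin (topol (Qhat K)) E"
        using continuous_map_discrete_closedin[of "topol (Qhat K)" "carrier N" f "\<lambda>w. \<exists>\<tau>\<in>galois_carrier K. w = g (galois_unit \<tau>)"]
          chomD(4)[OF f] by (simp add: topspace_Qhat E_def)
      then have "compactin (topol (Qhat K)) E"
        by (rule closedin_compact_space[OF compact_space_Qhat])
      then have "compactin (topol (QS K S)) ((\<lambda>x. x S) ` E)"
        using chomD(4)[OF pr] by (rule image_compactin)
      then show "closedin (topol (QS K S)) ((\<lambda>x. x S) ` E)"
        by (rule compactin_imp_closedin[OF Hausdorff_QS])
    qed
    fix v x assume vS: "v \<in> primes_over K S" and x: "x \<in> carrier (weil_compact K v)"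
    then have v: "v \<in> primes_of UNIV" using primes_over_subset by blast
    show "QS_inj K S v x \<in> H"
    proof (cases "x \<in> Some ` inertia K v")
      case True
      then obtain u where u: "x = Some u" "u \<in> inertia K v" by blast
      then have uG: "u \<in> galois_carrier K" by (simp add: inertia_eq[OF v])
      have Q: "Qhat_inj K v x \<in> carrier (Qhat K)" by (rule Qhat_inj_carrier[OF v x])
      \<comment> \<open>The relation at (1, u) moves u from the Galois factor to the local
        monoid.\<close>
      have "((\<one>\<^bsub>Qhat K\<^esub>, u), (\<one>\<^bsub>Qhat K\<^esub> \<otimes>\<^bsub>Qhat K\<^esub> Qhat_inj K v (Some u), inv\<^bsub>abs_galois K\<^esub> u \<otimes>\<^bsub>abs_galois K\<^esub> u)) \<in> inertia_relation K"
        unfolding inertia_relation_def using one_Qhat uG v u(2) by blast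
      then have "((\<one>\<^bsub>Qhat K\<^esub>, u), (Qhat_inj K v x, id)) \<in> inertia_relation K"
        using monoid.l_one[OF monoid_Qhat Q] u(1) by (simp add: inv_abs_galois[OF uG] galois_inv_comp[OF uG])
      then have "f (Qhat_inj K v x) = g (galois_unit u)"
        using deformation_class_relation by (simp add: f_def galois_unit_def)
      then have "Qhat_inj K v x \<in> E" using Q uG by (auto simp: E_def)
      moreover have "QS_inj K S v x = Qhat_inj K v x S" using S by (simp add: Qhat_inj_def)
      ultimately show ?thesis unfolding H_def by blast
    next
      case False
      then have "QS_inj K S v x (N', \<phi>) = z"
        using \<phi> vS free_product_coordinate(2)[OF p vS] by (simp add: QS_inj_def)
      then show ?thesis using chomD(1)[OF QS_inj_chom[OF v] x] by (simp add: H_def)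
    qed
  qed
  \<comment> \<open>Homomorphisms preserve units, and an absorbing element other than 1 is not a
    unit.\<close>
  moreover have "\<rho> S (N', \<phi>) \<noteq> z"
  proof
    assume *: "\<rho> S (N', \<phi>) = z"
    obtain h where h: "h \<in> chom (free_deformation K) (discrete_monoid N')"
      "\<forall>x\<in>carrier (Qhat_semidirect K). h (deformation_class x) = \<Psi> x"
      by (rule deformation_lift[OF N'(1,2) \<Psi>])
    have hz: "h (deformation_class (\<rho>, id)) = z"
      using h(2) \<rho> galois_id \<Psi>\<rho> * by simp
    obtain w where w: "w \<in> carrier (free_deformation K)"
      "deformation_class (\<rho>, id) \<otimes>\<^bsub>free_deformation K\<^esub> w = \<one>\<^bsub>free_deformation K\<^esub>"
      "deformation_class (\<rho>, id) \<in> carrier (free_deformation K)"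
      using unit by (auto simp: Units_def)
    have "\<one>\<^bsub>N'\<^esub> = z \<otimes>\<^bsub>N'\<^esub> h w"
      using chomD(2)[OF h(1) w(3,1)] chomD(3)[OF h(1)] w(2) hz by simp
    also have "\<dots> = z" using N'(4) chomD(1)[OF h(1) w(1)] by simp
    finally show False using N'(5) by simp
  qed
  \<comment> \<open>\<open>x\<close> may differ from \<rho>, but they agree at \<open>S\<close>,
    which is all that \<open>f\<close> sees.\<close>
  ultimately obtain x where x: "x \<in> E" "x S = \<rho> S" by (auto simp: H_def)
  then have xQ: "x \<in> carrier (Qhat K)" by (simp add: E_def)
  obtain \<tau> where \<tau>: "\<tau> \<in> galois_carrier K" "f x = g (galois_unit \<tau>)" using x(1) unfolding E_def by blast
  have "f \<rho> = g (galois_unit \<tau>)"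
    using bspec[OF bspec[OF fS xQ] \<rho>] x(2) \<tau>(2) by simp
  then show ?thesis using \<tau>(1) unfolding f_def by blast
qed

text \<open>Dividing by a Galois unit leaves a unit \<open>w\<close> represented by (\<rho>, id). In
  each finite quotient \<open>w\<close> agrees with some Galois unit; compactness makes one Galois
  unit work for all quotients, and the quotients separate points.\<close>

lemma Units_eq: "Units (free_deformation K) = galois_unit ` galois_carrier K"
proof
  let ?D = "free_deformation K"
  interpret D: Group.monoid ?D by (rule monoid_free_deformation)
  show "Units ?D \<subseteq> galois_unit ` galois_carrier K"
  proof
    fix u assume u: "u \<in> Units ?D"
    then obtain \<rho> \<sigma> where u_eq: "u = deformation_class (\<rho>, \<sigma>)" and \<rho>: "\<rho> \<in> carrier (Qhat K)" and \<sigma>: "\<sigma> \<in> galois_carrier K"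
      using D.Units_closed[OF u] by (auto simp: carrier_free_deformation)
    define w where "w = deformation_class (\<rho>, id)"
    have prod: "deformation_class (\<rho>, id) \<otimes>\<^bsub>?D\<^esub> galois_unit \<tau> = deformation_class (\<rho>, \<tau>)" if "\<tau> \<in> galois_carrier K" for \<tau>
      using chomD(2)[OF deformation_class_chom, of "(\<rho>, id)" "(\<one>\<^bsub>Qhat K\<^esub>, \<tau>)"] \<rho> that galois_id one_Qhat
      by (simp add: galois_unit_def Qhat_act_id monoid.r_one[OF monoid_Qhat])
    have wc: "w \<in> carrier ?D" using \<rho> galois_id by (simp add: w_def carrier_free_deformation)
    have "w \<in> Units ?D"
    proof -
      let ?s = "galois_unit \<sigma>"
      have s: "?s \<in> Units ?D" by (rule galois_unit_Units[OF \<sigma>])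
      have "w = u \<otimes>\<^bsub>?D\<^esub> inv\<^bsub>?D\<^esub> ?s"
        unfolding u_eq prod[OF \<sigma>, symmetric] w_def[symmetric]
        using wc s D.Units_closed[OF s] D.Units_inv_closed[OF s] by (simp add: D.m_assoc)
      then show ?thesis using u s by simp
    qed
    have "w \<in> galois_unit ` galois_carrier K"
    proof (rule ccontr)
      assume nw: "w \<notin> galois_unit ` galois_carrier K"
      \<comment> \<open>On each of these open sets a single finite quotient separates
        \<open>w\<close> from all Galois units.\<close>
      define \<W> where "\<W> = {U. openin (krull_topology K) U \<and> (\<exists>(N :: nat monoid) g. Group.monoid N \<and> finite (carrier N) \<and>
        g \<in> chom ?D (discrete_monoid N) \<and> (\<forall>\<tau>\<in>U. g (galois_unit \<tau>) \<noteq> g w))}"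
      have "\<exists>U\<in>\<W>. \<tau> \<in> U" if \<tau>: "\<tau> \<in> galois_carrier K" for \<tau>
      proof -
        have "galois_unit \<tau> \<in> carrier ?D" "galois_unit \<tau> \<noteq> w"
          using chomD(1)[OF galois_unit_chom] \<tau> nw by auto
        then obtain N :: "nat monoid" and g where N: "Group.monoid N" "finite (carrier N)"
          and g: "g \<in> chom ?D (discrete_monoid N)" "g (galois_unit \<tau>) \<noteq> g w"
          using min_quotient_separated[OF semidirect_facts, of "galois_unit \<tau>" w] wc unfolding free_deformation_def by metis
        have "openin (krull_topology K) {\<sigma> \<in> galois_carrier K. g (galois_unit \<sigma>) \<noteq> g w}"
          using continuous_map_discrete_openin[of "krull_topology K" "carrier N" "\<lambda>\<sigma>. g (galois_unit \<sigma>)" "\<lambda>x. x \<noteq> g w"]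
            chomD(4)[OF chom_comp[OF galois_unit_chom g(1)]] by simp
        then have "{\<sigma> \<in> galois_carrier K. g (galois_unit \<sigma>) \<noteq> g w} \<in> \<W>"
          unfolding \<W>_def mem_Collect_eq using N g(1)
          by (intro conjI exI[of _ N] exI[of _ g] ballI) simp_all
        then show ?thesis by (rule bexI[rotated]) (use \<tau> g(2) in simp)
      qed
      then have cover: "topspace (krull_topology K) \<subseteq> \<Union>\<W>" by auto
      have cpt: "compactin (krull_topology K) (topspace (krull_topology K))"
        using compact_space_krull by (simp add: compact_space_def)
      have op: "openin (krull_topology K) U" if "U \<in> \<W>" for U using that by (simp add: \<W>_def)
      have "\<exists>F. finite F \<and> F \<subseteq> \<W> \<and> topspace (krull_topology K) \<subseteq> \<Union>F"
        by (rule compactinD[OF cpt _ cover]) (rule op)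
      then obtain F where F: "finite F" "F \<subseteq> \<W>" "galois_carrier K \<subseteq> \<Union>F" by auto
      have "\<forall>U\<in>F. \<exists>q. Group.monoid (fst q :: nat monoid) \<and> finite (carrier (fst q)) \<and>
        snd q \<in> chom ?D (discrete_monoid (fst q)) \<and> (\<forall>\<tau>\<in>U. snd q (galois_unit \<tau>) \<noteq> snd q w)"
      proof
        fix U assume "U \<in> F"
        then have "U \<in> \<W>" using F(2) by blast
        then obtain N :: "nat monoid" and g where "Group.monoid N" "finite (carrier N)"
          "g \<in> chom ?D (discrete_monoid N)" "\<forall>\<tau>\<in>U. g (galois_unit \<tau>) \<noteq> g w"
          unfolding \<W>_def mem_Collect_eq by (elim exE conjE) (rule that)
        then show "\<exists>q. Group.monoid (fst q :: nat monoid) \<and> finite (carrier (fst q)) \<and>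
          snd q \<in> chom ?D (discrete_monoid (fst q)) \<and> (\<forall>\<tau>\<in>U. snd q (galois_unit \<tau>) \<noteq> snd q w)"
          by (intro exI[of _ "(N, g)"]) simp
      qed
      from bchoice[OF this] obtain q where q: "\<forall>U\<in>F. Group.monoid (fst (q U) :: nat monoid) \<and> finite (carrier (fst (q U))) \<and>
        snd (q U) \<in> chom ?D (discrete_monoid (fst (q U))) \<and> (\<forall>\<tau>\<in>U. snd (q U) (galois_unit \<tau>) \<noteq> snd (q U) w)" ..
      have fam: "Group.monoid N \<and> finite (carrier N) \<and> g \<in> chom ?D (discrete_monoid N)" if "(N, g) \<in> q ` F" for N g
      proof -
        obtain U where "U \<in> F" "q U = (N, g)" using \<open>(N, g) \<in> q ` F\<close> by auto
        then show ?thesis using q by (metis fst_conv snd_conv)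
      qed
      obtain N :: "nat monoid" and g where N: "Group.monoid N" "finite (carrier N)" "g \<in> chom ?D (discrete_monoid N)"
        and ref: "\<forall>p\<in>q ` F. \<forall>x\<in>carrier ?D. \<forall>y\<in>carrier ?D. g x = g y \<longrightarrow> snd p x = snd p y"
        by (rule common_refinement[OF monoid_free_deformation topspace_free_deformation finite_imageI[OF F(1), of q]]) (rule fam, assumption, rule that)
      obtain \<tau> where \<tau>: "\<tau> \<in> galois_carrier K" "g w = g (galois_unit \<tau>)"
        using unit_finite_quotient[OF \<rho> _ N(1,3)] \<open>w \<in> Units ?D\<close> unfolding w_def by blast
      \<comment> \<open>The refined quotient identifies \<open>w\<close> with the unit of \<tau>. So
        does the quotient attached to the set that contains \<tau>, which was chosen to separate
        them.\<close>
      obtain U where U: "U \<in> F" "\<tau> \<in> U" using F(3) \<tau>(1) by blast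
      have "galois_unit \<tau> \<in> carrier ?D" using chomD(1)[OF galois_unit_chom] \<tau>(1) by simp
      from bspec[OF bspec[OF bspec[OF ref imageI[OF U(1)]] wc] this]
      have "snd (q U) w = snd (q U) (galois_unit \<tau>)" using \<tau>(2) by (rule mp)
      moreover have "snd (q U) (galois_unit \<tau>) \<noteq> snd (q U) w" using bspec[OF q U(1)] U(2) by simp
      ultimately show False by simp
    qed
    then obtain \<tau> where \<tau>: "\<tau> \<in> galois_carrier K" "w = galois_unit \<tau>" by blast
    have "u = galois_unit (\<tau> \<circ> \<sigma>)"
      using prod[OF \<sigma>] \<tau> \<sigma> chomD(2)[OF galois_unit_chom, of \<tau> \<sigma>] by (simp add: u_eq w_def)
    then show "u \<in> galois_unit ` galois_carrier K" using galois_comp[OF \<tau>(1) \<sigma>] by blast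
  qed
qed (use galois_unit_Units in blast)

lemma unit_group_simps:
  "carrier (unit_group M) = Units M" "x \<otimes>\<^bsub>unit_group M\<^esub> y = x \<otimes>\<^bsub>M\<^esub> y"
  "topol (unit_group M) = subtopology (topol M) (Units M)"
  by (simp_all add: unit_group_def units_of_def monoid.defs)

text \<open>A continuous bijection from a compact space to a Hausdorff space; the latter because
  finite quotients separate the points of the deformation.\<close>

lemma galois_unit_top_iso: "galois_unit \<in> top_iso (abs_galois K) (unit_group (free_deformation K))"
proof -
  let ?D = "free_deformation K"
  have "galois_unit \<in> iso (abs_galois K) (unit_group ?D)"
    using galois_unit_inj galois_unit_Units chomD(2)[OF galois_unit_chom]
    by (auto simp: iso_def hom_def bij_betw_def unit_group_simps Units_eq)
  moreover have "homeomorphic_map (krull_topology K) (topol (unit_group ?D)) galois_unit"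
  proof (rule continuous_imp_homeomorphic_map)
    have sub: "Units ?D \<subseteq> topspace (topol ?D)"
      unfolding topspace_free_deformation by (auto simp: Units_def)
    show "continuous_map (krull_topology K) (topol (unit_group ?D)) galois_unit"
      using chomD(4)[OF galois_unit_chom] galois_unit_Units by (auto simp: unit_group_simps continuous_map_in_subtopology)
    show "compact_space (krull_topology K)" by (rule compact_space_krull)
    show "Hausdorff_space (topol (unit_group ?D))"
      unfolding unit_group_simps free_deformation_def
      by (intro Hausdorff_space_subtopology Hausdorff_min_quotient semidirect_facts)
    show "galois_unit ` topspace (krull_topology K) = topspace (topol (unit_group ?D))"
      using sub by (auto simp: unit_group_simps Units_eq)
    show "inj_on galois_unit (topspace (krull_topology K))" using galois_unit_inj by simp
  qed
  ultimately show ?thesis by (simp add: top_iso_def)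
qed

end

theorem theorem3p15:
  fixes K :: "'a::field_char_0 set"
  assumes "number_field K"
    and "algebraic_closure (ring_of_type_algebra :: 'a ring) K"
  shows "top_iso (unit_group (free_deformation K)) (abs_galois K) \<noteq> {}"
proof -
  interpret number_field_closure K by (rule number_field_closure.intro[OF assms])
  have "inv_into (carrier (abs_galois K)) galois_unit \<in> top_iso (unit_group (free_deformation K)) (abs_galois K)"
    by (rule top_iso_inverse[OF group_abs_galois galois_unit_top_iso]) simp
  then show ?thesis by blast
qed

end
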